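(* $\mathcal{P}_4(D_4)$ is the set of points $(p_1,p_2,p_3,q_1,q_2)\in\mathbb{R}^5$ satisfying $0\le p_1\le p_2\le p_3$, $p_1+p_2+p_3=1/2$, $0\le q_1\le q_2$, $q_1+q_2=1/2$, $q_1\le 2p_1$, and $q_2\le 2p_2$.
   Context: For a nondegenerate rank $n$ ring with homomorphisms $\sigma_i$ to $\mathbb{C}$, $|x|=\sqrt{\frac1n\sum|\sigma_i(x)|^2}$ and $\lambda_i$ is the smallest $r$ with $i+1$ linearly independent elements of length $\le r$. Pairs $(R,C)$: $R$ a nondegenerate quartic ring, $C$ a cubic resolvent ring of $R$ in Bhargava's sense; $\Delta=|\mathrm{Disc}(R)|$. $R$ is a $G$-ring if $\mathrm{Gal}(R\otimes\mathbb{Q})\cong G$ as permutation groups; $D_4\subseteq S_4$ is the dihedral group of order 8. $\mathcal{P}_4(G)$ is the set of limit points of $\{(\log_\Delta\lambda_1(R),\log_\Delta\lambda_2(R),\log_\Delta\lambda_3(R),\log_\Delta\lambda_1(C),\log_\Delta\lambda_2(C))\}$ over isomorphism classes of pairs $(R,C)$ with $R$ a $G$-ring. *)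

theory Defs
  imports
    "HOL-Analysis.Analysis"
    "HOL-Algebra.Sym_Groups"
    "HOL-Algebra.Generated_Rings"
    "HOL-Algebra.Generated_Fields"
    "HOL-Algebra.QuotRing"
    "Jordan_Normal_Form.VS_Connect"
begin

section \<open>Rings of rank n\<close>

definition int_comb :: "('a, 'b) ring_scheme \<Rightarrow> nat \<Rightarrow> (nat \<Rightarrow> 'a) \<Rightarrow> (nat \<Rightarrow> int) \<Rightarrow> 'a" where
  "int_comb R n b m = (\<Oplus>\<^bsub>R\<^esub> j \<in> {..<n}. [m j] \<cdot>\<^bsub>R\<^esub> b j)"

definition int_indep :: "('a, 'b) ring_scheme \<Rightarrow> nat \<Rightarrow> (nat \<Rightarrow> 'a) \<Rightarrow> bool" where
  "int_indep R n b \<longleftrightarrow> b \<in> {..<n} \<rightarrow> carrier R \<and>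
     (\<forall>m. int_comb R n b m = \<zero>\<^bsub>R\<^esub> \<longrightarrow> (\<forall>j<n. m j = 0))"

definition int_basis :: "('a, 'b) ring_scheme \<Rightarrow> nat \<Rightarrow> (nat \<Rightarrow> 'a) \<Rightarrow> bool" where
  "int_basis R n b \<longleftrightarrow> int_indep R n b \<and> (\<forall>x\<in>carrier R. \<exists>m. x = int_comb R n b m)"

definition rank_ring :: "nat \<Rightarrow> ('a, 'b) ring_scheme \<Rightarrow> bool" where
  "rank_ring n R \<longleftrightarrow> cring R \<and> (\<exists>b. int_basis R n b)"

definition coords :: "('a, 'b) ring_scheme \<Rightarrow> nat \<Rightarrow> (nat \<Rightarrow> 'a) \<Rightarrow> 'a \<Rightarrow> nat \<Rightarrow> int" where
  "coords R n b x = (THE m. m \<in> {..<n} \<rightarrow>\<^sub>E UNIV \<and> x = int_comb R n b m)"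

text \<open>The trace of multiplication by \<open>x\<close>, computed in the basis \<open>b\<close>.\<close>

definition ring_trace :: "('a, 'b) ring_scheme \<Rightarrow> nat \<Rightarrow> (nat \<Rightarrow> 'a) \<Rightarrow> 'a \<Rightarrow> int" where
  "ring_trace R n b x = (\<Sum>i<n. coords R n b (x \<otimes>\<^bsub>R\<^esub> b i) i)"

text \<open>The determinant of the trace form; its value is the same for every \<open>\<int>\<close>-basis.\<close>

definition ring_disc :: "nat \<Rightarrow> ('a, 'b) ring_scheme \<Rightarrow> int" where
  "ring_disc n R = (THE d. \<exists>b. int_basis R n b \<and>
     d = Determinant.det (Matrix.mat n n (\<lambda>(i, j). ring_trace R n b (b i \<otimes>\<^bsub>R\<^esub> b j))))"

definition nondegenerate :: "nat \<Rightarrow> ('a, 'b) ring_scheme \<Rightarrow> bool" where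
  "nondegenerate n R \<longleftrightarrow> rank_ring n R \<and> ring_disc n R \<noteq> 0"

section \<open>Length and successive minima\<close>

abbreviation complex_ring :: "complex ring" where
  "complex_ring \<equiv> class_ring"

text \<open>Unital ring homomorphisms to \<open>\<complex>\<close>. They are taken extensional on the carrier, so that there
  are exactly \<open>n\<close> of them when \<open>R\<close> is nondegenerate of rank \<open>n\<close>.\<close>

definition complex_homs :: "('a, 'b) ring_scheme \<Rightarrow> ('a \<Rightarrow> complex) set" where
  "complex_homs R = Ring.ring_hom R complex_ring \<inter> extensional (carrier R)"

definition ring_length :: "nat \<Rightarrow> ('a, 'b) ring_scheme \<Rightarrow> 'a \<Rightarrow> real" where
  "ring_length n R x = sqrt (1 / real n * (\<Sum>\<sigma>\<in>complex_homs R. (cmod (\<sigma> x))\<^sup>2))"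

definition succ_min :: "nat \<Rightarrow> ('a, 'b) ring_scheme \<Rightarrow> nat \<Rightarrow> real" where
  "succ_min n R i = (LEAST r. \<exists>v. int_indep R (Suc i) v \<and> (\<forall>j\<le>i. ring_length n R (v j) \<le> r))"

section \<open>Cubic resolvent rings\<close>

text \<open>The \<open>n!\<close> numberings of the homomorphisms of \<open>R\<close> to \<open>\<complex>\<close> by \<open>1, \<dots>, n\<close>.\<close>

definition numberings :: "nat \<Rightarrow> ('a, 'b) ring_scheme \<Rightarrow> (nat \<Rightarrow> 'a \<Rightarrow> complex) set" where
  "numberings n R = {e \<in> extensional {1..n}. bij_betw e {1..n} (complex_homs R)}"

text \<open>
  For nondegenerate \<open>R\<close> of rank \<open>n\<close>, the \<open>S\<^sub>n\<close>-closure of \<open>R\<close> tensored with \<open>\<complex>\<close> is the ring of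
  complex functions on the set of numberings: a homomorphism from the \<open>S\<^sub>n\<close>-closure to \<open>\<complex>\<close> is the
  same as a numbering \<open>e\<close>, and sends the \<open>i\<close>-th conjugate of \<open>x\<close> to \<open>e i x\<close>.
  The \<open>S\<^sub>n\<close>-closure, being torsion free, is a subring of it.
\<close>

definition closure_ring ::
    "nat \<Rightarrow> ('a, 'b) ring_scheme \<Rightarrow> ((nat \<Rightarrow> 'a \<Rightarrow> complex) \<Rightarrow> complex) ring" where
  "closure_ring n R =
     \<lparr>carrier = numberings n R \<rightarrow>\<^sub>E UNIV,
      mult = (\<lambda>f g. \<lambda>e\<in>numberings n R. f e * g e),
      one = (\<lambda>e\<in>numberings n R. 1),
      zero = (\<lambda>e\<in>numberings n R. 0),
      add = (\<lambda>f g. \<lambda>e\<in>numberings n R. f e + g e)\<rparr>"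

definition conjugate :: "nat \<Rightarrow> ('a, 'b) ring_scheme \<Rightarrow> nat \<Rightarrow> 'a \<Rightarrow> (nat \<Rightarrow> 'a \<Rightarrow> complex) \<Rightarrow> complex" where
  "conjugate n R i x = (\<lambda>e\<in>numberings n R. e i x)"

text \<open>Bhargava's \<open>\<phi>\<^sub>4\<^sub>,\<^sub>3(x) = x x' + x'' x'''\<close>.\<close>

definition phi43 :: "('a, 'b) ring_scheme \<Rightarrow> 'a \<Rightarrow> (nat \<Rightarrow> 'a \<Rightarrow> complex) \<Rightarrow> complex" where
  "phi43 R x =
     (conjugate 4 R 1 x \<otimes>\<^bsub>closure_ring 4 R\<^esub> conjugate 4 R 2 x) \<oplus>\<^bsub>closure_ring 4 R\<^esub>
     (conjugate 4 R 3 x \<otimes>\<^bsub>closure_ring 4 R\<^esub> conjugate 4 R 4 x)"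

definition cubic_invariant_ring ::
    "('a, 'b) ring_scheme \<Rightarrow> ((nat \<Rightarrow> 'a \<Rightarrow> complex) \<Rightarrow> complex) ring" where
  "cubic_invariant_ring R =
     (closure_ring 4 R)\<lparr>carrier := generate_ring (closure_ring 4 R) (phi43 R ` carrier R)\<rparr>"

text \<open>A cubic ring containing the cubic invariant ring and of the same discriminant as \<open>R\<close>
  (Bhargava's definition for nondegenerate \<open>R\<close>). Containment is an embedding since \<open>C\<close> is an
  abstract ring.\<close>

definition cubic_resolvent :: "('a, 'b) ring_scheme \<Rightarrow> ('c, 'd) ring_scheme \<Rightarrow> bool" where
  "cubic_resolvent R C \<longleftrightarrow> rank_ring 3 C \<and> ring_disc 3 C = ring_disc 4 R \<and>
     (\<exists>\<iota>\<in>Ring.ring_hom (cubic_invariant_ring R) C. inj_on \<iota> (carrier (cubic_invariant_ring R)))"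

section \<open>Galois groups\<close>

text \<open>The homomorphisms of \<open>R\<close> and of \<open>R \<otimes> \<rat>\<close> to \<open>\<complex>\<close> are the same. The Galois group of
  \<open>R \<otimes> \<rat>\<close> is that of the field generated by all their images; it permutes them by composition,
  and a numbering \<open>e\<close> turns it into a group of permutations of \<open>1, \<dots>, n\<close>.\<close>

definition splitting_field :: "('a, 'b) ring_scheme \<Rightarrow> complex ring" where
  "splitting_field R = complex_ring
     \<lparr>carrier := generate_field complex_ring (\<Union>\<sigma>\<in>complex_homs R. \<sigma> ` carrier R)\<rparr>"

definition galois_perms ::
    "nat \<Rightarrow> ('a, 'b) ring_scheme \<Rightarrow> (nat \<Rightarrow> 'a \<Rightarrow> complex) \<Rightarrow> (nat \<Rightarrow> nat) set" where
  "galois_perms n R e = {\<pi>. \<pi> permutes {1..n} \<and>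
     (\<exists>\<alpha>\<in>ring_iso (splitting_field R) (splitting_field R).
        \<forall>i\<in>{1..n}. \<forall>x\<in>carrier R. e (\<pi> i) x = \<alpha> (e i x))}"

text \<open>An isomorphism of permutation groups between the Galois group and \<open>G \<subseteq> S\<^sub>n\<close> is induced by a
  bijection of the sets acted on, that is, by a numbering.\<close>

definition G_ring :: "nat \<Rightarrow> (nat \<Rightarrow> nat) set \<Rightarrow> ('a, 'b) ring_scheme \<Rightarrow> bool" where
  "G_ring n G R \<longleftrightarrow> (\<exists>e\<in>numberings n R. galois_perms n R e = G)"

definition D4 :: "(nat \<Rightarrow> nat) set" where
  "D4 = generate (sym_group 4) {cycle_of_list [1, 2, 3, 4], Transposition.transpose 1 3}"

section \<open>The set of limit points\<close>

definition minima_point ::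
    "('a, 'b) ring_scheme \<Rightarrow> ('c, 'd) ring_scheme \<Rightarrow> real \<times> real \<times> real \<times> real \<times> real" where
  "minima_point R C = (let \<Delta> = real_of_int \<bar>ring_disc 4 R\<bar> in
     (log \<Delta> (succ_min 4 R 1), log \<Delta> (succ_min 4 R 2), log \<Delta> (succ_min 4 R 3),
      log \<Delta> (succ_min 3 C 1), log \<Delta> (succ_min 3 C 2)))"

text \<open>A ring of positive rank is countably infinite, so every isomorphism class of pairs is
  represented by rings on subsets of \<open>nat\<close>; \<open>minima_point\<close> only depends on the class.\<close>

definition P4 :: "(nat \<Rightarrow> nat) set \<Rightarrow> (real \<times> real \<times> real \<times> real \<times> real) set" where
  "P4 G = {p. p islimpt {minima_point R C | (R :: nat ring) (C :: nat ring).
     nondegenerate 4 R \<and> G_ring 4 G R \<and> cubic_resolvent R C}}"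

end

theory Submission
  imports Defs
begin

text \<open>
  A limit point comes from pairs \<open>(R, C)\<close> with \<open>\<Delta> \<rightarrow> \<infinity>\<close>: elements of bounded length are roots of
  finitely many integral polynomials, so bounded discriminant leaves finitely many values of the
  minima. Minkowski's second theorem gives \<open>p1 + p2 + p3 = q1 + q2 = 1/2\<close>. The bounds \<open>q1 \<le> 2 p1\<close>
  and \<open>q2 \<le> 2 p2\<close> follow from the quadratic map \<open>\<phi>: R/\<int> \<rightarrow> C/\<int>\<close>, since \<open>|\<phi>(x)| \<le> 2 |x|\<^sup>2\<close>: if
  \<open>\<phi>\<close> mapped the plane spanned by \<open>x\<close> and \<open>y\<close> into a line, three of the four points
  \<open>(\<sigma>(x), \<sigma>(y))\<close> would be collinear, and the four-cycle in the Galois group would make all four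
  collinear, against the independence of \<open>1, x, y\<close>.

  Conversely, the orders spanned by \<open>1, \<alpha>1, \<alpha>2, \<alpha>3\<close> with \<open>\<alpha>1\<^sup>2 = a\<^sup>2 b c\<close>, \<open>\<alpha>2\<^sup>2 = n b \<alpha>1\<close>,
  \<open>\<alpha>3\<^sup>2 = n c \<alpha>1\<close> and \<open>\<alpha>2 \<alpha>3 = n a b c\<close> in a pure quartic field have explicit cubic resolvents, and
  taking \<open>a, b, c, n\<close> to be powers of two of the right size realises every interior point.
\<close>


section \<open>Integer and complex linear algebra\<close>

text \<open>The inequalities of the region are what the family needs. With \<Delta> about 2^T,
  prescribing the minima makes a, n, b, c about 2 to the powers T (2 p1 - q1), T (p2 + p3 - q1), T
  (2 p2 - q2), T (2 p3 - q2); then q1 \<le> 2 p1 and q2 \<le> 2 p2 say that a and b can be integers.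
  Minkowski's second theorem is used only up to constants and in rank at most four. There greedily
  chosen short elements generate the ring apart from one degenerate case, so a reduction argument
  replaces volumes. The resolvent is an abstract ring that comes with an embedding of the invariant
  ring, and its complex embeddings have to be produced. The argument on collinear points shows that
  the invariant ring has full rank in C, so that evaluations at three numberings extend to C; the
  same argument yields the short independent elements of C. Only points with strict inequalities are
  approximated directly, because gaps growing with T absorb the rounding of the exponents. The
  remaining points are limits of these.\<close>

lemma det_fun_eq_0_iff:
  fixes f :: "nat \<Rightarrow> nat \<Rightarrow> 'a::idom"
  shows "Determinant.det (Matrix.mat n n (\<lambda>(i, j). f i j)) = 0 \<longleftrightarrow>
    (\<exists>c. (\<exists>j<n. c j \<noteq> 0) \<and> (\<forall>i<n. (\<Sum>j<n. f i j * c j) = 0))"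
    (is "?L \<longleftrightarrow> ?R")
proof -
  let ?A = "Matrix.mat n n (\<lambda>(i, j). f i j)"
  have mv: "(?A *\<^sub>v v = 0\<^sub>v n) = (\<forall>i<n. (\<Sum>j<n. f i j * vec_index v j) = 0)"
    if "v \<in> carrier_vec n" for v
    using that by (auto simp: vec_eq_iff scalar_prod_def atLeast0LessThan)
  have "?L \<longleftrightarrow> (\<exists>v. v \<in> carrier_vec n \<and> v \<noteq> 0\<^sub>v n \<and> ?A *\<^sub>v v = 0\<^sub>v n)"
    by (rule det_0_iff_vec_prod_zero) simp
  also have "\<dots> \<longleftrightarrow> ?R"
  proof
    assume "\<exists>v. v \<in> carrier_vec n \<and> v \<noteq> 0\<^sub>v n \<and> ?A *\<^sub>v v = 0\<^sub>v n"
    then obtain v where v: "v \<in> carrier_vec n" "v \<noteq> 0\<^sub>v n" "?A *\<^sub>v v = 0\<^sub>v n" by blast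
    then show ?R using mv[OF v(1)]
      by (intro exI[of _ "vec_index v"]) (auto simp: vec_eq_iff)
  next
    assume ?R
    then obtain c where c: "\<exists>j<n. c j \<noteq> 0" "\<forall>i<n. (\<Sum>j<n. f i j * c j) = 0" by blast
    have "Matrix.vec n c \<noteq> 0\<^sub>v n" using c(1) by (auto simp: vec_eq_iff)
    then show "\<exists>v. v \<in> carrier_vec n \<and> v \<noteq> 0\<^sub>v n \<and> ?A *\<^sub>v v = 0\<^sub>v n"
      using mv[of "Matrix.vec n c"] c(2) by (intro exI[of _ "Matrix.vec n c"]) auto
  qed
  finally show ?thesis .
qed

lemma det_fun_transpose:
  "Determinant.det (Matrix.mat n n (\<lambda>(i, j). f j i)) = Determinant.det (Matrix.mat n n (\<lambda>(i, j). f i j))"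
proof -
  have "(Matrix.mat n n (\<lambda>(i, j). f i j))\<^sup>T = Matrix.mat n n (\<lambda>(i, j). f j i)"
    by (auto intro!: eq_matI)
  then show ?thesis
    using det_transpose[of "Matrix.mat n n (\<lambda>(i, j). f i j)" n] by simp
qed

text \<open>Padding the matrix with a zero row makes it square, and its transpose kills the last
  unit vector. The kernel vector lies in the domain itself, so the lemma serves integer as well as
  complex relations.\<close>

lemma wide_kernel:
  fixes f :: "nat \<Rightarrow> nat \<Rightarrow> 'a::idom"
  shows "\<exists>c. (\<exists>j\<le>k. c j \<noteq> 0) \<and> (\<forall>i<k. (\<Sum>j\<le>k. f i j * c j) = 0)"
proof -
  let ?g = "\<lambda>i j. if i < k then f i j else 0"
  have "Determinant.det (Matrix.mat (Suc k) (Suc k) (\<lambda>(i, j). ?g j i)) = 0"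
    unfolding det_fun_eq_0_iff by (rule exI[of _ "\<lambda>j. if j = k then 1 else 0"]) auto
  then have "Determinant.det (Matrix.mat (Suc k) (Suc k) (\<lambda>(i, j). ?g i j)) = 0"
    by (simp add: det_fun_transpose[of _ ?g])
  then obtain c where c: "\<exists>j<Suc k. c j \<noteq> 0"
      "\<forall>i<Suc k. (\<Sum>j<Suc k. ?g i j * c j) = 0"
    unfolding det_fun_eq_0_iff by blast
  have "(\<Sum>j\<le>k. f i j * c j) = 0" if "i < k" for i
    using c(2)[rule_format, of i] that by (simp add: lessThan_Suc_atMost)
  with c(1) show ?thesis by (auto simp: less_Suc_eq_le)
qed

lemma det_fun_mult:
  fixes f g :: "nat \<Rightarrow> nat \<Rightarrow> 'a::comm_ring_1"
  shows "Determinant.det (Matrix.mat n n (\<lambda>(i, j). \<Sum>k<n. f i k * g k j)) =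
    Determinant.det (Matrix.mat n n (\<lambda>(i, j). f i j)) * Determinant.det (Matrix.mat n n (\<lambda>(i, j). g i j))"
proof -
  have "Matrix.mat n n (\<lambda>(i, j). \<Sum>k<n. f i k * g k j) =
      Matrix.mat n n (\<lambda>(i, j). f i j) * Matrix.mat n n (\<lambda>(i, j). g i j)"
    by (auto intro!: eq_matI simp: scalar_prod_def atLeast0LessThan)
  then show ?thesis by (simp add: det_mult[of _ n])
qed

lemma det_fun_of_int:
  "Determinant.det (Matrix.mat n n (\<lambda>(i, j). of_int (f i j))) =
    (of_int (Determinant.det (Matrix.mat n n (\<lambda>(i, j). f i j))) :: 'a::comm_ring_1)"
proof -
  have "Matrix.mat n n (\<lambda>(i, j). of_int (f i j)) =
      map_mat (of_int :: int \<Rightarrow> 'a) (Matrix.mat n n (\<lambda>(i, j). f i j))"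
    by (auto intro!: eq_matI)
  then show ?thesis by (simp add: of_int_hom.hom_det)
qed

lemma det_fun_inverse:
  fixes f :: "nat \<Rightarrow> nat \<Rightarrow> 'a::field"
  assumes "Determinant.det (Matrix.mat n n (\<lambda>(i, j). f i j)) \<noteq> 0"
  obtains g where "\<And>i j. i < n \<Longrightarrow> j < n \<Longrightarrow> (\<Sum>k<n. g i k * f k j) = (if i = j then 1 else 0)"
    and "\<And>i j. i < n \<Longrightarrow> j < n \<Longrightarrow> (\<Sum>k<n. f i k * g k j) = (if i = j then 1 else 0)"
proof -
  let ?A = "Matrix.mat n n (\<lambda>(i, j). f i j)"
  have "?A \<in> Units (ring_mat TYPE('a) n ())"
    by (rule det_non_zero_imp_unit[OF _ assms]) simp
  then obtain B where B: "B \<in> carrier_mat n n" "B * ?A = 1\<^sub>m n" "?A * B = 1\<^sub>m n"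
    by (auto simp: Units_def ring_mat_def)
  have "(\<Sum>k<n. B $$ (i, k) * f k j) = (if i = j then 1 else 0)" if "i < n" "j < n" for i j
    using arg_cong[OF B(2), of "\<lambda>M. M $$ (i, j)"] B(1) that
    by (simp add: scalar_prod_def atLeast0LessThan)
  moreover have "(\<Sum>k<n. f i k * B $$ (k, j)) = (if i = j then 1 else 0)" if "i < n" "j < n" for i j
    using arg_cong[OF B(3), of "\<lambda>M. M $$ (i, j)"] B(1) that
    by (simp add: scalar_prod_def atLeast0LessThan)
  ultimately show ?thesis by (rule that)
qed

section \<open>Homomorphisms to the complex numbers\<close>

lemma (in ring) int_comb_closed: "v \<in> {..<k} \<rightarrow> carrier R \<Longrightarrow> int_comb R k v c \<in> carrier R"
  by (auto simp: int_comb_def intro!: finsum_closed)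

context cring begin

lemma
  assumes h: "h \<in> Ring.ring_hom R complex_ring"
  shows chom_add: "\<lbrakk>x \<in> carrier R; y \<in> carrier R\<rbrakk> \<Longrightarrow> h (x \<oplus> y) = h x + h y"
    and chom_mult: "\<lbrakk>x \<in> carrier R; y \<in> carrier R\<rbrakk> \<Longrightarrow> h (x \<otimes> y) = h x * h y"
    and chom_one: "h \<one> = 1"
    and chom_zero: "h \<zero> = 0"
    and chom_minus: "\<lbrakk>x \<in> carrier R; y \<in> carrier R\<rbrakk> \<Longrightarrow> h (x \<ominus> y) = h x - h y"
    and chom_pow: "x \<in> carrier R \<Longrightarrow> h (x [^] (k::nat)) = h x ^ k"
    and chom_int: "x \<in> carrier R \<Longrightarrow> h ([(m::int)] \<cdot> x) = of_int m * h x"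
    and chom_comb: "v \<in> {..<k} \<rightarrow> carrier R \<Longrightarrow> h (int_comb R k v c) = (\<Sum>j<k. of_int (c j) * h (v j))"
proof -
  show add: "h (x \<oplus> y) = h x + h y" if "x \<in> carrier R" "y \<in> carrier R" for x y
    using ring_hom_add[OF h that] by simp
  show mult: "h (x \<otimes> y) = h x * h y" if "x \<in> carrier R" "y \<in> carrier R" for x y
    using ring_hom_mult[OF h that] by simp
  show one: "h \<one> = 1" using ring_hom_one[OF h] by simp
  show zero: "h \<zero> = 0" using add[of \<zero> \<zero>] by simp
  have um: "h (\<ominus> x) = - h x" if "x \<in> carrier R" for x
    using add[of x "\<ominus> x"] that zero by (simp add: r_neg add_eq_0_iff)
  show "h (x \<ominus> y) = h x - h y" if "x \<in> carrier R" "y \<in> carrier R" for x y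
    using that by (simp add: a_minus_def add um)
  show "h (x [^] (k::nat)) = h x ^ k" if "x \<in> carrier R" for x
    using that by (induction k) (simp_all add: one mult)
  have nat: "h ([(k::nat)] \<cdot> x) = of_nat k * h x" if "x \<in> carrier R" for x k
    using that by (induction k) (simp_all add: zero add algebra_simps)
  show int: "h ([(m::int)] \<cdot> x) = of_int m * h x" if "x \<in> carrier R" for x m
    using that
    by (cases "m \<ge> 0") (simp_all add: add_pow_int_ge add_pow_int_lt nat um)
  show "h (int_comb R k v c) = (\<Sum>j<k. of_int (c j) * h (v j))" if "v \<in> {..<k} \<rightarrow> carrier R"
    using that
  proof (induction k)
    case 0
    then show ?case by (simp add: int_comb_def zero)
  next
    case (Suc k)
    have v: "v \<in> {..<k} \<rightarrow> carrier R" "v k \<in> carrier R" using Suc.prems by auto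
    have "int_comb R (Suc k) v c = [c k] \<cdot> v k \<oplus> int_comb R k v c"
      using v by (auto simp: int_comb_def lessThan_Suc intro!: finsum_insert)
    moreover have "int_comb R k v c \<in> carrier R" "[c k] \<cdot> v k \<in> carrier R"
      using v by (auto simp: int_comb_def intro!: finsum_closed)
    ultimately show ?case using Suc.IH[OF v(1)] v by (simp add: add int)
  qed
qed

text \<open>Dedekind's independence of characters: subtracting \<open>h k y\<close> times the
  relation at x from the relation at \<open>y \<otimes> x\<close> removes the index k, where y is
  chosen to separate \<open>h i\<close> from \<open>h k\<close>.\<close>

lemma chom_independent:
  assumes "finite I" and "\<And>i. i \<in> I \<Longrightarrow> h i \<in> Ring.ring_hom R complex_ring"
    and "\<And>i j. \<lbrakk>i \<in> I; j \<in> I; i \<noteq> j\<rbrakk> \<Longrightarrow> \<exists>x\<in>carrier R. h i x \<noteq> h j x"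
    and "\<And>x. x \<in> carrier R \<Longrightarrow> (\<Sum>i\<in>I. c i * h i x) = 0"
    and "i \<in> I"
  shows "c i = 0"
  using assms
proof (induction I arbitrary: c i rule: finite_induct)
  case empty
  then show ?case by simp
next
  case (insert k I)
  have cI: "c i = 0" if i: "i \<in> I" for i
  proof -
    obtain y where y: "y \<in> carrier R" "h i y \<noteq> h k y"
      using insert.prems(2)[of i k] i insert.hyps by blast
    have "c i * (h i y - h k y) = 0"
    proof (rule insert.IH[of "\<lambda>i. c i * (h i y - h k y)" i])
      fix x assume x: "x \<in> carrier R"
      have 1: "c k * h k x + (\<Sum>i\<in>I. c i * h i x) = 0"
        using insert.prems(3)[OF x] insert.hyps by simp
      have "c k * h k (y \<otimes> x) + (\<Sum>i\<in>I. c i * h i (y \<otimes> x)) = 0"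
        using insert.prems(3)[of "y \<otimes> x"] insert.hyps x y by simp
      then have 2: "c k * (h k y * h k x) + (\<Sum>i\<in>I. c i * (h i y * h i x)) = 0"
        using x y insert.prems(1) by (simp add: chom_mult)
      have "(\<Sum>i\<in>I. c i * (h i y - h k y) * h i x) =
          (\<Sum>i\<in>I. c i * (h i y * h i x)) - h k y * (\<Sum>i\<in>I. c i * h i x)"
        by (simp add: sum_distrib_left sum_subtractf algebra_simps)
      also have "\<dots> = - (c k * (h k y * h k x)) - h k y * (- (c k * h k x))"
        using 1 2 by (simp only: add_eq_0_iff)
      finally show "(\<Sum>i\<in>I. c i * (h i y - h k y) * h i x) = 0" by simp
    qed (use insert.prems i in auto)
    then show ?thesis using y by simp
  qed
  have "c k = 0"
    using insert.prems(3)[of \<one>] insert.hyps cI insert.prems(1)[of k] by (simp add: chom_one)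
  with cI insert.prems show ?case by auto
qed

end

text \<open>The n distinct homomorphisms are part of the data: a numbering supplies them for the
  quartic ring, extended evaluations for the resolvent, explicit formulas for the family. That there
  are no others is then a theorem.\<close>

locale split_ring = cring R for R :: "('a, 'b) ring_scheme" (structure) +
  fixes n :: nat and s :: "nat \<Rightarrow> 'a \<Rightarrow> complex" and b :: "nat \<Rightarrow> 'a"
  assumes basis: "int_basis R n b"
    and homs: "\<And>i. i < n \<Longrightarrow> s i \<in> complex_homs R"
    and inj: "inj_on s {..<n}"
begin

definition emb_det :: "(nat \<Rightarrow> 'a) \<Rightarrow> complex" where
  "emb_det v = Determinant.det (Matrix.mat n n (\<lambda>(i, j). s i (v j)))"

lemma hom: "i < n \<Longrightarrow> s i \<in> Ring.ring_hom R complex_ring"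
  using homs by (auto simp: complex_homs_def)

lemma b_closed: "b \<in> {..<n} \<rightarrow> carrier R"
  using basis by (simp add: int_basis_def int_indep_def)

lemma b_closed' [simp]: "j < n \<Longrightarrow> b j \<in> carrier R"
  using b_closed by auto

lemma basis_expand:
  assumes "x \<in> carrier R"
  obtains m where "x = int_comb R n b m"
  using assms basis by (auto simp: int_basis_def)

lemma homs_differ:
  assumes "h \<in> complex_homs R" "g \<in> complex_homs R" "h \<noteq> g"
  shows "\<exists>x\<in>carrier R. h x \<noteq> g x"
  using assms extensionalityI[of h "carrier R" g] by (auto simp: complex_homs_def)

text \<open>A vanishing determinant is a complex relation between the homomorphisms on a basis,
  hence on all of R by additivity, against Dedekind.\<close>

lemma emb_det_basis: "emb_det b \<noteq> 0"
proof
  assume "emb_det b = 0"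
  then have "Determinant.det (Matrix.mat n n (\<lambda>(j, i). s i (b j))) = 0"
    by (simp add: emb_det_def det_fun_transpose[of n "\<lambda>j i. s i (b j)", symmetric])
  then obtain c where c: "\<exists>i<n. c i \<noteq> 0" "\<And>j. j < n \<Longrightarrow> (\<Sum>i<n. s i (b j) * c i) = 0"
    using det_fun_eq_0_iff[of n "\<lambda>j i. s i (b j)"] by auto
  have z: "(\<Sum>i<n. c i * s i x) = 0" if "x \<in> carrier R" for x
  proof -
    obtain m where x: "x = int_comb R n b m" using \<open>x \<in> carrier R\<close> by (rule basis_expand)
    have "(\<Sum>i<n. c i * s i x) = (\<Sum>i<n. \<Sum>j<n. of_int (m j) * (s i (b j) * c i))"
      by (rule sum.cong) (simp_all add: x chom_comb[OF hom b_closed] sum_distrib_left mult_ac)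
    also have "\<dots> = (\<Sum>j<n. of_int (m j) * (\<Sum>i<n. s i (b j) * c i))"
      by (subst sum.swap) (simp add: sum_distrib_left)
    finally show ?thesis using c(2) by simp
  qed
  have "c i = 0" if "i < n" for i
  proof (rule chom_independent[of "{..<n}" s c])
    fix i j assume ij: "i \<in> {..<n}" "j \<in> {..<n}" "i \<noteq> j"
    then have "s i \<noteq> s j" using inj by (auto simp: inj_on_def)
    then show "\<exists>x\<in>carrier R. s i x \<noteq> s j x" using ij by (intro homs_differ homs) auto
  qed (use that hom z in auto)
  with c(1) show False by blast
qed

text \<open>One more homomorphism would give n + 1 vectors of values on n basis elements. These are
  dependent, and the dependence extends to R.\<close>

lemma complex_homs_eq: "complex_homs R = s ` {..<n}"
proof
  show "s ` {..<n} \<subseteq> complex_homs R" using homs by auto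
  show "complex_homs R \<subseteq> s ` {..<n}"
  proof
    fix h assume h: "h \<in> complex_homs R"
    show "h \<in> s ` {..<n}"
    proof (rule ccontr)
      assume nh: "h \<notin> s ` {..<n}"
      define g where "g i = (if i < n then s i else h)" for i
      have gh: "g i \<in> complex_homs R" for i using h homs by (auto simp: g_def)
      obtain c where c: "\<exists>i\<le>n. c i \<noteq> 0" "\<forall>j<n. (\<Sum>i\<le>n. g i (b j) * c i) = 0"
        using wide_kernel[of n "\<lambda>j i. g i (b j)"] by blast
      have z: "(\<Sum>i\<in>{..n}. c i * g i x) = 0" if "x \<in> carrier R" for x
      proof -
        obtain m where x: "x = int_comb R n b m" using \<open>x \<in> carrier R\<close> by (rule basis_expand)
        have gr: "g i \<in> Ring.ring_hom R complex_ring" for i using gh by (auto simp: complex_homs_def)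
        have "(\<Sum>i\<in>{..n}. c i * g i x) = (\<Sum>i\<in>{..n}. \<Sum>j<n. of_int (m j) * (g i (b j) * c i))"
          by (rule sum.cong) (simp_all add: x chom_comb[OF gr b_closed] sum_distrib_left mult_ac)
        also have "\<dots> = (\<Sum>j<n. of_int (m j) * (\<Sum>i\<le>n. g i (b j) * c i))"
          by (subst sum.swap) (simp add: sum_distrib_left)
        finally show ?thesis using c(2) by simp
      qed
      have "c i = 0" if "i \<le> n" for i
      proof (rule chom_independent[of "{..n}" g c])
        fix i j assume "i \<in> {..n}" "j \<in> {..n}" "i \<noteq> j"
        then have "g i \<noteq> g j"
          using inj nh by (auto simp: g_def inj_on_def)
        then show "\<exists>x\<in>carrier R. g i x \<noteq> g j x" by (rule homs_differ[OF gh gh])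
      qed (use gh that z in \<open>auto simp: complex_homs_def\<close>)
      with c(1) show False by blast
    qed
  qed
qed

lemma homs_bij: "bij_betw s {..<n} (complex_homs R)"
  using inj by (simp add: complex_homs_eq bij_betw_def)

lemma comb_inj:
  assumes "\<And>i. i < n \<Longrightarrow> (\<Sum>j<n. c j * s i (b j)) = (\<Sum>j<n. d j * s i (b j))" "j < n"
  shows "c j = d j"
proof (rule ccontr)
  assume "c j \<noteq> d j"
  have "(\<Sum>j<n. s i (b j) * (c j - d j)) = 0" if "i < n" for i
    using assms(1)[OF that] by (simp add: right_diff_distrib sum_subtractf mult.commute)
  then have "emb_det b = 0"
    unfolding emb_det_def det_fun_eq_0_iff
    using assms(2) \<open>c j \<noteq> d j\<close> by (intro exI[of _ "\<lambda>j. c j - d j"]) auto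
  with emb_det_basis show False by simp
qed

lemma eq_if_homs_eq:
  assumes "x \<in> carrier R" "y \<in> carrier R" "\<And>i. i < n \<Longrightarrow> s i x = s i y"
  shows "x = y"
proof -
  obtain m where x: "x = int_comb R n b m" using assms(1) by (rule basis_expand)
  obtain k where y: "y = int_comb R n b k" using assms(2) by (rule basis_expand)
  have "of_int (m j) = (of_int (k j) :: complex)" if "j < n" for j
  proof (rule comb_inj[OF _ that])
    fix i assume "i < n"
    then show "(\<Sum>j<n. of_int (m j) * s i (b j)) = (\<Sum>j<n. of_int (k j) * s i (b j))"
      using assms(3)[of i] by (simp add: x y chom_comb[OF hom b_closed])
  qed
  then have "m j = k j" if "j < n" for j using that by simp
  then show ?thesis unfolding x y int_comb_def by (auto intro!: finsum_cong')
qed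

lemma int_indep_iff:
  "int_indep R k v \<longleftrightarrow> v \<in> {..<k} \<rightarrow> carrier R \<and>
    (\<forall>m. (\<forall>i<n. (\<Sum>j<k. of_int (m j) * s i (v j)) = 0) \<longrightarrow> (\<forall>j<k. m j = 0))"
proof -
  have "int_comb R k v m = \<zero> \<longleftrightarrow> (\<forall>i<n. (\<Sum>j<k. of_int (m j) * s i (v j)) = 0)"
    if v: "v \<in> {..<k} \<rightarrow> carrier R" for m
  proof -
    have "int_comb R k v m = \<zero> \<longleftrightarrow> (\<forall>i<n. s i (int_comb R k v m) = s i \<zero>)"
      using eq_if_homs_eq[OF int_comb_closed[OF v], of \<zero> m] by auto
    then show ?thesis by (simp add: chom_comb[OF hom v] chom_zero[OF hom])
  qed
  then show ?thesis unfolding int_indep_def by auto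
qed

lemma coords_expand:
  assumes "x \<in> carrier R"
  shows "int_comb R n b (coords R n b x) = x"
proof -
  obtain m where x: "x = int_comb R n b m" using assms by (rule basis_expand)
  \<comment> \<open>\<open>coords\<close> describes the coefficient function that is
    \<open>undefined\<close> outside \<open>{..<n}\<close>, so m has to be restricted to be the
    unique solution.\<close>
  let ?m = "\<lambda>j\<in>{..<n}. m j"
  have *: "int_comb R n b ?m = int_comb R n b m"
    unfolding int_comb_def by (auto intro!: finsum_cong')
  have "coords R n b x = ?m"
    unfolding coords_def
  proof (rule the_equality)
    show "?m \<in> {..<n} \<rightarrow>\<^sub>E UNIV \<and> x = int_comb R n b ?m" using x * by auto
    fix k assume k: "k \<in> {..<n} \<rightarrow>\<^sub>E UNIV \<and> x = int_comb R n b k"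
    have "of_int (k j) = (of_int (m j) :: complex)" if "j < n" for j
    proof (rule comb_inj[OF _ that])
      fix i assume "i < n"
      then show "(\<Sum>j<n. of_int (k j) * s i (b j)) = (\<Sum>j<n. of_int (m j) * s i (b j))"
        using arg_cong[of _ _ "s i", OF trans[OF x[symmetric] conjunct2[OF k]]]
        by (simp add: chom_comb[OF hom b_closed])
    qed
    then show "k = ?m" using k by (auto simp: PiE_def extensional_def fun_eq_iff)
  qed
  then show ?thesis using * x by simp
qed

lemma ring_trace_eq:
  assumes x: "x \<in> carrier R"
  shows "of_int (ring_trace R n b x) = (\<Sum>k<n. s k x)"
proof -
  \<comment> \<open>T is the matrix of multiplication by x. For each k the vector of values
    \<open>s k (b j)\<close> is an eigenvector with eigenvalue \<open>s k x\<close>, so inserting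
    the inverse matrix W turns the trace of T into the sum of the eigenvalues.\<close>
  define T where "T i j = (of_int (coords R n b (x \<otimes> b i) j) :: complex)" for i j
  have T: "(\<Sum>j<n. T i j * s k (b j)) = s k x * s k (b i)" if "i < n" "k < n" for i k
  proof -
    have "s k (int_comb R n b (coords R n b (x \<otimes> b i))) = s k (x \<otimes> b i)"
      using that x by (subst coords_expand) auto
    then show ?thesis using that x
      by (simp add: chom_comb[OF hom b_closed] chom_mult[OF hom] T_def)
  qed
  obtain W where W: "\<And>i j. i < n \<Longrightarrow> j < n \<Longrightarrow> (\<Sum>k<n. W i k * s k (b j)) = (if i = j then 1 else 0)"
    "\<And>i j. i < n \<Longrightarrow> j < n \<Longrightarrow> (\<Sum>k<n. s i (b k) * W k j) = (if i = j then 1 else 0)"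
    using emb_det_basis unfolding emb_det_def by (rule det_fun_inverse) blast
  have "of_int (ring_trace R n b x) = (\<Sum>i<n. T i i)" by (simp add: ring_trace_def T_def)
  also have "\<dots> = (\<Sum>i<n. \<Sum>j<n. T i j * (if i = j then 1 else 0))" by (simp add: mult_delta_right)
  also have "\<dots> = (\<Sum>i<n. \<Sum>j<n. T i j * (\<Sum>k<n. W i k * s k (b j)))"
    by (intro sum.cong refl) (simp add: W)
  also have "\<dots> = (\<Sum>i<n. \<Sum>k<n. W i k * (\<Sum>j<n. T i j * s k (b j)))"
    by (rule sum.cong[OF refl], subst (2) sum_distrib_left, subst sum_distrib_left,
        subst sum.swap) (simp add: mult_ac)
  also have "\<dots> = (\<Sum>i<n. \<Sum>k<n. s k x * (s k (b i) * W i k))"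
    by (intro sum.cong refl) (simp add: T mult_ac)
  also have "\<dots> = (\<Sum>k<n. s k x * (\<Sum>i<n. s k (b i) * W i k))"
    by (subst sum.swap) (simp add: sum_distrib_left)
  also have "\<dots> = (\<Sum>k<n. s k x)" by (simp add: W)
  finally show ?thesis .
qed

lemma trace_int:
  assumes "x \<in> carrier R"
  shows "(\<Sum>k<n. s k x) \<in> \<int>"
  using ring_trace_eq[OF assms, symmetric] by simp

lemma disc_basis:
  "of_int (Determinant.det (Matrix.mat n n (\<lambda>(i, j). ring_trace R n b (b i \<otimes> b j)))) = emb_det b ^ 2"
proof -
  have "(of_int (Determinant.det (Matrix.mat n n (\<lambda>(i, j). ring_trace R n b (b i \<otimes> b j)))) :: complex) =
      Determinant.det (Matrix.mat n n (\<lambda>(i, j). of_int (ring_trace R n b (b i \<otimes> b j))))"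
    by (rule det_fun_of_int[symmetric])
  also have "Matrix.mat n n (\<lambda>(i, j). of_int (ring_trace R n b (b i \<otimes> b j))) =
      Matrix.mat n n (\<lambda>(i, j). \<Sum>k<n. s k (b i) * s k (b j))"
    by (rule eq_matI) (simp_all add: ring_trace_eq chom_mult[OF hom])
  also have "Determinant.det \<dots> = emb_det b ^ 2"
    by (subst det_fun_mult[of n "\<lambda>i k. s k (b i)" "\<lambda>k j. s k (b j)"],
        subst det_fun_transpose[of n "\<lambda>k j. s k (b j)"]) (simp add: emb_det_def power2_eq_square)
  finally show ?thesis .
qed

text \<open>The factor d is the determinant of the integer coordinates of v in the basis b. When it
  is nonzero, its absolute value is the index of the sublattice spanned by v.\<close>

lemma emb_det_int_multiple:
  assumes v: "v \<in> {..<n} \<rightarrow> carrier R"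
  obtains d where "emb_det v = of_int d * emb_det b" "int_indep R n v \<Longrightarrow> d \<noteq> 0"
proof -
  have "\<forall>j\<in>{..<n}. \<exists>m. v j = int_comb R n b m" using basis_expand v by blast
  then obtain M where M: "\<And>j. j < n \<Longrightarrow> v j = int_comb R n b (M j)"
    by (metis lessThan_iff)
  define d where "d = Determinant.det (Matrix.mat n n (\<lambda>(k, j). M j k))"
  have e: "s i (v j) = (\<Sum>k<n. s i (b k) * of_int (M j k))" if "i < n" "j < n" for i j
    using that by (simp add: M chom_comb[OF hom b_closed] mult.commute)
  have "emb_det v = Determinant.det (Matrix.mat n n (\<lambda>(i, j). \<Sum>k<n. s i (b k) * of_int (M j k)))"
    unfolding emb_det_def by (rule arg_cong[of _ _ Determinant.det], rule eq_matI) (simp_all add: e)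
  also have "\<dots> = emb_det b * of_int d"
    unfolding d_def det_fun_of_int[of n "\<lambda>k j. M j k", symmetric]
    by (subst det_fun_mult) (simp add: emb_det_def)
  finally have "emb_det v = of_int d * emb_det b" by simp
  moreover have "d \<noteq> 0" if "int_indep R n v"
  proof
    assume "d = 0"
    then obtain c where c: "\<exists>j<n. c j \<noteq> 0" "\<And>k. k < n \<Longrightarrow> (\<Sum>j<n. M j k * c j) = 0"
      using det_fun_eq_0_iff[of n "\<lambda>k j. M j k"] by (auto simp: d_def)
    have "(\<Sum>j<n. of_int (c j) * s i (v j)) = 0" if "i < n" for i
    proof -
      have "(\<Sum>j<n. of_int (c j) * s i (v j)) = (\<Sum>j<n. \<Sum>k<n. s i (b k) * of_int (M j k * c j))"
        by (rule sum.cong) (simp_all add: e that sum_distrib_left mult_ac)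
      also have "\<dots> = (\<Sum>k<n. s i (b k) * of_int (\<Sum>j<n. M j k * c j))"
        by (subst sum.swap) (simp add: sum_distrib_left)
      finally show ?thesis using c(2) by simp
    qed
    then show False using \<open>int_indep R n v\<close> c(1) by (auto simp: int_indep_iff)
  qed
  ultimately show ?thesis by (rule that)
qed

lemma split_ring_basis: "int_basis R n v \<Longrightarrow> split_ring R n s v"
  using homs inj cring_axioms by (auto simp: split_ring_def split_ring_axioms_def)

text \<open>Each of two bases has integer coordinates in the other, so the two factors are mutually
  inverse integers. This is what makes the description of \<open>ring_disc\<close> unique.\<close>

lemma emb_det_basis_sq:
  assumes v: "int_basis R n v"
  shows "emb_det v ^ 2 = emb_det b ^ 2"
proof -
  interpret v: split_ring R n s v by (rule split_ring_basis[OF v])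
  obtain d where d: "emb_det v = of_int d * emb_det b"
    using emb_det_int_multiple[OF v.b_closed] by blast
  obtain d' where d': "emb_det b = of_int d' * emb_det v"
    using v.emb_det_int_multiple[OF b_closed] by blast
  have "(of_int (d * d') :: complex) * emb_det b = 1 * emb_det b"
    using d d' by (metis mult.assoc mult.commute mult_1 of_int_mult)
  then have "d * d' = 1"
    by (metis emb_det_basis mult_right_cancel of_int_1 of_int_eq_iff)
  then have "d = 1 \<or> d = -1" by (metis zmult_eq_1_iff)
  then show ?thesis using d by auto
qed

lemma ring_disc_eq: "of_int (ring_disc n R) = emb_det b ^ 2"
proof -
  let ?D = "\<lambda>b. Determinant.det (Matrix.mat n n (\<lambda>(i, j). ring_trace R n b (b i \<otimes> b j)))"
  have "ring_disc n R = ?D b"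
    unfolding ring_disc_def
  proof (rule the_equality)
    show "\<exists>v. int_basis R n v \<and> ?D b = ?D v" using basis by blast
    fix d assume "\<exists>v. int_basis R n v \<and> d = ?D v"
    then obtain v where v: "int_basis R n v" "d = ?D v" by blast
    interpret v: split_ring R n s v by (rule split_ring_basis[OF v(1)])
    have "(of_int d :: complex) = of_int (?D b)"
      using disc_basis v.disc_basis emb_det_basis_sq[OF v(1)] v(2) by simp
    then show "d = ?D b" by simp
  qed
  then show ?thesis by (simp add: disc_basis)
qed

lemma ring_disc_nonzero: "ring_disc n R \<noteq> 0"
  using ring_disc_eq emb_det_basis by auto

lemma rank_ring: "rank_ring n R"
  using basis cring_axioms by (auto simp: rank_ring_def)

lemma nondegenerate: "nondegenerate n R"
  using rank_ring ring_disc_nonzero by (simp add: nondegenerate_def)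

lemma ring_length_eq: "ring_length n R x = sqrt (1 / real n * (\<Sum>k<n. (cmod (s k x))\<^sup>2))"
proof -
  have "(\<Sum>\<sigma>\<in>complex_homs R. (cmod (\<sigma> x))\<^sup>2) = (\<Sum>k<n. (cmod (s k x))\<^sup>2)"
    using sum.reindex_bij_betw[OF homs_bij, of "\<lambda>\<sigma>. (cmod (\<sigma> x))\<^sup>2"] by simp
  then show ?thesis by (simp add: ring_length_def)
qed

end


section \<open>Power sums and lengths\<close>

text \<open>Four entries serve both ranks, since the conjugates in a cubic ring can be padded by
  zero. Integrality is asked of power sums because these are traces of powers.\<close>

definition power_lengths :: "real \<Rightarrow> real set" where
  "power_lengths B = {\<Sum>i<4. (cmod (z i))\<^sup>2 | z :: nat \<Rightarrow> complex.
     (\<forall>k\<in>{1..4}. (\<Sum>i<4. z i ^ k) \<in> \<int>) \<and> (\<Sum>i<4. (cmod (z i))\<^sup>2) \<le> B}"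

text \<open>By Newton's identities this is 24 times the monic polynomial with roots
  \<open>z 0, ..., z 3\<close>, written in their power sums; the factor 24 clears the
  denominators.\<close>

definition newton_poly :: "int \<Rightarrow> int \<Rightarrow> int \<Rightarrow> int \<Rightarrow> complex poly" where
  "newton_poly p1 p2 p3 p4 = map_poly of_int
     [:p1^4 - 6*p1^2*p2 + 3*p2^2 + 8*p1*p3 - 6*p4, -4*(p1^3 - 3*p1*p2 + 2*p3), 12*(p1^2 - p2), -24*p1, 24:]"

lemma newton_root:
  fixes z :: "nat \<Rightarrow> complex"
  assumes "(\<Sum>i<4. z i ^ 1) = of_int p1" "(\<Sum>i<4. z i ^ 2) = of_int p2"
    "(\<Sum>i<4. z i ^ 3) = of_int p3" "(\<Sum>i<4. z i ^ 4) = of_int p4" "i < 4"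
  shows "poly (newton_poly p1 p2 p3 p4) (z i) = 0"
proof -
  have S: "(\<Sum>i<4. f i) = f 0 + f 1 + f 2 + f 3" for f :: "nat \<Rightarrow> complex"
    by (simp add: eval_nat_numeral)
  note P = assms(1-4)[unfolded S, symmetric]
  have i: "i = 0 \<or> i = 1 \<or> i = 2 \<or> i = 3" using assms(5) by auto
  have np: "poly (newton_poly p1 p2 p3 p4) x =
      24*x^4 - 24 * of_int p1*x^3 + 12*(of_int p1^2 - of_int p2)*x^2
      - 4*(of_int p1^3 - 3 * of_int p1 * of_int p2 + 2 * of_int p3)*x
      + (of_int p1^4 - 6 * of_int p1^2 * of_int p2 + 3 * of_int p2^2 + 8 * of_int p1 * of_int p3 - 6 * of_int p4)"
    for x by (simp add: newton_poly_def map_poly_pCons algebra_simps eval_nat_numeral)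
  have key: "24*x^4 - 24*q1*x^3 + 12*(q1^2 - q2)*x^2 - 4*(q1^3 - 3*q1*q2 + 2*q3)*x
      + (q1^4 - 6*q1^2*q2 + 3*q2^2 + 8*q1*q3 - 6*q4) = 0"
    if q: "q1 = x + y + u + v" "q2 = x^2 + y^2 + u^2 + v^2" "q3 = x^3 + y^3 + u^3 + v^3"
      "q4 = x^4 + y^4 + u^4 + v^4" for x y u v q1 q2 q3 q4 :: complex
  proof -
    \<comment> \<open>Passing to the elementary symmetric functions of the three roots other than x
      leaves an identity of low degree in x, f1, f2 and f3.\<close>
    define f1 f2 f3 where f: "f1 = y + u + v" and f2: "f2 = y * u + u * v + v * y" and f3: "f3 = y * u * v"
    have g2: "y^2 + (u^2 + v^2) = f1^2 - 2*f2"
      unfolding f f2 f3 by (simp add: power2_eq_square algebra_simps)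
    have g3: "y^3 + (u^3 + v^3) = f1^3 - 3*f1*f2 + 3*f3"
      unfolding f f2 f3 by (simp add: power3_eq_cube algebra_simps)
    have g4: "y^4 + (u^4 + v^4) = f1^4 - 4*f1^2*f2 + 2*f2^2 + 4*f1*f3"
      unfolding f f2 f3 by (simp add: power4_eq_xxxx power2_eq_square algebra_simps)
    have q1': "q1 = x + f1" by (simp add: q f)
    have q': "q2 = x^2 + (f1^2 - 2*f2)" "q3 = x^3 + (f1^3 - 3*f1*f2 + 3*f3)"
      "q4 = x^4 + (f1^4 - 4*f1^2*f2 + 2*f2^2 + 4*f1*f3)"
      by (simp_all only: q g2 g3 g4 add.assoc)
    show ?thesis unfolding q1' q' by (simp add: power4_eq_xxxx power3_eq_cube power2_eq_square algebra_simps)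
  qed
  from i show ?thesis
  proof (elim disjE)
    assume "i = 0" then show ?thesis unfolding np by (simp only:) (rule key[of _ _ "z 1" "z 2" "z 3"]; simp add: P)
  next
    assume "i = 1" then show ?thesis unfolding np by (simp only:) (rule key[of _ _ "z 0" "z 2" "z 3"]; simp add: P)
  next
    assume "i = 2" then show ?thesis unfolding np by (simp only:) (rule key[of _ _ "z 0" "z 1" "z 3"]; simp add: P)
  next
    assume "i = 3" then show ?thesis unfolding np by (simp only:) (rule key[of _ _ "z 0" "z 1" "z 2"]; simp add: P)
  qed
qed

lemma power_sum_bound:
  fixes z :: "nat \<Rightarrow> complex"
  assumes "(\<Sum>i<4. (cmod (z i))\<^sup>2) \<le> B" "k \<in> {1..4}"
  shows "cmod (\<Sum>i<4. z i ^ k) \<le> 4 * (1 + B) ^ 4"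
proof -
  have b: "cmod (z i) \<le> 1 + B" if "i < 4" for i
  proof -
    have "(cmod (z i))\<^sup>2 \<le> (\<Sum>i<4. (cmod (z i))\<^sup>2)"
      using that by (intro member_le_sum) auto
    then have "(cmod (z i))\<^sup>2 \<le> B" using assms(1) by simp
    moreover have "cmod (z i) \<le> 1 + (cmod (z i))\<^sup>2"
      using zero_le_power2[of "cmod (z i) - 1/2"] by (simp add: power2_eq_square algebra_simps)
    ultimately show ?thesis by simp
  qed
  have B: "0 \<le> B" using assms(1) sum_nonneg[of "{..<4}" "\<lambda>i. (cmod (z i))\<^sup>2"] by force
  have "cmod (\<Sum>i<4. z i ^ k) \<le> (\<Sum>i<4. cmod (z i ^ k))" by (rule norm_sum)
  also have "\<dots> \<le> (\<Sum>i<(4::nat). (1 + B) ^ 4)"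
  proof (rule sum_mono)
    fix i :: nat assume "i \<in> {..<4}"
    then have "cmod (z i) ^ k \<le> (1 + B) ^ k" by (intro power_mono b) auto
    also have "\<dots> \<le> (1 + B) ^ 4" using B assms(2) by (intro power_increasing) auto
    finally show "cmod (z i ^ k) \<le> (1 + B) ^ 4" by (simp add: norm_power)
  qed
  finally show ?thesis by simp
qed

lemma finite_power_lengths: "finite (power_lengths B)"
proof -
  define I where "I = {p :: int. \<bar>real_of_int p\<bar> \<le> 4 * (1 + B) ^ 4}"
  have "I \<subseteq> {- \<lceil>4 * (1 + B) ^ 4\<rceil> .. \<lceil>4 * (1 + B) ^ 4\<rceil>}"
  proof
    fix p assume "p \<in> I"
    then have "real_of_int p \<le> 4 * (1 + B) ^ 4" "real_of_int (- p) \<le> 4 * (1 + B) ^ 4"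
      by (auto simp: I_def)
    then have "p \<le> \<lceil>4 * (1 + B) ^ 4\<rceil>" "- p \<le> \<lceil>4 * (1 + B) ^ 4\<rceil>"
      by linarith+
    then show "p \<in> {- \<lceil>4 * (1 + B) ^ 4\<rceil> .. \<lceil>4 * (1 + B) ^ 4\<rceil>}" by auto
  qed
  then have "finite I" by (rule finite_subset) simp
  define F where "F = (\<Union>p1\<in>I. \<Union>p2\<in>I. \<Union>p3\<in>I. \<Union>p4\<in>I. {x. poly (newton_poly p1 p2 p3 p4) x = 0})"
  have "newton_poly p1 p2 p3 p4 \<noteq> 0" for p1 p2 p3 p4
    by (simp add: newton_poly_def map_poly_pCons)
  then have F: "finite F"
    unfolding F_def using \<open>finite I\<close> by (intro finite_UN_I poly_roots_finite)
  have "power_lengths B \<subseteq> (\<lambda>z. \<Sum>i<4. (cmod (z i))\<^sup>2) ` ({..<4::nat} \<rightarrow>\<^sub>E F)"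
  proof
    fix r assume "r \<in> power_lengths B"
    then obtain z :: "nat \<Rightarrow> complex" where z: "r = (\<Sum>i<4. (cmod (z i))\<^sup>2)" "\<forall>k\<in>{1..4}. (\<Sum>i<4. z i ^ k) \<in> \<int>"
        "(\<Sum>i<4. (cmod (z i))\<^sup>2) \<le> B" by (auto simp: power_lengths_def)
    have ex: "\<exists>p\<in>I. (\<Sum>i<4. z i ^ k) = of_int p" if "k \<in> {1..4}" for k
    proof -
      have "(\<Sum>i<4. z i ^ k) \<in> \<int>" using z(2) that by blast
      then obtain p where p: "(\<Sum>i<4. z i ^ k) = of_int p" by (rule Ints_cases)
      then show ?thesis using power_sum_bound[OF z(3) that] by (auto simp: I_def)
    qed
    obtain p1 where p1: "p1 \<in> I" "(\<Sum>i<4. z i ^ 1) = of_int p1" using ex[of 1] by auto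
    obtain p2 where p2: "p2 \<in> I" "(\<Sum>i<4. z i ^ 2) = of_int p2" using ex[of 2] by auto
    obtain p3 where p3: "p3 \<in> I" "(\<Sum>i<4. z i ^ 3) = of_int p3" using ex[of 3] by auto
    obtain p4 where p4: "p4 \<in> I" "(\<Sum>i<4. z i ^ 4) = of_int p4" using ex[of 4] by auto
    have "z i \<in> F" if "i < 4" for i
      unfolding F_def using newton_root[OF p1(2) p2(2) p3(2) p4(2) that] p1(1) p2(1) p3(1) p4(1)
      by blast
    then have "restrict z {..<4} \<in> {..<4} \<rightarrow>\<^sub>E F" by auto
    moreover have "r = (\<Sum>i<4. (cmod (restrict z {..<4} i))\<^sup>2)" unfolding z(1) by (intro sum.cong) auto
    ultimately show "r \<in> (\<lambda>z. \<Sum>i<4. (cmod (z i))\<^sup>2) ` ({..<4::nat} \<rightarrow>\<^sub>E F)"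
      by (intro image_eqI[where x = "restrict z {..<4}"])
  qed
  moreover have "finite ({..<4::nat} \<rightarrow>\<^sub>E F)" using F by (simp add: finite_PiE)
  ultimately show ?thesis using finite_imageI finite_subset by blast
qed

text \<open>All four power sums are integers of modulus below 1, hence zero, and the Newton
  polynomial becomes 24 x^4. The constant 1/4 comes from the first power sum, whose square is at
  most 4 r by Cauchy-Schwarz; the higher ones are at most r because every entry has modulus below
  1.\<close>

lemma power_lengths_gap:
  assumes "r \<in> power_lengths B" "r < 1/4"
  shows "r = 0"
proof -
  obtain z :: "nat \<Rightarrow> complex" where z: "r = (\<Sum>i<4. (cmod (z i))\<^sup>2)" "\<forall>k\<in>{1..4}. (\<Sum>i<4. z i ^ k) \<in> \<int>"
    using assms(1) by (auto simp: power_lengths_def)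
  have half: "cmod (z i) < 1" if "i < 4" for i
  proof -
    have "(cmod (z i))\<^sup>2 \<le> r" unfolding z(1) using that by (intro member_le_sum) auto
    then have "(cmod (z i))\<^sup>2 < 1\<^sup>2" using assms(2) by simp
    then show ?thesis by (rule power_less_imp_less_base) simp
  qed
  have zero: "(\<Sum>i<4. z i ^ k) = of_int 0" if k: "k \<in> {1..4}" for k
  proof -
    have "cmod (\<Sum>i<4. z i ^ k) < 1"
    proof (cases "k = 1")
      case True
      have "(\<Sum>i<4. cmod (z i))\<^sup>2 \<le> 4 * r"
        using sum_squared_le_sum_of_squares[of "\<lambda>i. cmod (z i)" "{..<4::nat}"] by (simp add: z(1))
      then have "(\<Sum>i<4. cmod (z i))\<^sup>2 < 1\<^sup>2" using assms(2) by simp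
      then have "(\<Sum>i<4. cmod (z i)) < 1" by (rule power_less_imp_less_base) simp
      then show ?thesis using norm_sum[of z "{..<4}"] True by simp
    next
      case False
      have "cmod (\<Sum>i<4. z i ^ k) \<le> (\<Sum>i<4. cmod (z i) ^ k)"
        using norm_sum[of "\<lambda>i. z i ^ k" "{..<4}"] by (simp add: norm_power)
      also have "\<dots> \<le> r" unfolding z(1)
        using k False half by (intro sum_mono power_decreasing) (auto intro: less_imp_le)
      finally show ?thesis using assms(2) by simp
    qed
    moreover have "(\<Sum>i<4. z i ^ k) \<in> \<int>" using z(2) k by blast
    then obtain p where "(\<Sum>i<4. z i ^ k) = of_int p" by (rule Ints_cases)
    ultimately show ?thesis by simp
  qed
  have "z i = 0" if "i < 4" for i
    using newton_root[of z 0 0 0 0 i] zero[of 1] zero[of 2] zero[of 3] zero[of 4] that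
    by (simp add: newton_poly_def map_poly_pCons)
  then show ?thesis by (simp add: z(1))
qed

section \<open>Gram--Schmidt orthogonalisation\<close>

lemma det_fun_lower_triangular:
  fixes f :: "nat \<Rightarrow> nat \<Rightarrow> 'a::comm_ring_1"
  assumes "\<And>i j. i < j \<Longrightarrow> j < n \<Longrightarrow> f i j = 0"
  shows "Determinant.det (Matrix.mat n n (\<lambda>(i, j). f i j)) = (\<Prod>i<n. f i i)"
proof -
  have "Determinant.det (Matrix.mat n n (\<lambda>(i, j). f i j)) =
      prod_list (diag_mat (Matrix.mat n n (\<lambda>(i, j). f i j)))"
    using assms by (intro det_lower_triangular[of n]) auto
  also have "\<dots> = (\<Prod>i<n. f i i)"
    by (simp add: prod_list_diag_prod atLeast0LessThan)
  finally show ?thesis .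
qed

text \<open>Here \<open>w j\<close> is the component of \<open>v j\<close> orthogonal to all earlier
  vectors. It is not normalised, and it vanishes when \<open>v j\<close> depends on the earlier
  ones.\<close>

lemma gram_schmidt_exists:
  fixes v :: "nat \<Rightarrow> 'a::euclidean_space"
  obtains w where "\<And>j. v j - w j \<in> span (v ` {..<j})"
    and "\<And>j y. y \<in> span (v ` {..<j}) \<Longrightarrow> w j \<bullet> y = 0"
proof -
  have "\<exists>x. v j - x \<in> span (v ` {..<j}) \<and> (\<forall>y\<in>span (v ` {..<j}). x \<bullet> y = 0)" for j
  proof -
    obtain y z where "y \<in> span (v ` {..<j})" "\<And>w. w \<in> span (v ` {..<j}) \<Longrightarrow> real_inner_class.orthogonal z w" "v j = y + z"
      using orthogonal_subspace_decomp_exists[of "v ` {..<j}" "v j"] by blast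
    then show ?thesis by (intro exI[of _ z]) (auto simp: real_inner_class.orthogonal_def)
  qed
  then show ?thesis using that by metis
qed

context
  fixes v w :: "nat \<Rightarrow> 'a::euclidean_space"
  assumes diff: "\<And>j. v j - w j \<in> span (v ` {..<j})"
    and orth: "\<And>j y. y \<in> span (v ` {..<j}) \<Longrightarrow> w j \<bullet> y = 0"
begin

lemma gs_pythagoras:
  assumes "y \<in> span (v ` {..<j})"
  shows "(norm (r *\<^sub>R w j + y))\<^sup>2 = r\<^sup>2 * (norm (w j))\<^sup>2 + (norm y)\<^sup>2"
proof -
  show ?thesis
    using orth[OF assms] unfolding power2_norm_eq_inner
    by (simp add: inner_add_left inner_add_right inner_commute power2_eq_square)
qed

lemma gs_norm_le: "norm (w j) \<le> norm (v j)"
proof (rule power2_le_imp_le)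
  show "(norm (w j))\<^sup>2 \<le> (norm (v j))\<^sup>2"
    using gs_pythagoras[OF diff, of 1 j] by simp
qed simp

lemma gs_in_span: "i < j \<Longrightarrow> w i \<in> span (v ` {..<j})"
proof -
  assume "i < j"
  then have "v i \<in> span (v ` {..<j})" by (intro span_base) auto
  moreover have "v i - w i \<in> span (v ` {..<j})"
    using diff[of i] span_mono[of "v ` {..<i}" "v ` {..<j}"] \<open>i < j\<close> by (meson image_mono lessThan_subset_iff less_imp_le subsetD)
  ultimately show ?thesis using span_diff by fastforce
qed

lemma gs_orthogonal: "i \<noteq> j \<Longrightarrow> w i \<bullet> w j = 0"
  using orth[OF gs_in_span, of i j] orth[OF gs_in_span, of j i]
  by (metis inner_commute linorder_neqE_nat)

text \<open>Babai's nearest plane rounding: rounding the coefficient of the last vector leaves an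
  error d of at most 1/2 along \<open>w j\<close>, and the remaining error
  \<open>d *\<^sub>R (v j - w j)\<close> lies in the earlier span, where it is rounded by
  induction.\<close>

lemma gs_round:
  assumes "y \<in> span (v ` {..<j})"
  shows "\<exists>c::nat \<Rightarrow> int. (norm (y - (\<Sum>k<j. of_int (c k) *\<^sub>R v k)))\<^sup>2 \<le> 1/4 * (\<Sum>k<j. (norm (w k))\<^sup>2)"
  using assms
proof (induction j arbitrary: y)
  case 0
  then show ?case by simp
next
  case (Suc j)
  obtain r where r: "y - r *\<^sub>R v j \<in> span (v ` {..<j})"
    using Suc.prems by (auto simp: lessThan_Suc span_breakdown_eq)
  define d where "d = r - of_int (round r)"
  have d: "d\<^sup>2 \<le> 1/4"
  proof -
    have "\<bar>d\<bar> \<le> 1/2" unfolding d_def using of_int_round_abs_le[of r] by (simp add: abs_minus_commute)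
    then have "\<bar>d\<bar>\<^sup>2 \<le> (1/2)\<^sup>2" by (intro power_mono) auto
    then show ?thesis by (simp add: power2_eq_square)
  qed
  define y' where "y' = (y - r *\<^sub>R v j) + d *\<^sub>R (v j - w j)"
  have y': "y' \<in> span (v ` {..<j})"
    unfolding y'_def by (intro span_add r span_mul diff)
  obtain c where c: "(norm (y' - (\<Sum>k<j. of_int (c k) *\<^sub>R v k)))\<^sup>2 \<le> 1/4 * (\<Sum>k<j. (norm (w k))\<^sup>2)"
    using Suc.IH[OF y'] by blast
  let ?z = "y' - (\<Sum>k<j. of_int (c k) *\<^sub>R v k)"
  have z: "?z \<in> span (v ` {..<j})"
    by (intro span_diff y' span_sum span_mul span_base) auto
  let ?c = "c(j := round r)"
  have "y - (\<Sum>k<Suc j. of_int (?c k) *\<^sub>R v k) = d *\<^sub>R w j + ?z"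
    by (simp add: y'_def d_def algebra_simps)
  then have "(norm (y - (\<Sum>k<Suc j. of_int (?c k) *\<^sub>R v k)))\<^sup>2 = d\<^sup>2 * (norm (w j))\<^sup>2 + (norm ?z)\<^sup>2"
    using gs_pythagoras[OF z] by metis
  also have "\<dots> \<le> 1/4 * (norm (w j))\<^sup>2 + 1/4 * (\<Sum>k<j. (norm (w k))\<^sup>2)"
    using d c by (intro add_mono mult_right_mono) auto
  finally show ?case by (intro exI[of _ ?c]) (simp add: algebra_simps)
qed

lemma span_initial_expand:
  assumes "y \<in> span (v ` {..<j})"
  shows "\<exists>c. y = (\<Sum>k<j. c k *\<^sub>R w k)"
  using assms
proof (induction j arbitrary: y)
  case 0
  then show ?case by simp
next
  case (Suc j)
  obtain r where r: "y - r *\<^sub>R v j \<in> span (v ` {..<j})"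
    using Suc.prems by (auto simp: lessThan_Suc span_breakdown_eq)
  have "(y - r *\<^sub>R v j) + r *\<^sub>R (v j - w j) \<in> span (v ` {..<j})"
    by (intro span_add r span_mul diff)
  then obtain c where "(y - r *\<^sub>R v j) + r *\<^sub>R (v j - w j) = (\<Sum>k<j. c k *\<^sub>R w k)"
    using Suc.IH by blast
  then have "y = (\<Sum>k<j. c k *\<^sub>R w k) + r *\<^sub>R w j" by (simp add: algebra_simps)
  then show ?case by (intro exI[of _ "c(j := r)"]) simp
qed

text \<open>The Gram matrix factors as U D U^T with U unitriangular and D the diagonal matrix of the
  squared norms of w.\<close>

lemma gram_det:
  "Determinant.det (Matrix.mat n n (\<lambda>(i, j). v i \<bullet> v j)) = (\<Prod>i<n. (norm (w i))\<^sup>2)"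
proof -
  have "\<forall>i. \<exists>c. v i - w i = (\<Sum>k<i. c k *\<^sub>R w k)" using span_initial_expand[OF diff] by blast
  then obtain c where c: "\<And>i. v i - w i = (\<Sum>k<i. c i k *\<^sub>R w k)" by metis
  define U where "U i k = (if k < i then c i k else if k = i then 1 else (0::real))" for i k
  have v: "v i = (\<Sum>k<n. U i k *\<^sub>R w k)" if "i < n" for i
  proof -
    have "{..<n} = {..<i} \<union> {i} \<union> {i<..<n}" using that by auto
    then have "(\<Sum>k<n. U i k *\<^sub>R w k) = (\<Sum>k\<in>{..<i} \<union> {i} \<union> {i<..<n}. U i k *\<^sub>R w k)" by simp
    also have "\<dots> = (\<Sum>k<i. U i k *\<^sub>R w k) + U i i *\<^sub>R w i + (\<Sum>k\<in>{i<..<n}. U i k *\<^sub>R w k)"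
      by (subst sum.union_disjoint, auto)+
    also have "\<dots> = (\<Sum>k<i. c i k *\<^sub>R w k) + w i" by (simp add: U_def)
    finally show ?thesis using c[of i] by (simp add: algebra_simps)
  qed
  have "v i \<bullet> v j = (\<Sum>k<n. U i k * ((norm (w k))\<^sup>2 * U j k))" if "i < n" "j < n" for i j
  proof -
    have "v i \<bullet> v j = (\<Sum>k<n. \<Sum>l<n. U j k * (U i l * (w l \<bullet> w k)))"
      unfolding v[OF that(1)] v[OF that(2)] by (simp add: inner_sum_left inner_sum_right sum_distrib_left)
    also have "\<dots> = (\<Sum>k<n. \<Sum>l<n. if l = k then U i k * ((norm (w k))\<^sup>2 * U j k) else 0)"
      by (intro sum.cong refl) (auto simp: gs_orthogonal power2_norm_eq_inner)
    finally show ?thesis by simp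
  qed
  then have "Determinant.det (Matrix.mat n n (\<lambda>(i, j). v i \<bullet> v j)) =
      Determinant.det (Matrix.mat n n (\<lambda>(i, j). \<Sum>k<n. U i k * ((norm (w k))\<^sup>2 * U j k)))"
    by (intro arg_cong[of _ _ Determinant.det] eq_matI) auto
  also have "\<dots> = Determinant.det (Matrix.mat n n (\<lambda>(i, j). U i j)) *
      Determinant.det (Matrix.mat n n (\<lambda>(k, j). (norm (w k))\<^sup>2 * U j k))"
    by (rule det_fun_mult)
  also have "Determinant.det (Matrix.mat n n (\<lambda>(i, j). U i j)) = 1"
    by (subst det_fun_lower_triangular) (auto simp: U_def)
  also have "Determinant.det (Matrix.mat n n (\<lambda>(k, j). (norm (w k))\<^sup>2 * U j k)) =
      Determinant.det (Matrix.mat n n (\<lambda>(j, k). (norm (w k))\<^sup>2 * U j k))"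
    by (rule det_fun_transpose)
  also have "\<dots> = (\<Prod>i<n. (norm (w i))\<^sup>2)"
    by (subst det_fun_lower_triangular) (auto simp: U_def)
  finally show ?thesis by simp
qed

end


section \<open>Successive minima\<close>

text \<open>\<open>power_lengths\<close> collects n times the squared lengths, which the quotient
  and the root undo. Finiteness of this set is the discreteness that makes minima attained and
  leaves finitely many points of bounded discriminant.\<close>

definition lengths_upto :: "nat \<Rightarrow> real \<Rightarrow> real set" where
  "lengths_upto n B = (\<lambda>q. sqrt (q / real n)) ` power_lengths (real n * B\<^sup>2)"

lemma finite_lengths_upto: "finite (lengths_upto n B)"
  by (simp add: lengths_upto_def finite_power_lengths)

locale small_split = split_ring +
  assumes n_pos: "0 < n" and n_le: "n \<le> 4"
begin

abbreviation "len \<equiv> ring_length n R"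

lemma sum_pad: "(\<Sum>i<n. g i) = (\<Sum>i<(4::nat). if i < n then g i else (0::'d::comm_monoid_add))"
  using n_le by (intro sum.mono_neutral_cong_left) auto

lemma len_sq: "real n * (len x)\<^sup>2 = (\<Sum>k<n. (cmod (s k x))\<^sup>2)"
  using n_pos by (simp add: ring_length_eq sum_nonneg)

lemma len_nonneg [simp]: "0 \<le> len x"
  by (simp add: ring_length_eq sum_nonneg)

lemma len_one: "len \<one> = 1"
  using n_pos by (simp add: ring_length_eq chom_one[OF hom])

text \<open>The k-th power sum of the conjugates of x is the trace of \<open>x [^] k\<close>, hence
  an integer; the padding by zeros does not change it because k is at least 1.\<close>

lemma len_power_lengths:
  assumes x: "x \<in> carrier R" and B: "real n * (len x)\<^sup>2 \<le> B"
  shows "real n * (len x)\<^sup>2 \<in> power_lengths B"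
proof -
  define z where "z i = (if i < n then s i x else 0)" for i
  have "(\<Sum>i<4. z i ^ k) \<in> \<int>" if "k \<in> {1..4}" for k
  proof -
    have "(\<Sum>i<4. z i ^ k) = (\<Sum>i<4. if i < n then s i x ^ k else 0)"
      using that by (intro sum.cong) (auto simp: z_def)
    also have "\<dots> = (\<Sum>i<n. s i (x [^] k))"
      by (subst sum_pad[symmetric]) (simp add: chom_pow[OF hom x])
    finally show ?thesis using trace_int x by simp
  qed
  moreover have "real n * (len x)\<^sup>2 = (\<Sum>i<4. (cmod (z i))\<^sup>2)"
    unfolding len_sq by (subst sum_pad, intro sum.cong) (auto simp: z_def)
  ultimately show ?thesis using B unfolding power_lengths_def by auto
qed

lemma len_in_lengths_upto:
  assumes "x \<in> carrier R" "len x \<le> B"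
  shows "len x \<in> lengths_upto n B"
proof -
  have "(len x)\<^sup>2 \<le> B\<^sup>2" using assms by (intro power_mono) auto
  then have "real n * (len x)\<^sup>2 \<in> power_lengths (real n * B\<^sup>2)"
    using assms by (intro len_power_lengths) (auto intro: mult_left_mono)
  moreover have "len x = sqrt ((real n * (len x)\<^sup>2) / real n)" using n_pos by simp
  ultimately show ?thesis unfolding lengths_upto_def by (rule image_eqI[rotated])
qed

lemma len_lower:
  assumes x: "x \<in> carrier R" and "x \<noteq> \<zero>"
  shows "1/4 \<le> len x"
proof (rule ccontr)
  assume "\<not> 1/4 \<le> len x"
  then have "(len x)\<^sup>2 < (1/4)\<^sup>2" by (intro power_strict_mono) auto
  then have "real n * (len x)\<^sup>2 < 4 * (1/4)\<^sup>2"
    using n_pos n_le by (intro mult_le_less_imp_less) auto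
  then have "real n * (len x)\<^sup>2 = 0"
    using power_lengths_gap[OF len_power_lengths[OF x order_refl]] by (simp add: power2_eq_square)
  then have "(\<Sum>k<n. (cmod (s k x))\<^sup>2) = 0" by (simp add: len_sq)
  then have "\<forall>k<n. s k x = 0" by (subst (asm) sum_nonneg_eq_0_iff) auto
  then have "x = \<zero>" using x by (intro eq_if_homs_eq) (auto simp: chom_zero[OF hom])
  with assms show False by simp
qed

subsection \<open>The embedding in Euclidean space\<close>

text \<open>Zero padding lets all ranks up to four share one Euclidean space. Its inner product is
  the real part of the Hermitian form on the conjugates.\<close>

definition emb :: "'a \<Rightarrow> complex \<times> complex \<times> complex \<times> complex" where
  "emb x = (let f = \<lambda>i. if i < n then s i x else 0 in (f 0, f 1, f 2, f 3))"

lemma inner_emb: "inner (emb x) (emb y) = Re (\<Sum>i<n. s i x * cnj (s i y))"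
  by (subst sum_pad) (simp add: emb_def Let_def eval_nat_numeral inner_complex_def)

lemma norm_emb: "(norm (emb x))\<^sup>2 = real n * (len x)\<^sup>2"
proof -
  have "(norm (emb x))\<^sup>2 = inner (emb x) (emb x)" by (rule power2_norm_eq_inner)
  also have "\<dots> = (\<Sum>i<n. (cmod (s i x))\<^sup>2)"
    unfolding inner_emb Re_sum by (rule sum.cong) (simp_all add: complex_mult_cnj cmod_power2)
  finally show ?thesis by (simp add: len_sq)
qed

lemma norm_emb': "norm (emb x) = sqrt (real n) * len x"
  using norm_emb[of x] by (metis len_nonneg norm_ge_zero real_sqrt_mult real_sqrt_unique)

lemma emb_lincomb:
  assumes "\<And>i. i < n \<Longrightarrow> s i x = (\<Sum>l<j. of_real (c l) * s i (v l))"
  shows "emb x = (\<Sum>l<j. c l *\<^sub>R emb (v l))"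
proof -
  define f where "f y i = (if i < n then s i y else 0)" for y i
  have e: "emb y = (f y 0, f y 1, f y 2, f y 3)" for y by (simp add: emb_def f_def Let_def)
  have fx: "f x i = (\<Sum>l<j. c l *\<^sub>R f (v l) i)" for i
    using assms[of i] by (simp add: f_def scaleR_conv_of_real)
  show ?thesis
    by (simp add: e prod_eq_iff fst_sum snd_sum fx)
qed

lemma emb_eq_0: "emb x = 0 \<Longrightarrow> i < n \<Longrightarrow> s i x = 0"
  using norm_emb[of x] len_sq[of x] by (simp add: sum_nonneg_eq_0_iff)

text \<open>Complex conjugation permutes the homomorphisms, so the Hermitian form is real on \<open>R\<close>.\<close>

lemma hermitian_real:
  assumes "x \<in> carrier R" "y \<in> carrier R"
  shows "(\<Sum>i<n. s i x * cnj (s i y)) = of_real (inner (emb x) (emb y))"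
proof -
  define C where "C h = (\<lambda>z\<in>carrier R. cnj (h z))" for h :: "'a \<Rightarrow> complex"
  have C: "C h \<in> complex_homs R" if "h \<in> complex_homs R" for h
  proof -
    have h: "h \<in> Ring.ring_hom R complex_ring" using that by (simp add: complex_homs_def)
    have "C h \<in> Ring.ring_hom R complex_ring"
      by (rule ring_hom_memI) (simp_all add: C_def chom_add[OF h] chom_mult[OF h] chom_one[OF h])
    then show ?thesis by (simp add: complex_homs_def C_def)
  qed
  have CC: "C (C h) = h" if "h \<in> complex_homs R" for h
    using that by (auto simp: complex_homs_def C_def extensional_def fun_eq_iff)
  have S: "(\<Sum>i<n. s i x * cnj (s i y)) = (\<Sum>h\<in>complex_homs R. h x * cnj (h y))"
    using sum.reindex_bij_betw[OF homs_bij, of "\<lambda>h. h x * cnj (h y)"] by simp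
  have "cnj (\<Sum>h\<in>complex_homs R. h x * cnj (h y)) = (\<Sum>h\<in>complex_homs R. cnj (h x) * h y)"
    by simp
  also have "\<dots> = (\<Sum>h\<in>complex_homs R. h x * cnj (h y))"
    by (rule sum.reindex_bij_witness[of _ C C]) (auto simp: C CC, auto simp: C_def assms)
  finally have "(\<Sum>i<n. s i x * cnj (s i y)) \<in> \<real>"
    unfolding S by (simp add: Reals_cnj_iff)
  then show ?thesis unfolding inner_emb by (simp add: complex_is_Real_iff complex_eq_iff)
qed

text \<open>The transposed matrix of embeddings times the complex conjugate matrix is the Gram
  matrix of the vectors \<open>emb (v j)\<close>, because the Hermitian form is real on R.\<close>

lemma emb_det_gram:
  assumes v: "v \<in> {..<n} \<rightarrow> carrier R"
    and gs: "\<And>j. emb (v j) - w j \<in> span ((\<lambda>j. emb (v j)) ` {..<j})"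
      "\<And>j y. y \<in> span ((\<lambda>j. emb (v j)) ` {..<j}) \<Longrightarrow> inner (w j) y = 0"
  shows "(cmod (emb_det v))\<^sup>2 = (\<Prod>j<n. (norm (w j))\<^sup>2)"
proof -
  have vc: "v i \<in> carrier R" if "i < n" for i using v that by auto
  interpret cnj: comm_ring_hom cnj by unfold_locales auto
  have cd: "Determinant.det (Matrix.mat n n (\<lambda>(i, j). cnj (s i (v j)))) = cnj (emb_det v)"
  proof -
    have "Matrix.mat n n (\<lambda>(i, j). cnj (s i (v j))) = map_mat cnj (Matrix.mat n n (\<lambda>(i, j). s i (v j)))"
      by (auto intro!: eq_matI)
    then show ?thesis by (simp add: emb_det_def)
  qed
  have "of_real (Determinant.det (Matrix.mat n n (\<lambda>(i, j). inner (emb (v i)) (emb (v j))))) =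
      Determinant.det (Matrix.mat n n (\<lambda>(i, j). complex_of_real (inner (emb (v i)) (emb (v j)))))"
  proof -
    interpret of_real: comm_ring_hom "of_real :: real \<Rightarrow> complex" by unfold_locales auto
    have "Matrix.mat n n (\<lambda>(i, j). complex_of_real (inner (emb (v i)) (emb (v j)))) =
        map_mat of_real (Matrix.mat n n (\<lambda>(i, j). inner (emb (v i)) (emb (v j))))"
      by (auto intro!: eq_matI)
    then show ?thesis by simp
  qed
  also have "\<dots> = Determinant.det (Matrix.mat n n (\<lambda>(i, j). \<Sum>k<n. s k (v i) * cnj (s k (v j))))"
    using vc by (intro arg_cong[of _ _ Determinant.det] eq_matI) (simp_all add: hermitian_real)
  also have "\<dots> = emb_det v * cnj (emb_det v)"
    by (subst det_fun_mult[of n "\<lambda>i k. s k (v i)" "\<lambda>k j. cnj (s k (v j))"],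
        subst det_fun_transpose[of n "\<lambda>k j. s k (v j)"]) (simp add: emb_det_def[symmetric] cd)
  also have "\<dots> = of_real ((cmod (emb_det v))\<^sup>2)" by (simp only: complex_norm_square)
  also have "Determinant.det (Matrix.mat n n (\<lambda>(i, j). inner (emb (v i)) (emb (v j)))) = (\<Prod>j<n. (norm (w j))\<^sup>2)"
    by (rule gram_det[of "\<lambda>j. emb (v j)"]) (use gs in auto)
  finally show ?thesis by (metis of_real_eq_iff)
qed

lemma hadamard:
  assumes v: "v \<in> {..<n} \<rightarrow> carrier R"
  shows "(cmod (emb_det v))\<^sup>2 \<le> (\<Prod>j<n. (norm (emb (v j)))\<^sup>2)"
proof -
  obtain w where w: "\<And>j. emb (v j) - w j \<in> span ((\<lambda>j. emb (v j)) ` {..<j})"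
      "\<And>j y. y \<in> span ((\<lambda>j. emb (v j)) ` {..<j}) \<Longrightarrow> inner (w j) y = 0"
    using gram_schmidt_exists[of "\<lambda>j. emb (v j)"] by blast
  have "norm (w j) \<le> norm (emb (v j))" for j
    by (rule gs_norm_le[of "\<lambda>j. emb (v j)"]) (use w in auto)
  then have "(\<Prod>j<n. (norm (w j))\<^sup>2) \<le> (\<Prod>j<n. (norm (emb (v j)))\<^sup>2)"
    by (intro prod_mono) (auto intro: power_mono)
  then show ?thesis using emb_det_gram[OF v w] by simp
qed

subsection \<open>Linear independence over the integers\<close>

lemma int_indep_cong: "(\<And>j. j < k \<Longrightarrow> v j = w j) \<Longrightarrow> int_indep R k v = int_indep R k w"
  unfolding int_indep_iff by (intro arg_cong2[of _ _ _ _ "(\<and>)"]) (auto simp: Pi_iff)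

lemma indep_closed: "int_indep R k v \<Longrightarrow> j < k \<Longrightarrow> v j \<in> carrier R"
  by (auto simp: int_indep_def)

lemma int_indepD:
  assumes "int_indep R k v" "\<And>i. i < n \<Longrightarrow> (\<Sum>j<k. of_int (m j) * s i (v j)) = 0" "j < k"
  shows "m j = 0"
  using assms unfolding int_indep_iff by blast

lemma int_indep_initial:
  assumes "int_indep R k v" "j \<le> k"
  shows "int_indep R j v"
  unfolding int_indep_iff
proof (intro conjI allI impI)
  show "v \<in> {..<j} \<rightarrow> carrier R" using assms by (auto simp: int_indep_iff)
  fix m l assume m: "\<forall>i<n. (\<Sum>l<j. of_int (m l) * s i (v l)) = 0" and l: "l < j"
  let ?m = "\<lambda>l. if l < j then m l else 0"
  have "(\<Sum>l<k. of_int (?m l) * s i (v l)) = (\<Sum>l<j. of_int (m l) * s i (v l))" for i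
    using assms(2) by (intro sum.mono_neutral_cong_right) auto
  then have "?m l = 0" using assms(2) m l by (intro int_indepD[OF assms(1), of ?m]) simp_all
  then show "m l = 0" using l by simp
qed

lemma not_indep_extend:
  assumes v: "int_indep R j v" and x: "x \<in> carrier R" and ni: "\<not> int_indep R (Suc j) (v(j := x))"
  obtains d c where "d \<noteq> (0::int)"
    "\<And>i. i < n \<Longrightarrow> of_int d * s i x = (\<Sum>l<j. of_int (c l) * s i (v l))"
proof -
  have "v(j := x) \<in> {..<Suc j} \<rightarrow> carrier R" using v x by (auto simp: int_indep_iff less_Suc_eq)
  then obtain m where m: "\<And>i. i < n \<Longrightarrow> (\<Sum>l<Suc j. of_int (m l) * s i ((v(j := x)) l)) = 0"
      "\<exists>l<Suc j. m l \<noteq> 0"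
    using ni unfolding int_indep_iff by auto
  have m': "of_int (m j) * s i x = (\<Sum>l<j. of_int (- m l) * s i (v l))" if "i < n" for i
  proof -
    have "(\<Sum>l<j. of_int (m l) * s i ((v(j := x)) l)) = (\<Sum>l<j. of_int (m l) * s i (v l))"
      by (rule sum.cong) auto
    then have "(\<Sum>l<j. of_int (m l) * s i (v l)) + of_int (m j) * s i x = 0"
      using m(1)[OF that] by simp
    then show ?thesis by (simp add: sum_negf add_eq_0_iff)
  qed
  have "m j \<noteq> 0"
  proof
    assume z: "m j = 0"
    then have "\<forall>i<n. (\<Sum>l<j. of_int (m l) * s i (v l)) = 0"
      using m' by (simp add: sum_negf)
    then have "\<forall>l<j. m l = 0" using v by (simp add: int_indep_iff)
    then show False using z m(2) by (auto simp: less_Suc_eq)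
  qed
  then show ?thesis using m' by (rule that)
qed

text \<open>Steinitz exchange over the integers: otherwise each of the j + 1 elements
  \<open>w k\<close> has a nonzero multiple in the span of j elements, and
  \<open>wide_kernel\<close> produces an integer relation between the \<open>w k\<close>.\<close>

lemma int_indep_exchange:
  assumes v: "int_indep R j v" and w: "int_indep R (Suc j) w"
  shows "\<exists>k\<le>j. int_indep R (Suc j) (v(j := w k))"
proof (rule ccontr)
  assume "\<not> ?thesis"
  then have n: "\<And>k. k \<le> j \<Longrightarrow> \<not> int_indep R (Suc j) (v(j := w k))" by blast
  have wc: "w k \<in> carrier R" if "k \<le> j" for k using w that by (auto simp: int_indep_iff)
  have "\<forall>k. \<exists>d c. k \<le> j \<longrightarrow> d \<noteq> (0::int) \<and> (\<forall>i<n. of_int d * s i (w k) = (\<Sum>l<j. of_int (c l) * s i (v l)))"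
  proof (intro allI)
    fix k
    show "\<exists>d c. k \<le> j \<longrightarrow> d \<noteq> (0::int) \<and> (\<forall>i<n. of_int d * s i (w k) = (\<Sum>l<j. of_int (c l) * s i (v l)))"
    proof (cases "k \<le> j")
      case True
      show ?thesis by (rule not_indep_extend[OF v wc[OF True] n[OF True]]) blast
    qed simp
  qed
  then obtain d c where dc: "\<And>k. k \<le> j \<Longrightarrow> d k \<noteq> (0::int)"
      "\<And>k i. k \<le> j \<Longrightarrow> i < n \<Longrightarrow> of_int (d k) * s i (w k) = (\<Sum>l<j. of_int (c k l) * s i (v l))"
    by metis
  obtain e where e: "\<exists>k\<le>j. e k \<noteq> 0" "\<forall>l<j. (\<Sum>k\<le>j. c k l * e k) = 0"
    using wide_kernel[of j "\<lambda>l k. c k l"] by blast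
  have "(\<Sum>k<Suc j. of_int (e k * d k) * s i (w k)) = 0" if i: "i < n" for i
  proof -
    have "(\<Sum>k<Suc j. of_int (e k * d k) * s i (w k)) =
        (\<Sum>k<Suc j. of_int (e k) * (of_int (d k) * s i (w k)))"
      by (simp add: mult_ac)
    also have "\<dots> = (\<Sum>k<Suc j. \<Sum>l<j. of_int (c k l * e k) * s i (v l))"
      by (rule sum.cong) (auto simp: dc(2) i sum_distrib_left mult_ac less_Suc_eq_le simp del: sum.lessThan_Suc)
    also have "\<dots> = (\<Sum>l<j. of_int (\<Sum>k\<le>j. c k l * e k) * s i (v l))"
      by (subst sum.swap) (simp add: sum_distrib_right lessThan_Suc_atMost del: sum.lessThan_Suc sum.atMost_Suc)
    finally show ?thesis using e(2) by simp
  qed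
  then have "e k * d k = 0" if "k < Suc j" for k using that by (rule int_indepD[OF w])
  then show False using e(1) dc(1) by (auto simp: less_Suc_eq_le)
qed

lemma basis_indep: "int_indep R n b"
  using basis by (simp add: int_basis_def)

lemma not_indep_Suc_n: "\<not> int_indep R (Suc n) w"
proof
  assume w: "int_indep R (Suc n) w"
  obtain k where k: "k \<le> n" "int_indep R (Suc n) (b(n := w k))"
    using int_indep_exchange[OF basis_indep w] by blast
  obtain m where m: "w k = int_comb R n b m"
    using indep_closed[OF w] k(1) by (meson basis_expand le_imp_less_Suc)
  have "(\<Sum>l<Suc n. of_int ((m(n := -1)) l) * s i ((b(n := w k)) l)) = 0" if "i < n" for i
  proof -
    have "(\<Sum>l<n. of_int ((m(n := -1)) l) * s i ((b(n := w k)) l)) = (\<Sum>l<n. of_int (m l) * s i (b l))"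
      by (rule sum.cong) auto
    then show ?thesis using that by (simp add: m chom_comb[OF hom b_closed])
  qed
  then have "(m(n := -1)) n = 0" by (rule int_indepD[OF k(2)]) simp_all
  then show False by simp
qed

subsection \<open>Greedy choice of short independent elements\<close>

text \<open>Minimality is required one index at a time: \<open>v j\<close> is shortest among the
  elements extending its predecessors. By exchange such a system realises all successive minima at
  once.\<close>

definition greedy :: "nat \<Rightarrow> (nat \<Rightarrow> 'a) \<Rightarrow> bool" where
  "greedy k v \<longleftrightarrow> int_indep R k v \<and>
    (\<forall>j<k. \<forall>x. int_indep R (Suc j) (v(j := x)) \<longrightarrow> len (v j) \<le> len x)"

lemma greedy_exists: "k \<le> n \<Longrightarrow> \<exists>v. greedy k v"
proof (induction k)
  case 0
  then show ?case by (auto simp: greedy_def int_indep_iff)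
next
  case (Suc k)
  then obtain v where v: "greedy k v" by auto
  define X where "X = {x. int_indep R (Suc k) (v(k := x))}"
  have Xc: "x \<in> carrier R" if "x \<in> X" for x
    using indep_closed[of "Suc k" "v(k := x)" k] that by (simp add: X_def)
  have "int_indep R (Suc k) b" using basis_indep int_indep_initial Suc.prems by blast
  then obtain x0 where x0: "x0 \<in> X"
    using int_indep_exchange[of k v b] v by (auto simp: greedy_def X_def)
  \<comment> \<open>Only lengths up to that of one admissible element compete, and these form a
    finite set, so a shortest extension exists.\<close>
  let ?L = "len ` X \<inter> {..len x0}"
  have "?L \<subseteq> lengths_upto n (len x0)" using len_in_lengths_upto Xc by auto
  then have L: "finite ?L" "len x0 \<in> ?L" using finite_subset[OF _ finite_lengths_upto] x0 by auto
  then have "Min ?L \<in> ?L" by (intro Min_in) auto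
  then obtain x where x: "x \<in> X" "len x = Min ?L" by auto
  have min: "len x \<le> len y" if "y \<in> X" for y
  proof (cases "len y \<le> len x0")
    case True
    then show ?thesis using L that x(2) by (auto intro: Min_le)
  next
    case False
    then show ?thesis using Min_le[OF L] x(2) by linarith
  qed
  have "greedy (Suc k) (v(k := x))"
    unfolding greedy_def
  proof (intro conjI allI impI)
    show "int_indep R (Suc k) (v(k := x))" using x by (simp add: X_def)
    fix j y assume j: "j < Suc k" and y: "int_indep R (Suc j) (v(k := x, j := y))"
    show "len ((v(k := x)) j) \<le> len y"
    proof (cases "j = k")
      case True
      then show ?thesis using y min by (simp add: X_def)
    next
      case False
      have "int_indep R (Suc j) (v(j := y))"
        using y j False int_indep_cong[of "Suc j" "v(k := x, j := y)" "v(j := y)"] by auto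
      then show ?thesis using v j False by (auto simp: greedy_def)
    qed
  qed
  then show ?case by blast
qed

lemma greedy_mono:
  assumes "greedy k v" "i \<le> j" "j < k"
  shows "len (v i) \<le> len (v j)"
proof -
  have "int_indep R (Suc i) (v(i := v j))"
    unfolding int_indep_iff
  proof (intro conjI allI impI)
    show "v(i := v j) \<in> {..<Suc i} \<rightarrow> carrier R"
      using assms indep_closed[of k v] by (auto simp: greedy_def less_Suc_eq)
    fix m l assume m: "\<forall>a<n. (\<Sum>l<Suc i. of_int (m l) * s a ((v(i := v j)) l)) = 0" and l: "l < Suc i"
    let ?m = "\<lambda>l. if l < i then m l else if l = j then m i else 0"
    have ind: "int_indep R (Suc j) v" using assms int_indep_initial by (auto simp: greedy_def)
    have "(\<Sum>l<Suc j. of_int (?m l) * s a (v l)) = (\<Sum>l<Suc i. of_int (m l) * s a ((v(i := v j)) l))" for a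
    proof -
      have "(\<Sum>l<j. of_int (?m l) * s a (v l)) = (\<Sum>l<i. of_int (m l) * s a (v l))"
        using assms(2) by (intro sum.mono_neutral_cong_right) auto
      then show ?thesis using assms(2) by auto
    qed
    then have z: "?m l = 0" if "l < Suc j" for l
      using m that by (intro int_indepD[OF ind, of ?m]) simp_all
    show "m l = 0"
    proof (cases "l = i")
      case True
      then show ?thesis using z[of j] assms(2) by auto
    next
      case False
      then show ?thesis using z[of l] l assms(2) by auto
    qed
  qed
  then show ?thesis using assms by (auto simp: greedy_def)
qed

lemma succ_min_greedy:
  assumes v: "greedy n v" and i: "i < n"
  shows "succ_min n R i = len (v i)"
  unfolding succ_min_def
proof (rule Least_equality)
  show "\<exists>w. int_indep R (Suc i) w \<and> (\<forall>j\<le>i. len (w j) \<le> len (v i))"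
    using v i greedy_mono[OF v] int_indep_initial[of n v "Suc i"]
    by (intro exI[of _ v]) (auto simp: greedy_def)
  fix r assume "\<exists>w. int_indep R (Suc i) w \<and> (\<forall>j\<le>i. len (w j) \<le> r)"
  then obtain w where w: "int_indep R (Suc i) w" "\<forall>j\<le>i. len (w j) \<le> r" by blast
  have "int_indep R i v" using v i int_indep_initial[of n v i] by (auto simp: greedy_def)
  then obtain k where "k \<le> i" "int_indep R (Suc i) (v(i := w k))"
    using int_indep_exchange w(1) by blast
  then show "len (v i) \<le> r" using v i w(2) by (force simp: greedy_def)
qed

lemma succ_min_le:
  assumes "int_indep R (Suc i) w" "\<And>j. j \<le> i \<Longrightarrow> len (w j) \<le> r" "i < n"
  shows "succ_min n R i \<le> r"
proof -
  obtain v where v: "greedy n v" using greedy_exists by blast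
  have "int_indep R i v" using v assms(3) int_indep_initial[of n v i] by (auto simp: greedy_def)
  then obtain k where "k \<le> i" "int_indep R (Suc i) (v(i := w k))"
    using int_indep_exchange assms(1) by blast
  then show ?thesis using v assms(2,3) succ_min_greedy[OF v assms(3)] by (force simp: greedy_def)
qed

lemma succ_min_mono: "i \<le> j \<Longrightarrow> j < n \<Longrightarrow> succ_min n R i \<le> succ_min n R j"
proof -
  assume ij: "i \<le> j" "j < n"
  obtain v where v: "greedy n v" using greedy_exists by blast
  then show ?thesis using ij by (simp add: succ_min_greedy greedy_mono)
qed

lemma greedy_indep: "greedy n v \<Longrightarrow> int_indep R n v"
  by (simp add: greedy_def)

lemma indep_nonzero:
  assumes "int_indep R k v" "j < k"
  shows "v j \<noteq> \<zero>"
proof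
  assume z: "v j = \<zero>"
  have "(\<Sum>l<k. of_int (if l = j then 1 else 0) * s i (v l)) = 0" if "i < n" for i
    using that z by (intro sum.neutral) (auto simp: chom_zero[OF hom])
  then have "(if j = j then 1 else 0 :: int) = 0" using assms(2) by (rule int_indepD[OF assms(1)])
  then show False by simp
qed

lemma succ_min_lower: "i < n \<Longrightarrow> 1/4 \<le> succ_min n R i"
proof -
  assume i: "i < n"
  obtain v where v: "greedy n v" using greedy_exists by blast
  note v' = greedy_indep[OF v]
  show ?thesis
    using len_lower[OF indep_closed[OF v' i] indep_nonzero[OF v' i]] by (simp add: succ_min_greedy[OF v i])
qed

lemma succ_min_in_lengths_upto: "i < n \<Longrightarrow> succ_min n R i \<le> B \<Longrightarrow> succ_min n R i \<in> lengths_upto n B"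
proof -
  assume i: "i < n" and B: "succ_min n R i \<le> B"
  obtain v where v: "greedy n v" using greedy_exists by blast
  show ?thesis
    using B len_in_lengths_upto[OF indep_closed[OF greedy_indep[OF v] i]]
    by (simp add: succ_min_greedy[OF v i])
qed

lemma one_indep: "int_indep R (Suc 0) (\<lambda>_. \<one>)"
  using n_pos by (auto simp: int_indep_iff chom_one[OF hom])

lemma succ_min_0_le: "succ_min n R 0 \<le> 1"
  by (rule succ_min_le[OF one_indep]) (simp_all add: len_one n_pos)

end


section \<open>Minkowski's second theorem in rank at most four\<close>

context small_split begin

lemma abs_disc: "real_of_int \<bar>ring_disc n R\<bar> = (cmod (emb_det b))\<^sup>2"
proof -
  have "real_of_int \<bar>ring_disc n R\<bar> = cmod (of_int (ring_disc n R))" by simp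
  then show ?thesis unfolding ring_disc_eq by (simp add: norm_power)
qed

lemma abs_disc_ge_1: "1 \<le> real_of_int \<bar>ring_disc n R\<bar>"
  using ring_disc_nonzero by linarith

lemma indep_fun_closed: "int_indep R k v \<Longrightarrow> v \<in> {..<k} \<rightarrow> carrier R"
  by (simp add: int_indep_def)

lemma norm_emb_prod: "(\<Prod>j<n. (norm (emb (v j)))\<^sup>2) = real n ^ n * (\<Prod>j<n. len (v j))\<^sup>2"
  by (simp add: norm_emb prod.distrib prod_power_distrib)

lemma pow_n_le: "real n ^ n \<le> 256"
proof -
  have "real n ^ n \<le> 4 ^ n" using n_le by (intro power_mono) auto
  also have "\<dots> \<le> (4::real) ^ 4" using n_le by (intro power_increasing) auto
  finally show ?thesis by simp
qed

text \<open>Hadamard's inequality for a greedy system, whose determinant is a nonzero integer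
  multiple of that of a basis. The constant 16 is the square root of 4^4, which bounds the factor
  n^n between squared norms and squared lengths.\<close>

lemma disc_le_prod_succ_min:
  "sqrt \<bar>ring_disc n R\<bar> \<le> 16 * (\<Prod>i<n. succ_min n R i)"
proof -
  obtain v where v: "greedy n v" using greedy_exists by blast
  have ind: "int_indep R n v" using v by (rule greedy_indep)
  obtain d where d: "emb_det v = of_int d * emb_det b" "d \<noteq> 0"
    using emb_det_int_multiple[OF indep_fun_closed[OF ind]] ind by blast
  have "1 \<le> (real_of_int \<bar>d\<bar>)\<^sup>2" using d(2) by (intro one_le_power) linarith
  then have "(cmod (emb_det b))\<^sup>2 \<le> (cmod (emb_det v))\<^sup>2"
    by (simp add: d(1) norm_mult power_mult_distrib mult_right_le_one_le mult_le_cancel_right1)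
  also have "\<dots> \<le> real n ^ n * (\<Prod>j<n. len (v j))\<^sup>2"
    using hadamard[OF indep_fun_closed[OF ind]] by (simp only: norm_emb_prod)
  also have "\<dots> \<le> 256 * (\<Prod>j<n. len (v j))\<^sup>2"
    using pow_n_le by (intro mult_right_mono) auto
  also have "(\<Prod>j<n. len (v j)) = (\<Prod>i<n. succ_min n R i)"
    by (intro prod.cong refl) (simp add: succ_min_greedy[OF v])
  finally have "\<bar>ring_disc n R\<bar> \<le> (16 * (\<Prod>i<n. succ_min n R i))\<^sup>2"
    unfolding abs_disc[symmetric] by (simp add: power_mult_distrib)
  moreover have "0 \<le> (\<Prod>i<n. succ_min n R i)"
    by (intro prod_nonneg) (use succ_min_lower in \<open>force simp: less_imp_le\<close>)
  ultimately show ?thesis by (intro real_le_lsqrt) auto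
qed

section \<open>Greedy systems as reduced bases\<close>

context
  fixes v :: "nat \<Rightarrow> 'a" and w :: "nat \<Rightarrow> complex \<times> complex \<times> complex \<times> complex"
  assumes v: "greedy n v"
    and gs: "\<And>j. emb (v j) - w j \<in> span ((\<lambda>j. emb (v j)) ` {..<j})"
      "\<And>j y. y \<in> span ((\<lambda>j. emb (v j)) ` {..<j}) \<Longrightarrow> inner (w j) y = 0"
begin

lemma greedy_closed: "j < n \<Longrightarrow> v j \<in> carrier R"
  using indep_closed[OF greedy_indep[OF v]] .

lemma greedy_fun_closed: "j \<le> n \<Longrightarrow> v \<in> {..<j} \<rightarrow> carrier R"
  using greedy_closed by auto

lemma greedy_norm_mono: "i \<le> j \<Longrightarrow> j < n \<Longrightarrow> norm (emb (v i)) \<le> norm (emb (v j))"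
  unfolding norm_emb' using greedy_mono[OF v] by (simp add: mult_left_mono)

lemma gs_norm_le_greedy: "k \<le> j \<Longrightarrow> j < n \<Longrightarrow> (norm (w k))\<^sup>2 \<le> (norm (emb (v j)))\<^sup>2"
proof -
  assume kj: "k \<le> j" "j < n"
  have "norm (w k) \<le> norm (emb (v k))"
    by (rule gs_norm_le[of "\<lambda>j. emb (v j)"]) (use gs in auto)
  also have "\<dots> \<le> norm (emb (v j))" using kj by (rule greedy_norm_mono)
  finally show ?thesis by (intro power_mono) auto
qed

lemma reduce_mod:
  assumes x: "x \<in> carrier R" and j: "j \<le> n" and y: "y \<in> span ((\<lambda>j. emb (v j)) ` {..<j})"
  obtains c where
    "(norm (y - (\<Sum>k<j. of_int (c k) *\<^sub>R emb (v k))))\<^sup>2 \<le> 1/4 * (\<Sum>k<j. (norm (w k))\<^sup>2)"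
    "emb (x \<ominus> int_comb R j v c) = emb x - (\<Sum>k<j. of_int (c k) *\<^sub>R emb (v k))"
    "x \<ominus> int_comb R j v c \<in> carrier R"
proof -
  obtain c :: "nat \<Rightarrow> int" where c:
      "(norm (y - (\<Sum>k<j. of_int (c k) *\<^sub>R emb (v k))))\<^sup>2 \<le> 1/4 * (\<Sum>k<j. (norm (w k))\<^sup>2)"
    using gs_round[of "\<lambda>j. emb (v j)" w, OF gs y] by auto
  have vj: "v \<in> {..<j} \<rightarrow> carrier R" using j by (rule greedy_fun_closed)
  note cl = int_comb_closed[OF vj, of c]
  have ec: "emb (int_comb R j v c) = (\<Sum>k<j. of_int (c k) *\<^sub>R emb (v k))"
    by (rule emb_lincomb) (simp add: chom_comb[OF hom vj])
  have "emb (x \<ominus> int_comb R j v c) = emb x - emb (int_comb R j v c)"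
    unfolding emb_def Let_def by (simp add: chom_minus[OF hom x cl])
  with c x cl ec show ?thesis by (intro that[of c]) simp_all
qed

lemma not_indep_span:
  assumes j: "j \<le> n" and x: "x \<in> carrier R" and ni: "\<not> int_indep R (Suc j) (v(j := x))"
  shows "emb x \<in> span ((\<lambda>j. emb (v j)) ` {..<j})"
proof -
  have "int_indep R j v" using int_indep_initial[OF greedy_indep[OF v] j] .
  then obtain d c where dc: "d \<noteq> (0::int)"
      "\<And>i. i < n \<Longrightarrow> of_int d * s i x = (\<Sum>l<j. of_int (c l) * s i (v l))"
    by (rule not_indep_extend[OF _ x ni]) blast
  have "emb x = (\<Sum>l<j. (of_int (c l) / of_int d) *\<^sub>R emb (v l))"
  proof (rule emb_lincomb)
    fix i assume i: "i < n"
    have "of_int d * s i x = of_int d * (\<Sum>l<j. of_real (of_int (c l) / of_int d) * s i (v l))"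
      using dc(1) unfolding dc(2)[OF i] sum_distrib_left by (intro sum.cong) auto
    then show "s i x = (\<Sum>l<j. of_real (of_int (c l) / of_int d) * s i (v l))" using dc(1) by simp
  qed
  also have "\<dots> \<in> span ((\<lambda>j. emb (v j)) ` {..<j})"
    by (intro span_sum span_mul span_base) auto
  finally show ?thesis .
qed

lemma emb_in_span: "x \<in> carrier R \<Longrightarrow> emb x \<in> span ((\<lambda>j. emb (v j)) ` {..<n})"
  by (rule not_indep_span[OF order_refl _ not_indep_Suc_n])

text \<open>A vector reduced modulo \<open>v 0, \<dots>, v j\<close> has squared norm at most \<open>(j + 1)/4\<close> times that
  of \<open>v j\<close>. In rank four with \<open>j = 3\<close> this contradicts minimality only when \<open>v 0\<close> is
  strictly shorter than \<open>v 3\<close>.\<close>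

lemma greedy_spans:
  assumes strict: "n = 4 \<Longrightarrow> len (v 0) < len (v 3)"
  shows "\<lbrakk>j \<le> n; x \<in> carrier R; emb x \<in> span ((\<lambda>j. emb (v j)) ` {..<j})\<rbrakk> \<Longrightarrow>
    \<exists>c::nat \<Rightarrow> int. \<forall>i<n. s i x = (\<Sum>k<j. of_int (c k) * s i (v k))"
proof (induction j arbitrary: x)
  case 0
  then have "emb x = 0" by simp
  then show ?case using emb_eq_0 by auto
next
  case (Suc j)
  obtain c where c: "(norm (emb x - (\<Sum>k<Suc j. of_int (c k) *\<^sub>R emb (v k))))\<^sup>2
        \<le> 1/4 * (\<Sum>k<Suc j. (norm (w k))\<^sup>2)"
      "emb (x \<ominus> int_comb R (Suc j) v c) = emb x - (\<Sum>k<Suc j. of_int (c k) *\<^sub>R emb (v k))"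
      "x \<ominus> int_comb R (Suc j) v c \<in> carrier R"
    by (rule reduce_mod[OF Suc.prems(2,1,3)]) blast
  let ?y = "x \<ominus> int_comb R (Suc j) v c"
  let ?N = "(norm (emb (v j)))\<^sup>2"
  have j: "j < n" "j \<le> 3" using Suc.prems(1) n_le by auto
  have "v j \<noteq> \<zero>" using indep_nonzero[OF greedy_indep[OF v]] j by blast
  then have lp: "0 < len (v j)" using len_lower[OF greedy_closed[OF j(1)]] by simp
  have N: "0 < ?N" unfolding norm_emb using lp n_pos by simp
  have sum_le: "(\<Sum>k<m. (norm (w k))\<^sup>2) \<le> real m * ?N" if "m \<le> Suc j" for m
    using sum_mono[of "{..<m}" "\<lambda>k. (norm (w k))\<^sup>2" "\<lambda>_. ?N"] gs_norm_le_greedy[of _ j] j that by simp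
  have "1/4 * (\<Sum>k<Suc j. (norm (w k))\<^sup>2) < ?N"
  proof (cases "j = 3")
    case False
    then have "real (Suc j) * ?N \<le> 3 * ?N" using N j by (intro mult_right_mono) auto
    then show ?thesis using sum_le[of "Suc j"] N by linarith
  next
    case True
    then have n4: "n = 4" using j n_le by simp
    have "(norm (w 0))\<^sup>2 \<le> (norm (emb (v 0)))\<^sup>2" using gs_norm_le_greedy[of 0 0] n_pos by simp
    also have "\<dots> < ?N" unfolding norm_emb True using strict[OF n4] n_pos
      by (intro mult_strict_left_mono power_strict_mono) auto
    finally have "(norm (w 0))\<^sup>2 < ?N" .
    moreover have le: "(norm (w k))\<^sup>2 \<le> ?N" if "k \<le> 3" for k
      using gs_norm_le_greedy[of k j] that True j by simp
    moreover have "(norm (w 1))\<^sup>2 \<le> ?N" "(norm (w 2))\<^sup>2 \<le> ?N" "(norm (w 3))\<^sup>2 \<le> ?N"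
      by (rule le, simp)+
    ultimately have "(norm (w 0))\<^sup>2 + (norm (w 1))\<^sup>2 + (norm (w 2))\<^sup>2 + (norm (w 3))\<^sup>2 < 4 * ?N"
      by linarith
    then show ?thesis unfolding True by (simp add: eval_nat_numeral)
  qed
  then have "(norm (emb ?y))\<^sup>2 < ?N" using c by simp
  then have "(len ?y)\<^sup>2 < (len (v j))\<^sup>2" unfolding norm_emb using n_pos by simp
  then have "len ?y < len (v j)" by (rule power_less_imp_less_base) simp
  \<comment> \<open>A reduced element shorter than \<open>v j\<close> cannot extend the system, so
    it lies in the earlier span and the induction hypothesis gives it integer coordinates.\<close>
  then have "\<not> int_indep R (Suc j) (v(j := ?y))" using v j by (force simp: greedy_def)
  then have "emb ?y \<in> span ((\<lambda>j. emb (v j)) ` {..<j})"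
    using j c(3) by (intro not_indep_span) auto
  then obtain e where e: "\<forall>i<n. s i ?y = (\<Sum>k<j. of_int (e k) * s i (v k))"
    using Suc.IH[of ?y] j c(3) by auto
  have vj: "v \<in> {..<Suc j} \<rightarrow> carrier R" using Suc.prems(1) by (rule greedy_fun_closed)
  have "s i x = (\<Sum>k<Suc j. of_int (if k < j then c k + e k else c k) * s i (v k))" if i: "i < n" for i
  proof -
    have "s i x - (\<Sum>k<Suc j. of_int (c k) * s i (v k)) = (\<Sum>k<j. of_int (e k) * s i (v k))"
      using e i by (simp add: chom_minus[OF hom Suc.prems(2) int_comb_closed[OF vj]] chom_comb[OF hom vj])
    then show ?thesis by (simp add: algebra_simps sum.distrib)
  qed
  then show ?case by (intro exI[of _ "\<lambda>k. if k < j then c k + e k else c k"]) simp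
qed

text \<open>Reducing \<open>v j\<close> modulo its predecessors keeps its orthogonal component
  \<open>w j\<close> and its independence, so by minimality the result is not shorter than
  \<open>v j\<close>. The at most three predecessors contribute at most 3/4 of the squared norm,
  which leaves 1/4 for \<open>w j\<close>.\<close>

lemma greedy_near_orthogonal:
  assumes j: "j < n"
  shows "(norm (emb (v j)))\<^sup>2 \<le> 4 * (norm (w j))\<^sup>2"
proof -
  let ?N = "(norm (emb (v j)))\<^sup>2"
  obtain c where c: "(norm (emb (v j) - w j - (\<Sum>k<j. of_int (c k) *\<^sub>R emb (v k))))\<^sup>2
        \<le> 1/4 * (\<Sum>k<j. (norm (w k))\<^sup>2)"
      "emb (v j \<ominus> int_comb R j v c) = emb (v j) - (\<Sum>k<j. of_int (c k) *\<^sub>R emb (v k))"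
      "v j \<ominus> int_comb R j v c \<in> carrier R"
    by (rule reduce_mod[OF greedy_closed[OF j] less_imp_le[OF j] gs(1)[of j]]) blast
  let ?y = "v j \<ominus> int_comb R j v c"
  have vj: "v \<in> {..<j} \<rightarrow> carrier R" using j by (intro greedy_fun_closed) simp
  have indS: "int_indep R (Suc j) v" using int_indep_initial[OF greedy_indep[OF v]] j by simp
  have "int_indep R (Suc j) (v(j := ?y))"
    unfolding int_indep_iff
  proof (intro conjI allI impI)
    show "v(j := ?y) \<in> {..<Suc j} \<rightarrow> carrier R" using vj c(3) by (auto simp: less_Suc_eq)
    fix m l assume m: "\<forall>i<n. (\<Sum>l<Suc j. of_int (m l) * s i ((v(j := ?y)) l)) = 0" and l: "l < Suc j"
    let ?m = "\<lambda>l. if l < j then m l - m j * c l else m l"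
    have "(\<Sum>l<Suc j. of_int (?m l) * s i (v l)) = 0" if i: "i < n" for i
    proof -
      have "(\<Sum>l<j. of_int (m l) * s i ((v(j := ?y)) l)) = (\<Sum>l<j. of_int (m l) * s i (v l))"
        by (rule sum.cong) auto
      then have "(\<Sum>l<j. of_int (m l) * s i (v l)) + of_int (m j) * s i ?y = 0"
        using m i by simp
      then show ?thesis using i greedy_closed[OF j]
        by (simp add: chom_minus[OF hom _ int_comb_closed[OF vj]] chom_comb[OF hom vj]
            algebra_simps sum.distrib sum_subtractf sum_distrib_left)
    qed
    then have z: "?m l = 0" if "l < Suc j" for l
      using that by (intro int_indepD[OF indS, of ?m]) simp_all
    show "m l = 0" using z[of j] z[of l] l by (auto split: if_splits)
  qed
  then have "len (v j) \<le> len ?y" using v j by (auto simp: greedy_def)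
  then have "?N \<le> (norm (emb ?y))\<^sup>2"
    unfolding norm_emb by (intro mult_left_mono power_mono) auto
  also have "emb ?y = 1 *\<^sub>R w j + (emb (v j) - w j - (\<Sum>k<j. of_int (c k) *\<^sub>R emb (v k)))"
    using c(2) by simp
  also have "(norm \<dots>)\<^sup>2 = 1\<^sup>2 * (norm (w j))\<^sup>2 + (norm (emb (v j) - w j - (\<Sum>k<j. of_int (c k) *\<^sub>R emb (v k))))\<^sup>2"
    by (rule gs_pythagoras[of "\<lambda>j. emb (v j)", OF gs span_diff[OF gs(1)]])
      (auto intro!: span_sum span_mul intro: span_base)
  also have "\<dots> \<le> (norm (w j))\<^sup>2 + 1/4 * (\<Sum>k<j. (norm (w k))\<^sup>2)" using c(1) by simp
  also have "(\<Sum>k<j. (norm (w k))\<^sup>2) \<le> real j * ?N"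
    using sum_mono[of "{..<j}" "\<lambda>k. (norm (w k))\<^sup>2" "\<lambda>_. ?N"] gs_norm_le_greedy[of _ j] j by simp
  also have "\<dots> \<le> 3 * ?N" using j n_le by (intro mult_right_mono) auto
  finally show ?thesis by simp
qed

text \<open>The greedy system is a basis here, so no index enters. Near orthogonality costs a factor
  4 per vector in the squared norms, and 16 is the square root of 4^4.\<close>

lemma prod_greedy_le:
  assumes strict: "n = 4 \<Longrightarrow> len (v 0) < len (v 3)"
  shows "(\<Prod>i<n. len (v i)) \<le> 16 * sqrt \<bar>ring_disc n R\<bar>"
proof -
  have ind: "int_indep R n v" using v by (rule greedy_indep)
  have basis_v: "int_basis R n v"
    unfolding int_basis_def
  proof (intro conjI ballI ind)
    fix x assume x: "x \<in> carrier R"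
    then obtain c where c: "\<forall>i<n. s i x = (\<Sum>k<n. of_int (c k) * s i (v k))"
      using greedy_spans[OF strict order_refl x emb_in_span] by blast
    have "x = int_comb R n v c"
      using c x by (intro eq_if_homs_eq) (simp_all add: int_comb_closed indep_fun_closed[OF ind]
        chom_comb[OF hom indep_fun_closed[OF ind]])
    then show "\<exists>m. x = int_comb R n v m" by blast
  qed
  have "real n ^ n * (\<Prod>j<n. len (v j))\<^sup>2 = (\<Prod>j<n. (norm (emb (v j)))\<^sup>2)"
    by (rule norm_emb_prod[symmetric])
  also have "\<dots> \<le> (\<Prod>j<n. 4 * (norm (w j))\<^sup>2)"
    using greedy_near_orthogonal by (intro prod_mono) auto
  also have "\<dots> = 4 ^ n * (\<Prod>j<n. (norm (w j))\<^sup>2)" by (simp add: prod.distrib)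
  also have "(\<Prod>j<n. (norm (w j))\<^sup>2) = (cmod (emb_det v))\<^sup>2"
    by (rule emb_det_gram[OF indep_fun_closed[OF ind] gs, symmetric])
  also have "\<dots> = \<bar>ring_disc n R\<bar>"
    unfolding abs_disc using emb_det_basis_sq[OF basis_v] by (metis norm_power)
  also have "(4::real) ^ n * real_of_int \<bar>ring_disc n R\<bar> \<le> 4 ^ 4 * real_of_int \<bar>ring_disc n R\<bar>"
    using n_le by (intro mult_right_mono power_increasing) auto
  finally have "real n ^ n * (\<Prod>j<n. len (v j))\<^sup>2 \<le> 256 * \<bar>ring_disc n R\<bar>" by simp
  moreover have "1 * (\<Prod>j<n. len (v j))\<^sup>2 \<le> real n ^ n * (\<Prod>j<n. len (v j))\<^sup>2"
    using n_pos by (intro mult_right_mono one_le_power) auto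
  ultimately have "(\<Prod>j<n. len (v j))\<^sup>2 \<le> 256 * \<bar>ring_disc n R\<bar>" by simp
  then have "(\<Prod>j<n. len (v j)) \<le> sqrt (256 * \<bar>ring_disc n R\<bar>)" by (rule real_le_rsqrt)
  then show ?thesis by (simp add: real_sqrt_mult)
qed

end

lemma prod_succ_min_le: "(\<Prod>i<n. succ_min n R i) \<le> 16 * sqrt \<bar>ring_disc n R\<bar>"
proof -
  obtain v where v: "greedy n v" using greedy_exists by blast
  obtain w where w: "\<And>j. emb (v j) - w j \<in> span ((\<lambda>j. emb (v j)) ` {..<j})"
      "\<And>j y. y \<in> span ((\<lambda>j. emb (v j)) ` {..<j}) \<Longrightarrow> inner (w j) y = 0"
    using gram_schmidt_exists[of "\<lambda>j. emb (v j)"] by blast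
  have p: "(\<Prod>i<n. succ_min n R i) = (\<Prod>j<n. len (v j))"
    by (intro prod.cong refl) (simp add: succ_min_greedy[OF v])
  show ?thesis
  proof (cases "n = 4 \<and> len (v 3) \<le> len (v 0)")
    case False
    then show ?thesis unfolding p using prod_greedy_le[OF v w] by fastforce
  next
    case True
    \<comment> \<open>In the excluded case all four lengths are equal, and the first is at most 1
      because the unit has length 1. The product is then at most 1, while the discriminant is a
      nonzero integer.\<close>
    have l0: "len (v 0) \<le> 1" using succ_min_0_le succ_min_greedy[OF v n_pos] by simp
    have "len (v j) \<le> 1" if "j < n" for j
      using greedy_mono[OF v, of j 3] that True l0 by linarith
    then have "(\<Prod>j<n. len (v j)) \<le> 1" by (intro prod_le_1) auto
    moreover have "1 \<le> sqrt \<bar>ring_disc n R\<bar>" using abs_disc_ge_1 by simp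
    ultimately show ?thesis unfolding p by linarith
  qed
qed

end


section \<open>Extending homomorphisms to an overring of the same rank\<close>

context ring begin

lemma int_comb_Suc:
  assumes "v \<in> {..<Suc k} \<rightarrow> carrier R"
  shows "int_comb R (Suc k) v c = int_comb R k v c \<oplus> [c k] \<cdot> v k"
proof -
  have v: "v \<in> {..<k} \<rightarrow> carrier R" "v k \<in> carrier R" using assms by auto
  then have "int_comb R (Suc k) v c = [c k] \<cdot> v k \<oplus> int_comb R k v c"
    by (auto simp: int_comb_def lessThan_Suc intro!: finsum_insert)
  also have "\<dots> = int_comb R k v c \<oplus> [c k] \<cdot> v k"
    using v by (auto simp: int_comb_def intro!: a_comm finsum_closed)
  finally show ?thesis .
qed

lemma int_comb_0 [simp]: "int_comb R 0 v c = \<zero>"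
  by (simp add: int_comb_def)

lemma int_comb_add:
  assumes "v \<in> {..<k} \<rightarrow> carrier R"
  shows "int_comb R k v (\<lambda>j. c j + d j) = int_comb R k v c \<oplus> int_comb R k v d"
  using assms
proof (induction k)
  case (Suc k)
  then have v: "v \<in> {..<k} \<rightarrow> carrier R" "v k \<in> carrier R" by auto
  have p: "[(c k + d k)] \<cdot> v k = [c k] \<cdot> v k \<oplus> [d k] \<cdot> v k"
    using v(2) by (rule add.int_pow_mult)
  have cl: "int_comb R k v c \<in> carrier R" "int_comb R k v d \<in> carrier R"
      "[c k] \<cdot> v k \<in> carrier R" "[d k] \<cdot> v k \<in> carrier R"
    using v int_comb_closed by auto
  show ?case using Suc.IH[OF v(1)] cl unfolding int_comb_Suc[OF Suc.prems] p by (simp add: a_ac)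
qed simp

lemma int_comb_scale:
  assumes "v \<in> {..<k} \<rightarrow> carrier R"
  shows "[m] \<cdot> int_comb R k v c = int_comb R k v (\<lambda>j. (m :: int) * c j)"
  using assms
proof (induction k)
  case (Suc k)
  then have v: "v \<in> {..<k} \<rightarrow> carrier R" "v k \<in> carrier R" by auto
  have cl: "int_comb R k v c \<in> carrier R" "[c k] \<cdot> v k \<in> carrier R"
    using v int_comb_closed by auto
  have "[m] \<cdot> ([c k] \<cdot> v k) = [(m * c k)] \<cdot> v k"
    using add.int_pow_pow[OF v(2), of m "c k"] by (simp add: mult.commute)
  then show ?case using Suc.IH[OF v(1)] cl unfolding int_comb_Suc[OF Suc.prems]
    by (simp add: add.int_pow_distrib)
qed simp

lemma int_comb_cong:
  assumes "v \<in> {..<k} \<rightarrow> carrier R" "\<And>j. j < k \<Longrightarrow> c j = d j"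
  shows "int_comb R k v c = int_comb R k v d"
  unfolding int_comb_def using assms by (auto intro!: finsum_cong')

lemma int_comb_zero: "v \<in> {..<k} \<rightarrow> carrier R \<Longrightarrow> int_comb R k v (\<lambda>_. 0) = \<zero>"
proof (induction k)
  case (Suc k)
  then have v: "v \<in> {..<k} \<rightarrow> carrier R" "v k \<in> carrier R" by auto
  then show ?case using Suc.IH[OF v(1)] unfolding int_comb_Suc[OF Suc.prems]
    by (simp add: add_pow_int_ge)
qed simp

lemma int_comb_comb:
  assumes b: "b \<in> {..<n} \<rightarrow> carrier R"
  shows "\<lbrakk>v \<in> {..<k} \<rightarrow> carrier R; \<And>j. j < k \<Longrightarrow> v j = int_comb R n b (M j)\<rbrakk> \<Longrightarrow>
    int_comb R k v c = int_comb R n b (\<lambda>l. \<Sum>j<k. c j * M j l)"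
proof (induction k)
  case 0
  show ?case by (simp add: int_comb_zero[OF b])
next
  case (Suc k)
  then have v: "v \<in> {..<k} \<rightarrow> carrier R" by auto
  have IH: "int_comb R k v c = int_comb R n b (\<lambda>l. \<Sum>j<k. c j * M j l)"
    using Suc.IH[OF v] Suc.prems(2) by simp
  have vk: "v k = int_comb R n b (M k)" using Suc.prems(2) by simp
  show ?case unfolding int_comb_Suc[OF Suc.prems(1)] IH vk int_comb_scale[OF b]
    by (simp add: int_comb_add[OF b, symmetric])
qed

lemma rank_dependent:
  assumes b: "int_basis R n b" and v: "v \<in> {..<Suc n} \<rightarrow> carrier R"
  obtains c where "\<exists>j<Suc n. c j \<noteq> 0" "int_comb R (Suc n) v c = \<zero>"
proof -
  have bc: "b \<in> {..<n} \<rightarrow> carrier R" using b by (simp add: int_basis_def int_indep_def)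
  have "\<forall>j\<in>{..<Suc n}. \<exists>m. v j = int_comb R n b m" using b v unfolding int_basis_def by blast
  then obtain M where M: "\<And>j. j < Suc n \<Longrightarrow> v j = int_comb R n b (M j)"
    by (metis lessThan_iff)
  obtain c where c: "\<exists>j\<le>n. c j \<noteq> 0" "\<forall>l<n. (\<Sum>j\<le>n. M j l * c j) = 0"
    using wide_kernel[of n "\<lambda>l j. M j l"] by blast
  have "int_comb R (Suc n) v c = int_comb R n b (\<lambda>l. \<Sum>j<Suc n. c j * M j l)"
    by (rule int_comb_comb[OF bc v M])
  also have "\<dots> = int_comb R n b (\<lambda>_. 0)"
    using c(2) by (intro int_comb_cong[OF bc]) (simp add: lessThan_Suc_atMost mult.commute)
  finally have "int_comb R (Suc n) v c = \<zero>" by (simp add: int_comb_zero[OF bc])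
  then show ?thesis using c(1) that by (auto simp: less_Suc_eq_le)
qed

end

context ring_hom_cring begin

lemma hom_int_multiple: "x \<in> carrier R \<Longrightarrow> h ([(m::int)] \<cdot>\<^bsub>R\<^esub> x) = [m] \<cdot>\<^bsub>S\<^esub> h x"
proof -
  assume x: "x \<in> carrier R"
  have nat: "h ([(k::nat)] \<cdot>\<^bsub>R\<^esub> x) = [k] \<cdot>\<^bsub>S\<^esub> h x" for k
    using x by (induction k) simp_all
  show ?thesis
    using x by (cases "m \<ge> 0") (simp_all add: add_pow_int_ge add_pow_int_lt nat)
qed

lemma hom_comb:
  assumes "v \<in> {..<k} \<rightarrow> carrier R"
  shows "h (int_comb R k v c) = int_comb S k (\<lambda>j. h (v j)) c"
  using assms
proof (induction k)
  case 0
  then show ?case by (simp add: int_comb_def)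
next
  case (Suc k)
  then have v: "v \<in> {..<k} \<rightarrow> carrier R" "v k \<in> carrier R" by auto
  have hv: "(\<lambda>j. h (v j)) \<in> {..<Suc k} \<rightarrow> carrier S" using Suc.prems by auto
  show ?case
    unfolding R.int_comb_Suc[OF Suc.prems] S.int_comb_Suc[OF hv]
    using Suc.IH[OF v(1)] v R.int_comb_closed[OF v(1)] by (simp add: hom_int_multiple)
qed

text \<open>Every c has a nonzero multiple d c = h f, which forces the value ev f / d. It does not
  depend on the choice of d and f because h is injective.\<close>

lemma extend_complex_hom:
  assumes inj: "inj_on h (carrier R)" and ev: "ev \<in> Ring.ring_hom R complex_ring"
    and tors: "\<And>c. c \<in> carrier S \<Longrightarrow> \<exists>d f. d \<noteq> (0::int) \<and> f \<in> carrier R \<and> [d] \<cdot>\<^bsub>S\<^esub> c = h f"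
  obtains \<tau> where "\<tau> \<in> complex_homs S" "\<And>f. f \<in> carrier R \<Longrightarrow> \<tau> (h f) = ev f"
proof -
  obtain D F where D: "\<And>c. c \<in> carrier S \<Longrightarrow> D c \<noteq> (0::int)"
    and F: "\<And>c. c \<in> carrier S \<Longrightarrow> F c \<in> carrier R" "\<And>c. c \<in> carrier S \<Longrightarrow> [D c] \<cdot>\<^bsub>S\<^esub> c = h (F c)"
    using tors by metis
  define \<tau> where "\<tau> = (\<lambda>c\<in>carrier S. ev (F c) / of_int (D c))"
  have \<tau>: "\<tau> c = ev f / of_int d"
    if c: "c \<in> carrier S" and d: "d \<noteq> 0" and f: "f \<in> carrier R" "[d] \<cdot>\<^bsub>S\<^esub> c = h f" for c d f
  proof -
    have "h ([d] \<cdot>\<^bsub>R\<^esub> F c) = [d] \<cdot>\<^bsub>S\<^esub> ([D c] \<cdot>\<^bsub>S\<^esub> c)" using c F by (simp add: hom_int_multiple)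
    also have "\<dots> = [D c] \<cdot>\<^bsub>S\<^esub> ([d] \<cdot>\<^bsub>S\<^esub> c)"
      using c by (simp add: S.add.int_pow_pow mult.commute)
    also have "\<dots> = h ([D c] \<cdot>\<^bsub>R\<^esub> f)" using f by (simp add: hom_int_multiple)
    finally have "[d] \<cdot>\<^bsub>R\<^esub> F c = [D c] \<cdot>\<^bsub>R\<^esub> f"
      using inj F c f by (auto simp: inj_on_def)
    then have "ev ([d] \<cdot>\<^bsub>R\<^esub> F c) = ev ([D c] \<cdot>\<^bsub>R\<^esub> f)" by simp
    then have "of_int d * ev (F c) = of_int (D c) * ev f"
      using F c f by (simp add: R.chom_int[OF ev])
    then show ?thesis using c d D[OF c] by (simp add: \<tau>_def field_simps)
  qed
  have "\<tau> \<in> Ring.ring_hom S complex_ring"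
  proof (rule ring_hom_memI)
    fix x y assume x: "x \<in> carrier S" and y: "y \<in> carrier S"
    have "[(D x * D y)] \<cdot>\<^bsub>S\<^esub> (x \<otimes>\<^bsub>S\<^esub> y) = [D x] \<cdot>\<^bsub>S\<^esub> ([D y] \<cdot>\<^bsub>S\<^esub> (x \<otimes>\<^bsub>S\<^esub> y))"
      using S.add.int_pow_pow[of "x \<otimes>\<^bsub>S\<^esub> y" "D x" "D y"] S.m_closed[OF x y]
      by (simp only: mult.commute)
    also have "\<dots> = ([D x] \<cdot>\<^bsub>S\<^esub> x) \<otimes>\<^bsub>S\<^esub> ([D y] \<cdot>\<^bsub>S\<^esub> y)"
      using x y by (simp add: S.add_pow_ldistr_int S.add_pow_rdistr_int S.add.int_pow_pow mult.commute)
    also have "\<dots> = h (F x \<otimes>\<^bsub>R\<^esub> F y)" using x y F by simp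
    finally have "\<tau> (x \<otimes>\<^bsub>S\<^esub> y) = ev (F x \<otimes>\<^bsub>R\<^esub> F y) / of_int (D x * D y)"
      using x y D F by (intro \<tau>) auto
    then show "\<tau> (x \<otimes>\<^bsub>S\<^esub> y) = \<tau> x \<otimes>\<^bsub>complex_ring\<^esub> \<tau> y"
      using x y F by (simp add: R.chom_mult[OF ev] \<tau>_def)
    have "[(D x * D y)] \<cdot>\<^bsub>S\<^esub> (x \<oplus>\<^bsub>S\<^esub> y) = [(D x * D y)] \<cdot>\<^bsub>S\<^esub> x \<oplus>\<^bsub>S\<^esub> [(D x * D y)] \<cdot>\<^bsub>S\<^esub> y"
      using x y by (simp add: S.add.int_pow_distrib)
    also have "[(D x * D y)] \<cdot>\<^bsub>S\<^esub> x = [D y] \<cdot>\<^bsub>S\<^esub> ([D x] \<cdot>\<^bsub>S\<^esub> x)"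
      using x by (simp add: S.add.int_pow_pow)
    also have "[(D x * D y)] \<cdot>\<^bsub>S\<^esub> y = [D x] \<cdot>\<^bsub>S\<^esub> ([D y] \<cdot>\<^bsub>S\<^esub> y)"
      using y by (simp add: S.add.int_pow_pow mult.commute)
    also have "[D y] \<cdot>\<^bsub>S\<^esub> ([D x] \<cdot>\<^bsub>S\<^esub> x) \<oplus>\<^bsub>S\<^esub> [D x] \<cdot>\<^bsub>S\<^esub> ([D y] \<cdot>\<^bsub>S\<^esub> y) =
        h ([D y] \<cdot>\<^bsub>R\<^esub> F x \<oplus>\<^bsub>R\<^esub> [D x] \<cdot>\<^bsub>R\<^esub> F y)"
      using x y F by (simp add: hom_int_multiple)
    finally have "\<tau> (x \<oplus>\<^bsub>S\<^esub> y) = ev ([D y] \<cdot>\<^bsub>R\<^esub> F x \<oplus>\<^bsub>R\<^esub> [D x] \<cdot>\<^bsub>R\<^esub> F y) / of_int (D x * D y)"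
      using x y D F by (intro \<tau>) auto
    then show "\<tau> (x \<oplus>\<^bsub>S\<^esub> y) = \<tau> x \<oplus>\<^bsub>complex_ring\<^esub> \<tau> y"
      using x y F D by (simp add: R.chom_add[OF ev] R.chom_int[OF ev] \<tau>_def field_simps)
  next
    have "\<tau> \<one>\<^bsub>S\<^esub> = ev \<one>\<^bsub>R\<^esub> / of_int 1" by (rule \<tau>) auto
    then show "\<tau> \<one>\<^bsub>S\<^esub> = \<one>\<^bsub>complex_ring\<^esub>" by (simp add: R.chom_one[OF ev])
  qed simp
  moreover have "\<tau> (h f) = ev f" if "f \<in> carrier R" for f
    using \<tau>[of "h f" 1 f] that by simp
  ultimately show ?thesis by (intro that) (auto simp: complex_homs_def \<tau>_def)
qed

end

section \<open>The cubic invariant ring\<close>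

lemma closure_ring_cring: "cring (closure_ring m R)"
proof (rule cringI)
  show "abelian_group (closure_ring m R)"
  proof (rule abelian_groupI)
    fix f assume "f \<in> carrier (closure_ring m R)"
    then show "\<exists>g\<in>carrier (closure_ring m R). g \<oplus>\<^bsub>closure_ring m R\<^esub> f = \<zero>\<^bsub>closure_ring m R\<^esub>"
      by (intro bexI[of _ "\<lambda>e\<in>numberings m R. - f e"]) (auto simp: closure_ring_def)
  qed (auto simp: closure_ring_def fun_eq_iff PiE_def extensional_def)
  show "comm_monoid (closure_ring m R)"
    by (rule comm_monoidI) (auto simp: closure_ring_def fun_eq_iff PiE_def extensional_def)
qed (auto simp: closure_ring_def fun_eq_iff algebra_simps)

lemma phi43_eval:
  "e \<in> numberings 4 R \<Longrightarrow> phi43 R x e = e 1 x * e 2 x + e 3 x * e 4 x"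
  by (simp add: phi43_def closure_ring_def conjugate_def)

lemma phi43_closed: "phi43 R x \<in> carrier (closure_ring 4 R)"
  by (simp add: phi43_def closure_ring_def)

lemma cubic_invariant_ring_cring: "cring (cubic_invariant_ring R)"
proof -
  interpret cring "closure_ring 4 R" by (rule closure_ring_cring)
  have H: "phi43 R ` carrier R \<subseteq> carrier (closure_ring 4 R)" using phi43_closed by auto
  show ?thesis unfolding cubic_invariant_ring_def
    using subcring_iff[OF generate_ring_incl[OF H]] subcringI'[OF generate_ring_is_subring[OF H]] by simp
qed

lemma phi43_in_invariant_ring: "x \<in> carrier R \<Longrightarrow> phi43 R x \<in> carrier (cubic_invariant_ring R)"
  by (auto simp: cubic_invariant_ring_def intro: generate_ring.incl)

lemma eval_invariant_ring:
  assumes "e \<in> numberings 4 R"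
  shows "(\<lambda>f. f e) \<in> Ring.ring_hom (cubic_invariant_ring R) complex_ring"
  by (rule ring_hom_memI) (auto simp: cubic_invariant_ring_def closure_ring_def assms)


section \<open>Quartic rings with dihedral Galois group\<close>

context small_split begin

lemma indep_extend:
  assumes "int_indep R k v" "k \<le> n"
  shows "\<exists>v'. int_indep R n v' \<and> (\<forall>j<k. v' j = v j)"
  using assms(2)
proof (induction n rule: dec_induct)
  case base
  then show ?case using assms(1) by blast
next
  case (step m)
  then obtain v' where v': "int_indep R m v'" "\<forall>j<k. v' j = v j" by blast
  have "int_indep R (Suc m) b" using basis_indep int_indep_initial step.hyps by auto
  then obtain l where l: "int_indep R (Suc m) (v'(m := b l))"
    using int_indep_exchange[OF v'(1)] by blast
  have "\<forall>j<k. (v'(m := b l)) j = v j" using v'(2) step.hyps by simp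
  with l show ?case by blast
qed

text \<open>Completed to n independent elements, v has as determinant a nonzero multiple of that of
  a basis. So elements independent over the integers have vectors of conjugates independent over the
  complex numbers, and relations may have conjugates as coefficients.\<close>

lemma indep_complex:
  assumes v: "int_indep R k v" "k \<le> n"
    and z: "\<And>i. i < n \<Longrightarrow> (\<Sum>j<k. c j * s i (v j)) = 0" and j: "j < k"
  shows "c j = 0"
proof (rule ccontr)
  assume nz: "c j \<noteq> 0"
  from indep_extend[OF v]
  obtain v' where v': "int_indep R n v'" "\<forall>j<k. v' j = v j" by (elim exE conjE)
  obtain d where d: "emb_det v' = of_int d * emb_det b" "d \<noteq> 0"
    by (rule emb_det_int_multiple[OF indep_fun_closed[OF v'(1)]]) (use v'(1) in blast)
  let ?c = "\<lambda>l. if l < k then c l else 0"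
  have "(\<Sum>l<n. s i (v' l) * ?c l) = 0" if i: "i < n" for i
  proof -
    have "(\<Sum>l<n. s i (v' l) * ?c l) = (\<Sum>l<k. c l * s i (v l))"
      using v(2) v'(2) by (intro sum.mono_neutral_cong_right) auto
    then show ?thesis using z[OF i] by simp
  qed
  then have "emb_det v' = 0"
    unfolding emb_det_def det_fun_eq_0_iff using nz j v(2)
    by (intro exI[of _ ?c]) auto
  then show False using d emb_det_basis by simp
qed

end

lemma (in ring) int_comb_fun_cong:
  assumes "w \<in> {..<k} \<rightarrow> carrier R" "\<And>j. j < k \<Longrightarrow> v j = w j"
  shows "int_comb R k v c = int_comb R k w c"
  unfolding int_comb_def using assms by (auto intro!: finsum_cong')

locale D4_quartic = cring R for R :: "('a, 'b) ring_scheme" (structure) +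
  fixes e :: "nat \<Rightarrow> 'a \<Rightarrow> complex" and b :: "nat \<Rightarrow> 'a"
  assumes bas: "int_basis R 4 b"
    and e_num: "e \<in> numberings 4 R"
    and gal: "galois_perms 4 R e = D4"
begin

lemma e_bij: "bij_betw e {1..4} (complex_homs R)"
  using e_num by (simp add: numberings_def)

sublocale small_split R 4 "\<lambda>i. e (Suc i)" b
proof unfold_locales
  have "bij_betw Suc {..<4} {1..4}"
    by (rule bij_betwI[where g = "\<lambda>i. i - 1"]) auto
  then have "bij_betw (\<lambda>i. e (Suc i)) {..<4} (complex_homs R)"
    using bij_betw_trans[OF _ e_bij, of Suc "{..<4}"] by (simp add: comp_def)
  then show "inj_on (\<lambda>i. e (Suc i)) {..<4}" and "\<And>i. i < 4 \<Longrightarrow> e (Suc i) \<in> complex_homs R"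
    by (auto simp: bij_betw_def)
qed (use bas in auto)

lemma e_hom: "i \<in> {1..4} \<Longrightarrow> e i \<in> Ring.ring_hom R complex_ring"
  using e_bij by (auto simp: bij_betw_def complex_homs_def)

section \<open>Consequences of the four-cycle in the Galois group\<close>

definition nxt :: "nat \<Rightarrow> nat" where
  "nxt i = (if i = 4 then 1 else Suc i)"

lemma nxt_simps: "nxt (Suc 0) = 2" "nxt 1 = 2" "nxt 2 = 3" "nxt 3 = 4" "nxt 4 = 1"
  by (simp_all add: nxt_def)

lemma cycle_in_D4: "cycle_of_list [1, 2, 3, 4::nat] \<in> D4"
  unfolding D4_def by (rule generate.incl) simp

lemma cycle_nxt: "i \<in> {1..4} \<Longrightarrow> cycle_of_list [1, 2, 3, 4::nat] i = nxt i"
proof -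
  assume "i \<in> {1..4}"
  then have "i = 1 \<or> i = 2 \<or> i = 3 \<or> i = 4" by auto
  then show ?thesis by (elim disjE) (simp_all add: nxt_def Transposition.transpose_def)
qed

text \<open>K is the splitting field and \<alpha> the automorphism inducing the four-cycle. The
  listed properties are those that transport polynomial identities between conjugates.\<close>

lemma cycle_automorphism:
  obtains \<alpha> K where "\<And>i x. \<lbrakk>i \<in> {1..4}; x \<in> carrier R\<rbrakk> \<Longrightarrow> e i x \<in> K"
    "\<And>z w. \<lbrakk>z \<in> K; w \<in> K\<rbrakk> \<Longrightarrow> z - w \<in> K" "\<And>z w. \<lbrakk>z \<in> K; w \<in> K\<rbrakk> \<Longrightarrow> z * w \<in> K"
    "\<And>z w. \<lbrakk>z \<in> K; w \<in> K\<rbrakk> \<Longrightarrow> \<alpha> (z - w) = \<alpha> z - \<alpha> w"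
    "\<And>z w. \<lbrakk>z \<in> K; w \<in> K\<rbrakk> \<Longrightarrow> \<alpha> (z * w) = \<alpha> z * \<alpha> w"
    "\<And>i x. \<lbrakk>i \<in> {1..4}; x \<in> carrier R\<rbrakk> \<Longrightarrow> \<alpha> (e i x) = e (nxt i) x"
proof -
  define U where "U = (\<Union>\<sigma>\<in>complex_homs R. \<sigma> ` carrier R)"
  define K where "K = generate_field complex_ring U"
  have KK: "splitting_field R = complex_ring\<lparr>carrier := K\<rparr>"
    by (simp add: splitting_field_def K_def U_def)
  obtain \<alpha> where \<alpha>: "\<alpha> \<in> ring_iso (splitting_field R) (splitting_field R)"
      "\<forall>i\<in>{1..4}. \<forall>x\<in>carrier R. e (cycle_of_list [1, 2, 3, 4] i) x = \<alpha> (e i x)"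
    using cycle_in_D4 unfolding gal[symmetric] galois_perms_def by blast
  have hom: "\<alpha> \<in> Ring.ring_hom (splitting_field R) (splitting_field R)"
    using \<alpha>(1) by (simp add: ring_iso_def)
  have add: "z + w \<in> K" if "z \<in> K" "w \<in> K" for z w
    using generate_field.eng_add[of z complex_ring U w] that by (simp add: K_def)
  have mult: "z * w \<in> K" if "z \<in> K" "w \<in> K" for z w
    using generate_field.eng_mult[of z complex_ring U w] that by (simp add: K_def)
  have uminus: "- z \<in> K" if "z \<in> K" for z
    using generate_field.a_inv[of z complex_ring U] that by (simp add: K_def class_ring_simps)
  have diff: "z - w \<in> K" if "z \<in> K" "w \<in> K" for z w
    using add[OF that(1) uminus[OF that(2)]] by simp
  have aadd: "\<alpha> (z + w) = \<alpha> z + \<alpha> w" if "z \<in> K" "w \<in> K" for z w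
    using ring_hom_add[OF hom, of z w] that by (simp add: KK)
  have amult: "\<alpha> (z * w) = \<alpha> z * \<alpha> w" if "z \<in> K" "w \<in> K" for z w
    using ring_hom_mult[OF hom, of z w] that by (simp add: KK)
  have adiff: "\<alpha> (z - w) = \<alpha> z - \<alpha> w" if "z \<in> K" "w \<in> K" for z w
    using aadd[OF diff[OF that] that(2)] by simp
  have eK: "e i x \<in> K" if "i \<in> {1..4}" "x \<in> carrier R" for i x
  proof -
    have "e i \<in> complex_homs R" using that(1) e_bij bij_betwE by blast
    then show ?thesis unfolding K_def using that(2) by (intro generate_field.incl) (auto simp: U_def)
  qed
  show ?thesis
    by (rule that[of K \<alpha>]) (use eK diff mult adiff amult \<alpha>(2) cycle_nxt in auto)
qed

lemma eq_next:
  assumes "x \<in> carrier R" "i \<in> {1..4}" "j \<in> {1..4}" "e i x = e j x"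
  shows "e (nxt i) x = e (nxt j) x"
proof -
  obtain \<alpha> K where "\<And>i x. \<lbrakk>i \<in> {1..4}; x \<in> carrier R\<rbrakk> \<Longrightarrow> \<alpha> (e i x) = e (nxt i) x"
    by (rule cycle_automorphism) blast
  then show ?thesis using assms by metis
qed

text \<open>Collinearity of the points \<open>(e i x, e i y)\<close>, \<open>(e j x, e j y)\<close>
  and \<open>(e k x, e k y)\<close>, written without division so that an automorphism carries it
  along.\<close>

definition col :: "nat \<Rightarrow> nat \<Rightarrow> nat \<Rightarrow> 'a \<Rightarrow> 'a \<Rightarrow> bool" where
  "col i j k x y \<longleftrightarrow> (e i x - e j x) * (e i y - e k y) = (e i x - e k x) * (e i y - e j y)"

lemma col_next:
  assumes "x \<in> carrier R" "y \<in> carrier R" "i \<in> {1..4}" "j \<in> {1..4}" "k \<in> {1..4}" "col i j k x y"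
  shows "col (nxt i) (nxt j) (nxt k) x y"
proof -
  obtain \<alpha> K where K: "\<And>i x. \<lbrakk>i \<in> {1..4}; x \<in> carrier R\<rbrakk> \<Longrightarrow> e i x \<in> K"
    "\<And>z w. \<lbrakk>z \<in> K; w \<in> K\<rbrakk> \<Longrightarrow> z - w \<in> K" "\<And>z w. \<lbrakk>z \<in> K; w \<in> K\<rbrakk> \<Longrightarrow> z * w \<in> K"
    and a: "\<And>z w. \<lbrakk>z \<in> K; w \<in> K\<rbrakk> \<Longrightarrow> \<alpha> (z - w) = \<alpha> z - \<alpha> w"
    "\<And>z w. \<lbrakk>z \<in> K; w \<in> K\<rbrakk> \<Longrightarrow> \<alpha> (z * w) = \<alpha> z * \<alpha> w"
    "\<And>i x. \<lbrakk>i \<in> {1..4}; x \<in> carrier R\<rbrakk> \<Longrightarrow> \<alpha> (e i x) = e (nxt i) x"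
    by (rule cycle_automorphism) blast
  have "\<alpha> ((e i x - e j x) * (e i y - e k y)) = \<alpha> ((e i x - e k x) * (e i y - e j y))"
    using assms(6) by (simp add: col_def)
  then show ?thesis using assms(1-5) by (simp add: a K col_def)
qed

definition triple :: "'a \<Rightarrow> 'a \<Rightarrow> nat \<Rightarrow> 'a" where
  "triple x y j = (if j = 0 then \<one> else if j = 1 then x else y)"

lemma triple_closed:
  assumes "int_indep R 3 (triple x y)"
  shows "x \<in> carrier R" "y \<in> carrier R"
  using indep_closed[OF assms, of 1] indep_closed[OF assms, of 2] by (simp_all add: triple_def)

lemma all_i: "(\<forall>i<4. P (Suc i)) \<longleftrightarrow> P 1 \<and> P 2 \<and> P 3 \<and> P (4::nat)"
  by (auto simp: eval_nat_numeral less_Suc_eq)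

lemma not_all_equal:
  assumes ind: "int_indep R 2 (triple x y)"
  shows "\<not> (e 2 x = e 1 x \<and> e 3 x = e 1 x \<and> e 4 x = e 1 x)"
proof
  assume eq: "e 2 x = e 1 x \<and> e 3 x = e 1 x \<and> e 4 x = e 1 x"
  let ?c = "\<lambda>j::nat. if j = 0 then - e 1 x else 1"
  have "\<forall>i<4. (\<Sum>j<2. ?c j * e (Suc i) (triple x y j)) = 0"
    unfolding all_i[of "\<lambda>i. (\<Sum>j<2. ?c j * e i (triple x y j)) = 0"]
    using eq by (simp add: eval_nat_numeral triple_def chom_one[OF e_hom])
  then have "?c 1 = 0" by (intro indep_complex[OF ind, of ?c 1]) auto
  then show False by simp
qed

text \<open>Equality of two neighbouring conjugates travels around the four-cycle and makes all
  conjugates of x equal, against the independence of 1 and x.\<close>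

lemma adjacent_distinct:
  assumes ind: "int_indep R 2 (triple x y)" and x: "x \<in> carrier R" and i: "i \<in> {1..4}"
  shows "e i x \<noteq> e (nxt i) x"
proof
  assume eq: "e i x = e (nxt i) x"
  have nx: "nxt j \<in> {1..4}" if "j \<in> {1..4}" for j using that by (auto simp: nxt_def)
  have 1: "e (nxt i) x = e (nxt (nxt i)) x" by (rule eq_next[OF x i nx[OF i] eq])
  have 2: "e (nxt (nxt i)) x = e (nxt (nxt (nxt i))) x" by (rule eq_next[OF x nx[OF i] nx[OF nx[OF i]] 1])
  have "i = 1 \<or> i = 2 \<or> i = 3 \<or> i = 4" using i by auto
  then have "e 2 x = e 1 x \<and> e 3 x = e 1 x \<and> e 4 x = e 1 x"
    using eq 1 2 by (elim disjE) (simp_all add: nxt_simps)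
  with not_all_equal[OF ind] show False by blast
qed

lemma indep_2_triple: "int_indep R 3 (triple x y) \<Longrightarrow> int_indep R 2 (triple x y)"
  using int_indep_initial[of 3 "triple x y" 2] by simp

text \<open>A line through all four points is a complex linear relation between 1, x and y; the
  coefficient of y is nonzero because the first two conjugates of x differ.\<close>

lemma not_all_collinear:
  assumes ind: "int_indep R 3 (triple x y)"
  shows "\<not> (col 1 2 3 x y \<and> col 1 2 4 x y)"
proof
  assume c: "col 1 2 3 x y \<and> col 1 2 4 x y"
  define p q where "p = e 1 y - e 2 y" and "q = e 1 x - e 2 x"
  have q: "q \<noteq> 0"
    using adjacent_distinct[OF indep_2_triple[OF ind] triple_closed(1)[OF ind], of 1]
    by (simp add: q_def nxt_simps)
  let ?c = "\<lambda>j::nat. if j = 0 then q * e 1 y - p * e 1 x else if j = 1 then p else - q"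
  have "\<forall>i<4. (\<Sum>j<3. ?c j * e (Suc i) (triple x y j)) = 0"
    unfolding all_i[of "\<lambda>i. (\<Sum>j<3. ?c j * e i (triple x y j)) = 0"]
    using c by (simp add: eval_nat_numeral triple_def chom_one[OF e_hom] col_def p_def q_def)
      (simp add: algebra_simps)
  then have "?c 2 = 0" by (intro indep_complex[OF ind, of ?c 2]) auto
  then show False using q by simp
qed

text \<open>The images of a collinear triple under the four-cycle are collinear too, and among them
  and the triple itself are {1, 2, 3} and {1, 2, 4}, which share two points.\<close>

lemma no_three_collinear:
  assumes ind: "int_indep R 3 (triple x y)"
  shows "\<not> col 1 4 3 x y" "\<not> col 4 1 2 x y"
proof -
  note cl = triple_closed[OF ind]
  have perm: "col i j k x y = col j i k x y" "col i j k x y = col i k j x y" for i j k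
    by (auto simp: col_def algebra_simps)
  show "\<not> col 1 4 3 x y"
  proof
    assume 1: "col 1 4 3 x y"
    have 2: "col 2 1 4 x y" using col_next[OF cl _ _ _ 1] by (simp add: nxt_simps)
    have 3: "col 3 2 1 x y" using col_next[OF cl _ _ _ 2] by (simp add: nxt_simps)
    have "col 1 2 4 x y" using 2 perm by blast
    moreover have "col 1 2 3 x y" using 3 perm by metis
    ultimately show False using not_all_collinear[OF ind] by blast
  qed
  show "\<not> col 4 1 2 x y"
  proof
    assume 1: "col 4 1 2 x y"
    have 2: "col 1 2 3 x y" using col_next[OF cl _ _ _ 1] by (simp add: nxt_simps)
    have "col 1 2 4 x y" using 1 perm by metis
    then show False using 2 not_all_collinear[OF ind] by blast
  qed
qed

text \<open>The three values of \<open>phi43\<close> at x, which are the roots of the classical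
  resolvent cubic. The index stands for the splittings 12|34, 13|24 and 14|23.\<close>

definition pairing :: "nat \<Rightarrow> 'a \<Rightarrow> complex" where
  "pairing p x = (if p = 0 then e 1 x * e 2 x + e 3 x * e 4 x
    else if p = 1 then e 1 x * e 3 x + e 2 x * e 4 x else e 1 x * e 4 x + e 2 x * e 3 x)"

lemma pairing_0_1: "pairing 0 x - pairing 1 x = (e 1 x - e 4 x) * (e 2 x - e 3 x)"
  and pairing_0_2: "pairing 0 x - pairing 2 x = (e 1 x - e 3 x) * (e 2 x - e 4 x)"
  and pairing_1_2: "pairing 1 x - pairing 2 x = (e 1 x - e 2 x) * (e 3 x - e 4 x)"
  by (simp_all add: pairing_def algebra_simps)

lemma pairing_distinct:
  assumes ind: "int_indep R 2 (triple x y)" and x: "x \<in> carrier R"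
  shows "pairing 0 x \<noteq> pairing 1 x" "pairing 1 x \<noteq> pairing 2 x"
proof -
  note d = adjacent_distinct[OF ind x]
  have "e 1 x \<noteq> e 2 x" "e 2 x \<noteq> e 3 x" "e 3 x \<noteq> e 4 x" "e 4 x \<noteq> e 1 x"
    using d[of 1] d[of 2] d[of 3] d[of 4] by (simp_all add: nxt_simps)
  then show "pairing 0 x \<noteq> pairing 1 x" "pairing 1 x \<noteq> pairing 2 x"
    using pairing_0_1[of x] pairing_1_2[of x] by auto
qed

text \<open>The homomorphisms \<open>e 1\<close> and \<open>e 3\<close> differ at some x; if
  \<open>e 2\<close> and \<open>e 4\<close> agreed there, the four-cycle would make
  \<open>e 3\<close> and \<open>e 1\<close> agree. Not every nonrational x will do: elements of the
  quadratic subfield have equal opposite conjugates.\<close>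

lemma pairing_0_2_distinct: "\<exists>x\<in>carrier R. pairing 0 x \<noteq> pairing 2 x"
proof -
  have "e 1 \<noteq> e 3" using inj_onD[of e "{1..4}" 1 3] e_bij by (auto simp: bij_betw_def)
  moreover have "e 1 \<in> complex_homs R" "e 3 \<in> complex_homs R" using e_bij by (auto simp: bij_betw_def)
  ultimately obtain x where x: "x \<in> carrier R" "e 1 x \<noteq> e 3 x" using homs_differ by blast
  then have "e 2 x \<noteq> e 4 x"
    using eq_next[OF x(1), of 2 4] by (auto simp: nxt_simps)
  then have "pairing 0 x - pairing 2 x \<noteq> 0" using x(2) unfolding pairing_0_2 by simp
  then show ?thesis using x(1) by (intro bexI[of _ x]) auto
qed

text \<open>The conics \<open>pairing 0 - pairing 1\<close> and \<open>pairing 0 - pairing 2\<close>, restricted to the span of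
  \<open>x\<close> and \<open>y\<close>, split into linear forms. If they were proportional, the forms would share a root,
  which makes three of the four points \<open>(e i x, e i y)\<close> collinear.\<close>

lemma pairing_independent:
  assumes ind: "int_indep R 3 (triple x y)"
  shows "\<exists>z\<in>{y, x \<oplus> y}. \<forall>m0 m1 m2 :: int.
    (\<forall>p<3. of_int m0 + of_int m1 * pairing p x + of_int m2 * pairing p z = 0) \<longrightarrow>
      m0 = 0 \<and> m1 = 0 \<and> m2 = 0"
proof (rule ccontr)
  assume contr: "\<not> ?thesis"
  note cl = triple_closed[OF ind]
  have all3: "(\<forall>p<3. P p) \<longleftrightarrow> P 0 \<and> P 1 \<and> P (2::nat)" for P
    by (auto simp: eval_nat_numeral less_Suc_eq)
  define P where "P = pairing 0 x - pairing 1 x"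
  define Q where "Q = pairing 0 x - pairing 2 x"
  have P: "P \<noteq> 0" using pairing_distinct[OF indep_2_triple[OF ind] cl(1)] by (simp add: P_def)
  \<comment> \<open>If both choices of z failed, the two conics would be in the same ratio at x, y
    and \<open>x \<oplus> y\<close>. Three such values determine a binary quadratic form, so the
    conics would be proportional; the point \<open>x \<oplus> y\<close> controls the mixed
    term.\<close>
  have dep: "\<exists>r. pairing 0 z - pairing 1 z = r * P \<and> pairing 0 z - pairing 2 z = r * Q"
    if z: "z \<in> {y, x \<oplus> y}" for z
  proof -
    obtain m0 m1 m2 :: int where
      m: "\<forall>p<3. of_int m0 + of_int m1 * pairing p x + of_int m2 * pairing p z = 0"
      and nz: "\<not> (m0 = 0 \<and> m1 = 0 \<and> m2 = 0)" using contr z by blast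
    have m': "of_int m0 + of_int m1 * pairing 0 x + of_int m2 * pairing 0 z = 0"
      "of_int m0 + of_int m1 * pairing 1 x + of_int m2 * pairing 1 z = 0"
      "of_int m0 + of_int m1 * pairing 2 x + of_int m2 * pairing 2 z = 0"
      using m unfolding all3 by auto
    have 1: "of_int m1 * P + of_int m2 * (pairing 0 z - pairing 1 z) = 0"
      using arg_cong2[of _ _ _ _ "(-)", OF m'(1,2)] by (simp add: P_def algebra_simps)
    have 2: "of_int m1 * Q + of_int m2 * (pairing 0 z - pairing 2 z) = 0"
      using arg_cong2[of _ _ _ _ "(-)", OF m'(1,3)] by (simp add: Q_def algebra_simps)
    have "m2 \<noteq> 0" using 1 P nz m'(1) by auto
    then have m2: "(of_int m2 :: complex) \<noteq> 0" by simp
    let ?r = "- of_int m1 / of_int m2 :: complex"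
    have "pairing 0 z - pairing 1 z = ?r * P" "pairing 0 z - pairing 2 z = ?r * Q"
      using 1 2 m2 by (simp_all add: field_simps eq_neg_iff_add_eq_0)
    then show ?thesis by blast
  qed
  obtain r where r: "pairing 0 y - pairing 1 y = r * P" "pairing 0 y - pairing 2 y = r * Q"
    using dep[of y] by blast
  obtain r' where r': "pairing 0 (x \<oplus> y) - pairing 1 (x \<oplus> y) = r' * P"
      "pairing 0 (x \<oplus> y) - pairing 2 (x \<oplus> y) = r' * Q"
    using dep[of "x \<oplus> y"] by blast
  define x14 x23 x13 x24 where x: "x14 = e 1 x - e 4 x" and "x23 = e 2 x - e 3 x"
    and "x13 = e 1 x - e 3 x" and "x24 = e 2 x - e 4 x"
  define y14 y23 y13 y24 where y: "y14 = e 1 y - e 4 y" and "y23 = e 2 y - e 3 y"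
    and "y13 = e 1 y - e 3 y" and "y24 = e 2 y - e 4 y"
  note defs = x x23_def x13_def x24_def y y23_def y13_def y24_def
  have PQ: "P = x14 * x23" "Q = x13 * x24"
    unfolding P_def Q_def pairing_0_1 pairing_0_2 defs by simp_all
  have ry: "y14 * y23 = r * P" "y13 * y24 = r * Q"
    using r unfolding pairing_0_1 pairing_0_2 defs by simp_all
  have e_add: "e i (x \<oplus> y) = e i x + e i y" if "i \<in> {1..4}" for i
    using chom_add[OF e_hom[OF that] cl] .
  have "(x14 + y14) * (x23 + y23) = r' * P" "(x13 + y13) * (x24 + y24) = r' * Q"
    using r' unfolding pairing_0_1 pairing_0_2 defs by (simp_all add: e_add algebra_simps)
  then have mixed: "x14 * y23 + y14 * x23 = (r' - 1 - r) * P" "x13 * y24 + y13 * x24 = (r' - 1 - r) * Q"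
    using PQ ry by (simp_all add: algebra_simps)
  \<comment> \<open>The left side is the second conic at the combination y14 x - x14 y, where the
    linear form with coefficients x14 and y14 vanishes. The first conic contains this form as a
    factor and vanishes there, so by proportionality the second does too.\<close>
  have "(y14 * x13 - x14 * y13) * (y14 * x24 - x14 * y24) =
      y14 * y14 * (x13 * x24) - x14 * y14 * (x13 * y24 + y13 * x24) + x14 * x14 * (y13 * y24)"
    by (simp add: algebra_simps)
  also have "\<dots> = y14 * y14 * Q - x14 * y14 * ((r' - 1 - r) * Q) + x14 * x14 * (r * Q)"
    by (simp only: mixed(2) ry(2) PQ(2)[symmetric])
  finally have pr: "(y14 * x13 - x14 * y13) * (y14 * x24 - x14 * y24) =
      y14 * y14 * Q - x14 * y14 * ((r' - 1 - r) * Q) + x14 * x14 * (r * Q)" .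
  have "P * ((y14 * x13 - x14 * y13) * (y14 * x24 - x14 * y24)) =
      Q * (y14 * y14 * P - x14 * y14 * ((r' - 1 - r) * P) + x14 * x14 * (r * P))"
    unfolding pr by (simp add: algebra_simps)
  also have "y14 * y14 * P - x14 * y14 * ((r' - 1 - r) * P) + x14 * x14 * (r * P) =
      y14 * y14 * (x14 * x23) - x14 * y14 * (x14 * y23 + y14 * x23) + x14 * x14 * (y14 * y23)"
    by (simp only: mixed(1) ry(1) PQ(1)[symmetric])
  also have "\<dots> = 0" by (simp add: algebra_simps)
  finally have "P * ((y14 * x13 - x14 * y13) * (y14 * x24 - x14 * y24)) = 0" by simp
  then have "y14 * x13 = x14 * y13 \<or> y14 * x24 = x14 * y24" using P by auto
  then have "col 1 4 3 x y \<or> col 4 1 2 x y"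
    unfolding col_def defs by (auto simp: algebra_simps)
  then show False using no_three_collinear[OF ind] by blast
qed

end


lemma less_3: "p < (3::nat) \<longleftrightarrow> p = 0 \<or> p = 1 \<or> p = 2"
  by auto

context D4_quartic begin

text \<open>Transposing 2 and 3, or 2 and 4, turns the splitting 12|34 used by \<open>phi43\<close>
  into 13|24 or 14|23.\<close>

definition renum :: "nat \<Rightarrow> nat \<Rightarrow> 'a \<Rightarrow> complex" where
  "renum p = (\<lambda>i\<in>{1..4}. e ((if p = 0 then id else if p = 1 then Transposition.transpose 2 3
     else Transposition.transpose 2 4) i))"

lemma renum_numbering: "renum p \<in> numberings 4 R"
proof -
  let ?\<sigma> = "if p = 0 then id else if p = 1 then Transposition.transpose 2 3
     else Transposition.transpose 2 (4::nat)"
  have "?\<sigma> permutes {1..4}" by (auto intro: permutes_swap_id permutes_id)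
  then have "bij_betw ?\<sigma> {1..4} {1..4}" by (rule permutes_imp_bij)
  then have "bij_betw (e \<circ> ?\<sigma>) {1..4} (complex_homs R)" using e_bij by (rule bij_betw_trans)
  then have "bij_betw (renum p) {1..4} (complex_homs R)"
    by (rule bij_betw_cong[THEN iffD1, rotated]) (simp add: renum_def)
  then show ?thesis by (simp add: numberings_def renum_def)
qed

lemma phi43_renum: "phi43 R x (renum p) = pairing p x"
  unfolding phi43_eval[OF renum_numbering]
  by (simp add: renum_def pairing_def Transposition.transpose_def)

text \<open>A greedy system need not contain the unit, so its elements are exchanged into a system
  that starts with it. The exchange takes the second element among the first two greedy ones and the
  third among the first three, which keeps the length bounds.\<close>

lemma short_triple:
  obtains x y where "int_indep R 3 (triple x y)" "len x \<le> succ_min 4 R 1" "len y \<le> succ_min 4 R 2"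
proof -
  obtain v where v: "greedy 4 v" using greedy_exists by blast
  have ind: "int_indep R k v" if "k \<le> 4" for k
    using int_indep_initial[OF greedy_indep[OF v] that] .
  from int_indep_exchange[OF one_indep ind[of "Suc (Suc 0)"]]
  obtain k where k: "k \<le> Suc 0" "int_indep R (Suc (Suc 0)) ((\<lambda>_. \<one>)(Suc 0 := v k))" by auto
  from int_indep_exchange[OF k(2) ind[of "Suc (Suc (Suc 0))"]]
  obtain l where l: "l \<le> Suc (Suc 0)"
    "int_indep R (Suc (Suc (Suc 0))) ((\<lambda>_. \<one>)(Suc 0 := v k, Suc (Suc 0) := v l))" by auto
  have "int_indep R (Suc (Suc (Suc 0))) (triple (v k) (v l))"
    using l(2) by (rule int_indep_cong[THEN iffD2, rotated]) (auto simp: triple_def less_Suc_eq)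
  then have "int_indep R 3 (triple (v k) (v l))" by (simp add: eval_nat_numeral)
  moreover have "len (v k) \<le> succ_min 4 R 1"
    using greedy_mono[OF v, of k 1] k(1) by (simp add: succ_min_greedy[OF v])
  moreover have "len (v l) \<le> succ_min 4 R 2"
  proof -
    have "l \<le> 2" using l(1) by simp
    then show ?thesis using greedy_mono[OF v, of l 2] by (simp add: succ_min_greedy[OF v])
  qed
  ultimately show ?thesis by (rule that)
qed

text \<open>The map \<theta> is \<open>phi43\<close> followed by the given embedding of the
  invariant ring. The images of 1, x and z under it and the embedding show that every element of C
  has a nonzero multiple in the invariant ring, so the evaluations at the three renumberings extend
  to C.\<close>

lemma resolvent_split:
  assumes C: "cubic_resolvent R C"
  obtains \<theta> sC bC where "split_ring C 3 sC bC" "\<And>x. x \<in> carrier R \<Longrightarrow> \<theta> x \<in> carrier C"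
    "\<And>x p. x \<in> carrier R \<Longrightarrow> p < 3 \<Longrightarrow> sC p (\<theta> x) = pairing p x"
proof -
  let ?A = "cubic_invariant_ring R"
  obtain \<iota> where \<iota>: "\<iota> \<in> Ring.ring_hom ?A C" "inj_on \<iota> (carrier ?A)"
    using C by (auto simp: cubic_resolvent_def)
  obtain bC where bC: "int_basis C 3 bC" and cC: "cring C"
    using C by (auto simp: cubic_resolvent_def rank_ring_def)
  interpret \<iota>: ring_hom_cring ?A C \<iota>
    using \<iota>(1) cC cubic_invariant_ring_cring
    by (simp add: ring_hom_cring_def ring_hom_cring_axioms_def)
  have ev: "(\<lambda>f. f (renum p)) \<in> Ring.ring_hom ?A complex_ring" for p
    by (rule eval_invariant_ring[OF renum_numbering])
  have phi: "phi43 R x \<in> carrier ?A" if "x \<in> carrier R" for x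
    using that by (rule phi43_in_invariant_ring)
  obtain x y where xy: "int_indep R 3 (triple x y)" using short_triple by blast
  note cl = triple_closed[OF xy]
  obtain z where z: "z \<in> {y, x \<oplus> y}" and zall: "\<forall>m0 m1 m2 :: int.
      (\<forall>p<3. of_int m0 + of_int m1 * pairing p x + of_int m2 * pairing p z = 0) \<longrightarrow>
      m0 = 0 \<and> m1 = 0 \<and> m2 = 0"
    using pairing_independent[OF xy] by (rule bexE)
  note zind = zall[THEN spec, THEN spec, THEN spec, THEN mp]
  have zc: "z \<in> carrier R" using z cl by auto
  define f where "f j = (if j = 0 then \<one>\<^bsub>?A\<^esub> else if j = 1 then phi43 R x else phi43 R z)" for j :: nat
  have fc: "f \<in> {..<3} \<rightarrow> carrier ?A" using phi cl zc by (auto simp: f_def)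
  have "\<exists>d g. d \<noteq> (0::int) \<and> g \<in> carrier ?A \<and> [d] \<cdot>\<^bsub>C\<^esub> c = \<iota> g" if c: "c \<in> carrier C" for c
  proof -
    define v where "v j = (if j < 3 then \<iota> (f j) else c)" for j :: nat
    have fj: "f j \<in> carrier ?A" if "j < 3" for j using fc that by auto
    have vc: "v \<in> {..<Suc 3} \<rightarrow> carrier C" using fj c by (auto simp: v_def)
    obtain k where k: "\<exists>j<Suc 3. k j \<noteq> 0" "int_comb C (Suc 3) v k = \<zero>\<^bsub>C\<^esub>"
      using \<iota>.S.rank_dependent[OF bC vc] by blast
    let ?g = "int_comb ?A 3 f k"
    have gc: "?g \<in> carrier ?A" using fc by (rule \<iota>.R.int_comb_closed)
    have "int_comb C 3 v k = int_comb C 3 (\<lambda>j. \<iota> (f j)) k"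
      using fj by (intro \<iota>.S.int_comb_fun_cong) (auto simp: v_def)
    also have "\<dots> = \<iota> ?g" using \<iota>.hom_comb[OF fc] by simp
    finally have eq: "\<iota> ?g \<oplus>\<^bsub>C\<^esub> [k 3] \<cdot>\<^bsub>C\<^esub> c = \<zero>\<^bsub>C\<^esub>"
      using k(2) unfolding \<iota>.S.int_comb_Suc[OF vc] by (simp add: v_def)
    \<comment> \<open>Otherwise injectivity pulls the relation back to the invariant ring, and
      evaluating it at the three renumberings contradicts the choice of z.\<close>
    have "k 3 \<noteq> 0"
    proof
      assume k3: "k 3 = 0"
      then have "[k 3] \<cdot>\<^bsub>C\<^esub> c = \<zero>\<^bsub>C\<^esub>" by (simp add: add_pow_int_ge)
      then have "\<iota> ?g = \<iota> \<zero>\<^bsub>?A\<^esub>" using eq gc by simp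
      then have g0: "?g = \<zero>\<^bsub>?A\<^esub>" using \<iota>(2) gc by (auto simp: inj_on_def)
      have "of_int (k 0) + of_int (k 1) * pairing p x + of_int (k 2) * pairing p z = 0" for p
      proof -
        have "(\<Sum>j<3. of_int (k j) * f j (renum p)) = ?g (renum p)"
          using \<iota>.R.chom_comb[OF ev fc] by simp
        also have "\<dots> = 0" using \<iota>.R.chom_zero[OF ev] by (simp add: g0)
        finally show ?thesis using \<iota>.R.chom_one[OF ev, of p]
          by (simp add: eval_nat_numeral f_def phi43_renum)
      qed
      then have "k 0 = 0 \<and> k 1 = 0 \<and> k 2 = 0" by (intro zind) simp
      then show False using k(1) k3 by (auto simp: eval_nat_numeral less_Suc_eq)
    qed
    moreover have "[k 3] \<cdot>\<^bsub>C\<^esub> c = \<iota> (\<ominus>\<^bsub>?A\<^esub> ?g)"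
      using eq gc c by (simp add: \<iota>.S.minus_equality[symmetric] \<iota>.S.a_comm)
    ultimately show ?thesis using gc by (intro exI[of _ "k 3"] exI[of _ "\<ominus>\<^bsub>?A\<^esub> ?g"]) simp
  qed
  then have "\<forall>p. \<exists>\<tau>. \<tau> \<in> complex_homs C \<and> (\<forall>g\<in>carrier ?A. \<tau> (\<iota> g) = g (renum p))"
    using \<iota>.extend_complex_hom[OF \<iota>(2) ev] by metis
  then obtain sC where sC: "\<And>p. sC p \<in> complex_homs C"
      "\<And>p g. g \<in> carrier ?A \<Longrightarrow> sC p (\<iota> g) = g (renum p)" by metis
  have val: "sC p (\<iota> (phi43 R w)) = pairing p w" if "w \<in> carrier R" for p w
    using sC(2)[OF phi[OF that]] by (simp add: phi43_renum)
  \<comment> \<open>The element x separates pairing 1 from the other two; pairings 0 and 2 may agree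
    at x and need an element of their own.\<close>
  obtain u where u: "u \<in> carrier R" "pairing 0 u \<noteq> pairing 2 u" using pairing_0_2_distinct by blast
  note pd = pairing_distinct[OF indep_2_triple[OF xy] cl(1)]
  have ne: "sC 0 \<noteq> sC 1" "sC 1 \<noteq> sC 2" "sC 0 \<noteq> sC 2"
    using pd val[OF cl(1), of 0] val[OF cl(1), of 1] val[OF cl(1), of 2] val[OF u(1), of 0] val[OF u(1), of 2] u(2)
    by metis+
  have "split_ring C 3 sC bC"
  proof (intro split_ring.intro split_ring_axioms.intro cC bC sC(1))
    show "inj_on sC {..<3}"
      unfolding inj_on_def using ne by (auto simp: less_3)
  qed
  then show ?thesis using val phi by (intro that[of sC bC "\<lambda>x. \<iota> (phi43 R x)"]) auto
qed

lemma pairing_bound: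
  assumes "p < 3"
  shows "cmod (pairing p x) \<le> 2 * (len x)\<^sup>2"
proof -
  have ab: "cmod (z * w) \<le> ((cmod z)\<^sup>2 + (cmod w)\<^sup>2) / 2" for z w
    using sum_squares_bound[of "cmod z" "cmod w"] by (simp add: norm_mult)
  have S: "4 * (len x)\<^sup>2 = (cmod (e 1 x))\<^sup>2 + (cmod (e 2 x))\<^sup>2 + (cmod (e 3 x))\<^sup>2 + (cmod (e 4 x))\<^sup>2"
    using len_sq[of x] by (simp add: eval_nat_numeral)
  have *: "cmod (z * w + z' * w') \<le> 2 * (len x)\<^sup>2"
    if "(cmod z)\<^sup>2 + (cmod w)\<^sup>2 + (cmod z')\<^sup>2 + (cmod w')\<^sup>2 = 4 * (len x)\<^sup>2" for z w z' w'
  proof -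
    have "cmod (z * w + z' * w') \<le> cmod (z * w) + cmod (z' * w')" by (rule norm_triangle_ineq)
    also have "\<dots> \<le> ((cmod z)\<^sup>2 + (cmod w)\<^sup>2) / 2 + ((cmod z')\<^sup>2 + (cmod w')\<^sup>2) / 2"
      by (intro add_mono ab)
    also have "\<dots> = ((cmod z)\<^sup>2 + (cmod w)\<^sup>2 + (cmod z')\<^sup>2 + (cmod w')\<^sup>2) / 2"
      by (simp add: add_divide_distrib)
    finally show ?thesis unfolding that by simp
  qed
  show ?thesis
    using assms unfolding less_3 pairing_def
    by (elim disjE) (simp_all add: S *)
qed

lemma len_add: "\<lbrakk>x \<in> carrier R; y \<in> carrier R\<rbrakk> \<Longrightarrow> (len (x \<oplus> y))\<^sup>2 \<le> 2 * (len x)\<^sup>2 + 2 * (len y)\<^sup>2"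
proof -
  assume cl: "x \<in> carrier R" "y \<in> carrier R"
  have "(cmod (z + w))\<^sup>2 \<le> 2 * (cmod z)\<^sup>2 + 2 * (cmod w)\<^sup>2" for z w
  proof -
    have "(cmod (z + w))\<^sup>2 \<le> (cmod z + cmod w)\<^sup>2" by (intro power_mono norm_triangle_ineq) simp
    also have "\<dots> \<le> 2 * (cmod z)\<^sup>2 + 2 * (cmod w)\<^sup>2"
      using sum_squares_bound[of "cmod z" "cmod w"] by (simp add: power2_sum)
    finally show ?thesis .
  qed
  then have "(\<Sum>k<4. (cmod (e (Suc k) (x \<oplus> y)))\<^sup>2) \<le>
      (\<Sum>k<4. 2 * (cmod (e (Suc k) x))\<^sup>2 + 2 * (cmod (e (Suc k) y))\<^sup>2)"
    by (intro sum_mono) (simp add: chom_add[OF hom cl])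
  then have "4 * (len (x \<oplus> y))\<^sup>2 \<le> 2 * (4 * (len x)\<^sup>2) + 2 * (4 * (len y)\<^sup>2)"
    using len_sq[of x] len_sq[of y] len_sq[of "x \<oplus> y"]
    by (simp add: sum.distrib sum_distrib_left[symmetric])
  then show ?thesis by simp
qed

text \<open>The constant 16 meets two demands: the image of \<open>x \<oplus> y\<close> has length
  at most 2 * 4 times the squared second minimum, and the unit must satisfy the same bounds, which
  it does because minima are at least 1/4.\<close>

lemma resolvent_minima:
  assumes C: "cubic_resolvent R C"
  obtains sC bC where "small_split C 3 sC bC"
    "succ_min 3 C 1 \<le> 16 * (succ_min 4 R 1)\<^sup>2" "succ_min 3 C 2 \<le> 16 * (succ_min 4 R 2)\<^sup>2"
proof -
  obtain \<theta> sC bC where s: "split_ring C 3 sC bC" and \<theta>: "\<And>x. x \<in> carrier R \<Longrightarrow> \<theta> x \<in> carrier C"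
    "\<And>x p. x \<in> carrier R \<Longrightarrow> p < 3 \<Longrightarrow> sC p (\<theta> x) = pairing p x"
    using C by (rule resolvent_split) blast
  interpret c: small_split C 3 sC bC
    using s by (intro small_split.intro small_split_axioms.intro) auto
  obtain x y where xy: "int_indep R 3 (triple x y)"
    and lx: "len x \<le> succ_min 4 R 1" and ly: "len y \<le> succ_min 4 R 2"
    by (rule short_triple)
  note cl = triple_closed[OF xy]
  obtain z where z: "z \<in> {y, x \<oplus> y}" and zall: "\<forall>m0 m1 m2 :: int.
      (\<forall>p<3. of_int m0 + of_int m1 * pairing p x + of_int m2 * pairing p z = 0) \<longrightarrow>
      m0 = 0 \<and> m1 = 0 \<and> m2 = 0"
    using pairing_independent[OF xy] by (rule bexE)
  note zind = zall[THEN spec, THEN spec, THEN spec, THEN mp]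
  have zc: "z \<in> carrier R" using z cl by auto
  define f where "f j = (if j = 0 then \<one>\<^bsub>C\<^esub> else if j = 1 then \<theta> x else \<theta> z)" for j :: nat
  have ind: "int_indep C 3 f"
    unfolding c.int_indep_iff
  proof (intro conjI allI impI)
    show "f \<in> {..<3} \<rightarrow> carrier C" using \<theta>(1) cl zc by (auto simp: f_def)
    fix m j assume m: "\<forall>i<3. (\<Sum>j<3. of_int (m j) * sC i (f j)) = 0" and j: "j < (3::nat)"
    have "m 0 = 0 \<and> m 1 = 0 \<and> m 2 = 0"
    proof (rule zind, intro allI impI)
      fix p :: nat assume p: "p < 3"
      show "of_int (m 0) + of_int (m 1) * pairing p x + of_int (m 2) * pairing p z = 0"
        using m[rule_format, OF p]
        by (simp add: eval_nat_numeral f_def c.chom_one[OF c.hom[OF p]] \<theta>(2)[OF cl(1) p] \<theta>(2)[OF zc p])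
    qed
    then show "m j = 0" using j by (auto simp: less_3)
  qed
  have len_\<theta>: "c.len (\<theta> w) \<le> 2 * (len w)\<^sup>2" if w: "w \<in> carrier R" for w
  proof (rule power2_le_imp_le)
    have "3 * (c.len (\<theta> w))\<^sup>2 = (\<Sum>k<3. (cmod (pairing k w))\<^sup>2)"
      using c.len_sq[of "\<theta> w"] \<theta>(2)[OF w] by simp
    also have "\<dots> \<le> (\<Sum>k<(3::nat). (2 * (len w)\<^sup>2)\<^sup>2)"
      using pairing_bound by (intro sum_mono power_mono) auto
    finally show "(c.len (\<theta> w))\<^sup>2 \<le> (2 * (len w)\<^sup>2)\<^sup>2" by simp
  qed simp
  have l1: "1 \<le> 16 * (succ_min 4 R i)\<^sup>2" if "i < 4" for i
  proof -
    have "(1/4)\<^sup>2 \<le> (succ_min 4 R i)\<^sup>2" using succ_min_lower[OF that] by (intro power_mono) auto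
    then show ?thesis by (simp add: power2_eq_square)
  qed
  have sq: "(len x)\<^sup>2 \<le> (succ_min 4 R 1)\<^sup>2" "(len y)\<^sup>2 \<le> (succ_min 4 R 2)\<^sup>2"
    using lx ly by (auto intro: power_mono)
  have m12: "succ_min 4 R 1 \<le> succ_min 4 R 2" by (rule succ_min_mono) auto
  then have "(succ_min 4 R 1)\<^sup>2 \<le> (succ_min 4 R 2)\<^sup>2"
    using succ_min_lower[of 1] by (intro power_mono) auto
  then have x2: "(len x)\<^sup>2 \<le> (succ_min 4 R 2)\<^sup>2" using sq(1) by linarith
  have "z = y \<or> z = x \<oplus> y" using z by simp
  then have "(len z)\<^sup>2 \<le> 4 * (succ_min 4 R 2)\<^sup>2"
  proof
    assume zy: "z = y"
    show ?thesis unfolding zy using sq(2) zero_le_power2[of "succ_min 4 R 2"] by linarith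
  next
    assume zy: "z = x \<oplus> y"
    show ?thesis unfolding zy using len_add[OF cl] x2 sq(2) by linarith
  qed
  then have z2: "c.len (\<theta> z) \<le> 16 * (succ_min 4 R 2)\<^sup>2"
    using len_\<theta>[OF zc] zero_le_power2[of "succ_min 4 R 2"] by linarith
  have x1: "c.len (\<theta> x) \<le> 16 * (succ_min 4 R 1)\<^sup>2"
    using len_\<theta>[OF cl(1)] sq(1) zero_le_power2[of "succ_min 4 R 1"] by linarith
  have x2': "c.len (\<theta> x) \<le> 16 * (succ_min 4 R 2)\<^sup>2"
    using len_\<theta>[OF cl(1)] x2 zero_le_power2[of "succ_min 4 R 2"] by linarith
  have i2: "int_indep C (Suc 1) f" using c.int_indep_initial[OF ind, of "Suc 1"] by simp
  have i3: "int_indep C (Suc 2) f" using ind by (simp add: eval_nat_numeral)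
  have s1: "succ_min 3 C 1 \<le> 16 * (succ_min 4 R 1)\<^sup>2"
  proof (rule c.succ_min_le[OF i2])
    fix j :: nat assume "j \<le> 1"
    then have "j = 0 \<or> j = 1" by auto
    then show "c.len (f j) \<le> 16 * (succ_min 4 R 1)\<^sup>2"
      using x1 l1[of 1] by (elim disjE) (simp_all add: f_def c.len_one)
  qed simp
  have s2: "succ_min 3 C 2 \<le> 16 * (succ_min 4 R 2)\<^sup>2"
  proof (rule c.succ_min_le[OF i3])
    fix j :: nat assume "j \<le> 2"
    then have "j = 0 \<or> j = 1 \<or> j = 2" by auto
    then show "c.len (f j) \<le> 16 * (succ_min 4 R 2)\<^sup>2"
      using x2' z2 l1[of 2] by (elim disjE) (simp_all add: f_def c.len_one)
  qed simp
  show ?thesis using s1 s2 by (rule that[OF c.small_split_axioms])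
qed

end

lemma D4_pair_bounds:
  assumes "nondegenerate 4 R" "G_ring 4 D4 R" "cubic_resolvent R C"
  obtains s b sC bC where "small_split R 4 s b" "small_split C 3 sC bC"
    "ring_disc 3 C = ring_disc 4 R"
    "succ_min 3 C 1 \<le> 16 * (succ_min 4 R 1)\<^sup>2" "succ_min 3 C 2 \<le> 16 * (succ_min 4 R 2)\<^sup>2"
proof -
  obtain b where b: "cring R" "int_basis R 4 b"
    using assms(1) by (auto simp: nondegenerate_def rank_ring_def)
  obtain e where e: "e \<in> numberings 4 R" "galois_perms 4 R e = D4"
    using assms(2) by (auto simp: G_ring_def)
  interpret D4_quartic R e b
    using b e by (simp add: D4_quartic_def D4_quartic_axioms_def)
  have d: "ring_disc 3 C = ring_disc 4 R" using assms(3) by (simp add: cubic_resolvent_def)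
  show ?thesis
    using assms(3)
  proof (rule resolvent_minima)
    fix sC bC
    assume "small_split C 3 sC bC" "succ_min 3 C 1 \<le> 16 * (succ_min 4 R 1)\<^sup>2"
      "succ_min 3 C 2 \<le> 16 * (succ_min 4 R 2)\<^sup>2"
    then show thesis using that small_split_axioms d by blast
  qed
qed


section \<open>Limit points satisfy the inequalities\<close>

text \<open>The target region with slack \<delta> for the constants. It is closed, so limit points
  stay inside; the orderings hold exactly and get no slack.\<close>

definition exponent_region :: "real \<Rightarrow> (real \<times> real \<times> real \<times> real \<times> real) set" where
  "exponent_region \<delta> = {(p1, p2, p3, q1, q2). - \<delta> \<le> p1 \<and> p1 \<le> p2 \<and> p2 \<le> p3 \<and>
     p1 + p2 + p3 \<le> 1/2 + \<delta> \<and> 1/2 - \<delta> \<le> p1 + p2 + p3 \<and>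
     - \<delta> \<le> q1 \<and> q1 \<le> q2 \<and> q1 + q2 \<le> 1/2 + \<delta> \<and> 1/2 - \<delta> \<le> q1 + q2 \<and>
     q1 \<le> 2 * p1 + \<delta> \<and> q2 \<le> 2 * p2 + \<delta>}"

lemma closed_exponent_region: "closed (exponent_region \<delta>)"
  unfolding exponent_region_def case_prod_beta
  by (intro closed_Collect_conj closed_Collect_le continuous_intros)

lemma exponent_region_limit:
  assumes "\<And>\<delta>. \<delta> > 0 \<Longrightarrow> p \<in> exponent_region \<delta>"
  shows "p \<in> exponent_region 0"
proof -
  obtain p1 p2 p3 q1 q2 where p: "p = (p1, p2, p3, q1, q2)" by (cases p)
  note a = assms[unfolded p exponent_region_def, simplified]
  have "0 \<le> p1" "0 \<le> q1" by (rule field_le_epsilon, use a in force)+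
  moreover have "p1 + p2 + p3 \<le> 1/2" "q1 + q2 \<le> 1/2" "q1 \<le> 2 * p1" "q2 \<le> 2 * p2"
    by (rule field_le_epsilon, use a in force)+
  moreover have "1/2 \<le> p1 + p2 + p3" "1/2 \<le> q1 + q2"
    by (rule field_le_epsilon, use a in force)+
  ultimately show ?thesis using a[of 1] by (simp add: p exponent_region_def)
qed

lemma prod_4: "(\<Prod>i<(4::nat). f i) = f 0 * f 1 * f 2 * (f 3 :: real)"
  by (simp add: eval_nat_numeral)

lemma prod_3: "(\<Prod>i<(3::nat). f i) = f 0 * f 1 * (f 2 :: real)"
  by (simp add: eval_nat_numeral)

text \<open>The minimum of index 0 lies between 1/4 and 1, so removing it from the product costs at
  most a factor 4, and 64 = 4 * 16.\<close>

lemma quartic_minima_bounds: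
  assumes "small_split R 4 s b"
  defines "l \<equiv> succ_min 4 R" and "D \<equiv> real_of_int \<bar>ring_disc 4 R\<bar>"
  shows "1 \<le> D" "1/4 \<le> l 1" "l 1 \<le> l 2" "l 2 \<le> l 3"
    "l 1 * l 2 * l 3 \<le> 64 * sqrt D" "sqrt D \<le> 64 * (l 1 * l 2 * l 3)"
proof -
  interpret small_split R 4 s b by fact
  show "1 \<le> D" unfolding D_def by (rule abs_disc_ge_1)
  show l1: "1/4 \<le> l 1" unfolding l_def by (rule succ_min_lower) simp
  show "l 1 \<le> l 2" "l 2 \<le> l 3" unfolding l_def by (rule succ_min_mono; simp)+
  then have pos: "0 \<le> l 1 * l 2 * l 3" using l1 by simp
  have l0: "1/4 \<le> l 0" "l 0 \<le> 1" unfolding l_def by (rule succ_min_lower succ_min_0_le; simp)+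
  have "1/4 * (l 1 * l 2 * l 3) \<le> l 0 * (l 1 * l 2 * l 3)" using l0 pos by (intro mult_right_mono)
  also have "\<dots> \<le> 16 * sqrt D" using prod_succ_min_le by (simp add: l_def D_def prod_4 mult.assoc)
  finally show "l 1 * l 2 * l 3 \<le> 64 * sqrt D" by simp
  have "sqrt D \<le> 16 * (l 0 * (l 1 * l 2 * l 3))"
    using disc_le_prod_succ_min by (simp add: l_def D_def prod_4 mult.assoc)
  also have "l 0 * (l 1 * l 2 * l 3) \<le> 1 * (l 1 * l 2 * l 3)" using l0 pos by (intro mult_right_mono)
  finally show "sqrt D \<le> 64 * (l 1 * l 2 * l 3)" using pos by simp
qed

lemma cubic_minima_bounds:
  assumes "small_split C 3 s b"
  defines "l \<equiv> succ_min 3 C" and "D \<equiv> real_of_int \<bar>ring_disc 3 C\<bar>"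
  shows "1/4 \<le> l 1" "l 1 \<le> l 2" "l 1 * l 2 \<le> 64 * sqrt D" "sqrt D \<le> 64 * (l 1 * l 2)"
proof -
  interpret small_split C 3 s b by fact
  show l1: "1/4 \<le> l 1" unfolding l_def by (rule succ_min_lower) simp
  show "l 1 \<le> l 2" unfolding l_def by (rule succ_min_mono; simp)
  then have pos: "0 \<le> l 1 * l 2" using l1 by simp
  have l0: "1/4 \<le> l 0" "l 0 \<le> 1" unfolding l_def by (rule succ_min_lower succ_min_0_le; simp)+
  have "1/4 * (l 1 * l 2) \<le> l 0 * (l 1 * l 2)" using l0 pos by (intro mult_right_mono)
  also have "\<dots> \<le> 16 * sqrt D" using prod_succ_min_le by (simp add: l_def D_def prod_3 mult.assoc)
  finally show "l 1 * l 2 \<le> 64 * sqrt D" by simp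
  have "sqrt D \<le> 16 * (l 0 * (l 1 * l 2))"
    using disc_le_prod_succ_min by (simp add: l_def D_def prod_3 mult.assoc)
  also have "l 0 * (l 1 * l 2) \<le> 1 * (l 1 * l 2)" using l0 pos by (intro mult_right_mono)
  finally show "sqrt D \<le> 64 * (l 1 * l 2)" using pos by simp
qed

context
  fixes R :: "('a, 'b) ring_scheme" and C :: "('c, 'd) ring_scheme"
  assumes R: "nondegenerate 4 R" and G: "G_ring 4 D4 R" and C: "cubic_resolvent R C"
begin

lemma minima_point_in_region:
  fixes \<delta> :: real
  assumes "0 < \<delta>" and D: "exp (ln 64 / \<delta>) < real_of_int \<bar>ring_disc 4 R\<bar>"
  shows "minima_point R C \<in> exponent_region \<delta>"
proof -
  obtain s b sC bC where s: "small_split R 4 s b" "small_split C 3 sC bC"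
    "ring_disc 3 C = ring_disc 4 R"
    "succ_min 3 C 1 \<le> 16 * (succ_min 4 R 1)\<^sup>2" "succ_min 3 C 2 \<le> 16 * (succ_min 4 R 2)\<^sup>2"
    using R G C by (rule D4_pair_bounds)
  define l where "l = succ_min 4 R"
  define m where "m = succ_min 3 C"
  define D' where "D' = real_of_int \<bar>ring_disc 4 R\<bar>"
  define L where "L = ln D'"
  note b4 = quartic_minima_bounds[OF s(1), folded l_def D'_def]
  note b3 = cubic_minima_bounds[OF s(2), unfolded s(3), folded m_def D'_def]
  note s45 = s(4,5)[folded l_def m_def]
  have D0: "0 < D'" using b4(1) by simp
  have "ln (exp (ln 64 / \<delta>)) < L"
    unfolding L_def using D D0 by (subst ln_less_cancel_iff) (auto simp: D'_def)
  then have L: "ln 64 / \<delta> < L" by simp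
  have L0: "0 < L" using L assms(1) by (smt (verit) divide_pos_pos ln_gt_zero)
  \<comment> \<open>The threshold for the discriminant is chosen so that a factor 64 moves an
    exponent by at most \<delta>.\<close>
  have \<delta>: "ln 64 \<le> \<delta> * L" using L assms(1) by (simp add: field_simps)
  have lp: "0 < l 1" "0 < l 2" "0 < l 3" "0 < m 1" "0 < m 2" using b4 b3 by auto
  have ln4: "ln (1/4) \<ge> - ln (64 :: real)" by (simp add: ln_div)
  have ln16: "ln 16 \<le> ln (64 :: real)" by simp
  have sq: "ln (sqrt D') = L / 2" using D0 by (simp add: L_def ln_sqrt)
  have x1: "- (\<delta> * L) \<le> ln (l 1)"
  proof -
    have "ln (1/4) \<le> ln (l 1)" using b4(2) lp by (subst ln_le_cancel_iff) auto
    then show ?thesis using ln4 \<delta> by linarith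
  qed
  have x2: "ln (l 1) \<le> ln (l 2)" "ln (l 2) \<le> ln (l 3)" using b4(3,4) lp by simp_all
  have x3: "ln (l 1) + ln (l 2) + ln (l 3) \<le> L / 2 + \<delta> * L"
  proof -
    have "ln (l 1 * l 2 * l 3) \<le> ln (64 * sqrt D')" using b4(5) lp D0 by (intro ln_mono) auto
    then show ?thesis using lp D0 \<delta> by (simp add: ln_mult sq)
  qed
  have x4: "L / 2 - \<delta> * L \<le> ln (l 1) + ln (l 2) + ln (l 3)"
  proof -
    have "ln (sqrt D') \<le> ln (64 * (l 1 * l 2 * l 3))" using b4(6) lp D0 by (intro ln_mono) auto
    then show ?thesis using lp D0 \<delta> by (simp add: ln_mult sq)
  qed
  have y1: "- (\<delta> * L) \<le> ln (m 1)"
  proof -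
    have "ln (1/4) \<le> ln (m 1)" using b3(1) lp by (subst ln_le_cancel_iff) auto
    then show ?thesis using ln4 \<delta> by linarith
  qed
  have y2: "ln (m 1) \<le> ln (m 2)" using b3(2) lp by simp
  have y3: "ln (m 1) + ln (m 2) \<le> L / 2 + \<delta> * L"
  proof -
    have "ln (m 1 * m 2) \<le> ln (64 * sqrt D')" using b3(3) lp D0 by (intro ln_mono) auto
    then show ?thesis using lp D0 \<delta> by (simp add: ln_mult sq)
  qed
  have y4: "L / 2 - \<delta> * L \<le> ln (m 1) + ln (m 2)"
  proof -
    have "ln (sqrt D') \<le> ln (64 * (m 1 * m 2))" using b3(4) lp D0 by (intro ln_mono) auto
    then show ?thesis using lp D0 \<delta> by (simp add: ln_mult sq)
  qed
  have z: "ln (m i) \<le> 2 * ln (l i) + \<delta> * L" if "m i \<le> 16 * (l i)\<^sup>2" "0 < m i" "0 < l i" for i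
  proof -
    have "ln (m i) \<le> ln (16 * (l i)\<^sup>2)" using that by (intro ln_mono) auto
    also have "\<dots> = ln 16 + 2 * ln (l i)" using that by (simp add: ln_mult ln_realpow)
    finally show ?thesis using ln16 \<delta> by linarith
  qed
  have z12: "ln (m 1) \<le> 2 * ln (l 1) + \<delta> * L" "ln (m 2) \<le> 2 * ln (l 2) + \<delta> * L"
    using z s45 lp by auto
  have mp: "minima_point R C = (ln (l 1) / L, ln (l 2) / L, ln (l 3) / L, ln (m 1) / L, ln (m 2) / L)"
    by (simp add: minima_point_def Let_def log_def l_def m_def L_def D'_def)
  show ?thesis
    unfolding mp exponent_region_def using L0 x1 x2 x3 x4 y1 y2 y3 y4 z12
    by (simp add: field_simps)
qed

text \<open>The product bound controls the largest minimum because the others are at least 1/4: in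
  rank four 1024 = 64 * 16. All minima then lie in finite sets of lengths.\<close>

lemma minima_point_in_finite:
  assumes "real_of_int \<bar>ring_disc 4 R\<bar> \<le> B"
  shows "minima_point R C \<in> (\<lambda>(d, l1, l2, l3, m1, m2).
      (log (real_of_int d) l1, log (real_of_int d) l2, log (real_of_int d) l3, log (real_of_int d) m1, log (real_of_int d) m2)) `
    ({1..\<lfloor>B\<rfloor>} \<times> lengths_upto 4 (1024 * sqrt B) \<times> lengths_upto 4 (1024 * sqrt B) \<times>
      lengths_upto 4 (1024 * sqrt B) \<times> lengths_upto 3 (1024 * sqrt B) \<times>
      lengths_upto 3 (1024 * sqrt B))"
proof -
  obtain s b sC bC where s: "small_split R 4 s b" "small_split C 3 sC bC"
    "ring_disc 3 C = ring_disc 4 R" using R G C by (rule D4_pair_bounds)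
  interpret r: small_split R 4 s b by fact
  interpret c: small_split C 3 sC bC by fact
  define l where "l = succ_min 4 R"
  define m where "m = succ_min 3 C"
  define D where "D = real_of_int \<bar>ring_disc 4 R\<bar>"
  note b4 = quartic_minima_bounds[OF s(1), folded l_def D_def]
  note b3 = cubic_minima_bounds[OF s(2), unfolded s(3), folded m_def D_def]
  have DB: "sqrt D \<le> sqrt B" using assms by (simp add: D_def)
  have l12: "1/16 \<le> l 1 * l 2" using mult_mono[of "1/4" "l 1" "1/4" "l 2"] b4 by simp
  have "1/16 * l 3 \<le> l 1 * l 2 * l 3" using l12 b4 by (intro mult_right_mono) auto
  then have l3: "l 3 \<le> 1024 * sqrt B" using b4(5) DB by linarith
  have "1/4 * m 2 \<le> m 1 * m 2" using b3 by (intro mult_right_mono) auto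
  moreover have "0 \<le> sqrt B" using DB real_sqrt_ge_one[OF b4(1)] by linarith
  ultimately have m2: "m 2 \<le> 1024 * sqrt B" using b3(3) DB by linarith
  have "l i \<in> lengths_upto 4 (1024 * sqrt B)" if "i \<in> {1, 2, 3}" for i
    unfolding l_def using that l3 b4 by (intro r.succ_min_in_lengths_upto) (auto simp: l_def)
  moreover have "m i \<in> lengths_upto 3 (1024 * sqrt B)" if "i \<in> {1, 2}" for i
    unfolding m_def using that m2 b3 by (intro c.succ_min_in_lengths_upto) (auto simp: m_def)
  moreover have "\<bar>ring_disc 4 R\<bar> \<in> {1..\<lfloor>B\<rfloor>}"
    using assms b4(1) by (simp add: D_def le_floor_iff)
  moreover have "minima_point R C = (log D (l 1), log D (l 2), log D (l 3), log D (m 1), log D (m 2))"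
    by (simp add: minima_point_def Let_def l_def m_def D_def)
  ultimately show ?thesis
    by (intro image_eqI[where x = "(\<bar>ring_disc 4 R\<bar>, l 1, l 2, l 3, m 1, m 2)"]) (auto simp: D_def)
qed

end

lemma P4_D4_subset: "P4 D4 \<subseteq> exponent_region 0"
proof
  fix p assume p: "p \<in> P4 D4"
  let ?S = "{minima_point R C | (R :: nat ring) (C :: nat ring).
     nondegenerate 4 R \<and> G_ring 4 D4 R \<and> cubic_resolvent R C}"
  have lim: "p islimpt ?S" using p by (simp add: P4_def)
  show "p \<in> exponent_region 0"
  proof (rule exponent_region_limit)
    fix \<delta> :: real assume \<delta>: "\<delta> > 0"
    define B where "B = exp (ln 64 / \<delta>)"
    define F where "F = (\<lambda>(d, l1, l2, l3, m1, m2).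
      (log (real_of_int d) l1, log (real_of_int d) l2, log (real_of_int d) l3, log (real_of_int d) m1, log (real_of_int d) m2)) `
    ({1..\<lfloor>B\<rfloor>} \<times> lengths_upto 4 (1024 * sqrt B) \<times> lengths_upto 4 (1024 * sqrt B) \<times>
      lengths_upto 4 (1024 * sqrt B) \<times> lengths_upto 3 (1024 * sqrt B) \<times>
      lengths_upto 3 (1024 * sqrt B))"
    have F: "finite F" unfolding F_def by (intro finite_imageI finite_cartesian_product finite_lengths_upto) simp
    have "?S \<subseteq> F \<union> exponent_region \<delta>"
    proof
      fix q assume "q \<in> ?S"
      then obtain R C :: "nat ring" where RC: "nondegenerate 4 R" "G_ring 4 D4 R" "cubic_resolvent R C"
        and q: "q = minima_point R C" by blast
      show "q \<in> F \<union> exponent_region \<delta>"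
      proof (cases "real_of_int \<bar>ring_disc 4 R\<bar> \<le> B")
        case True
        then show ?thesis using minima_point_in_finite[OF RC True] q by (simp only: F_def) simp
      next
        case False
        then show ?thesis using minima_point_in_region[OF RC \<delta>] q by (simp add: B_def)
      qed
    qed
    then have "p islimpt F \<union> exponent_region \<delta>" using lim islimpt_subset by blast
    then have "p islimpt exponent_region \<delta>" using F by (simp add: islimpt_Un islimpt_finite)
    then show "p \<in> exponent_region \<delta>" using closed_exponent_region closed_limpt by blast
  qed
qed


section \<open>Rings on subsets of the natural numbers\<close>

text \<open>\<open>P4\<close> ranges over rings on sets of natural numbers. All computation takes
  place in the countable type of integer tuples and is transported by \<open>to_nat\<close>.\<close>

definition nat_ring :: "('v::{countable, ab_group_add} \<Rightarrow> 'v \<Rightarrow> 'v) \<Rightarrow> 'v \<Rightarrow> nat ring" where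
  "nat_ring mul e = \<lparr>carrier = range (to_nat :: 'v \<Rightarrow> nat),
     mult = (\<lambda>x y. to_nat (mul (from_nat x) (from_nat y))), one = to_nat e,
     zero = to_nat (0 :: 'v), add = (\<lambda>x y. to_nat (from_nat x + from_nat y :: 'v))\<rparr>"

lemma cring_nat_ring:
  fixes mul :: "'v::{countable, ab_group_add} \<Rightarrow> 'v \<Rightarrow> 'v"
  assumes "\<And>x y z. mul (mul x y) z = mul x (mul y z)" "\<And>x y. mul x y = mul y x"
    "\<And>x y z. mul (x + y) z = mul x z + mul y z" "\<And>x. mul e x = x"
  shows "cring (nat_ring mul e)"
proof (rule cringI)
  show "abelian_group (nat_ring mul e)"
  proof (rule abelian_groupI)
    fix x assume "x \<in> carrier (nat_ring mul e)"
    then obtain v :: 'v where v: "x = to_nat v" by (auto simp: nat_ring_def)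
    show "\<exists>y\<in>carrier (nat_ring mul e). y \<oplus>\<^bsub>nat_ring mul e\<^esub> x = \<zero>\<^bsub>nat_ring mul e\<^esub>"
      by (rule bexI[of _ "to_nat (- v)"]) (simp_all add: nat_ring_def v)
  qed (auto simp: nat_ring_def ac_simps)
  show "comm_monoid (nat_ring mul e)"
    by (rule comm_monoidI) (auto simp: nat_ring_def assms(1,4), simp add: assms(2))
qed (auto simp: nat_ring_def assms(3))

lemma (in ring) additive_int_comb:
  fixes f :: "'a \<Rightarrow> int"
  assumes add: "\<And>x y. \<lbrakk>x \<in> carrier R; y \<in> carrier R\<rbrakk> \<Longrightarrow> f (x \<oplus> y) = f x + f y"
    and v: "v \<in> {..<k} \<rightarrow> carrier R"
  shows "f (int_comb R k v c) = (\<Sum>j<k. c j * f (v j))"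
proof -
  have zero: "f \<zero> = 0" using add[of \<zero> \<zero>] by simp
  have um: "f (\<ominus> x) = - f x" if "x \<in> carrier R" for x
    using add[of x "\<ominus> x"] that zero by (simp add: r_neg)
  have nat: "f ([(k::nat)] \<cdot> x) = int k * f x" if "x \<in> carrier R" for x k
    using that by (induction k) (simp_all add: zero add algebra_simps)
  have int: "f ([(m::int)] \<cdot> x) = m * f x" if "x \<in> carrier R" for x m
    using that by (cases "m \<ge> 0") (simp_all add: add_pow_int_ge add_pow_int_lt nat um)
  show ?thesis
    using v
  proof (induction k)
    case (Suc k)
    then have vk: "v \<in> {..<k} \<rightarrow> carrier R" "v k \<in> carrier R" by auto
    show ?case unfolding int_comb_Suc[OF Suc.prems]
      using Suc.IH[OF vk(1)] vk int_comb_closed[OF vk(1)] by (simp add: add int)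
  qed (simp add: zero)
qed

lemma less_4: "p < (4::nat) \<longleftrightarrow> p = 0 \<or> p = 1 \<or> p = 2 \<or> p = 3" by auto

section \<open>Integer coordinates in ranks three and four\<close>

type_synonym int3 = "int \<times> int \<times> int"
type_synonym int4 = "int \<times> int \<times> int \<times> int"

definition coord3 :: "nat \<Rightarrow> int3 \<Rightarrow> int" where
  "coord3 j v = (case v of (x, y, z) \<Rightarrow> if j = 0 then x else if j = 1 then y else z)"

definition coord4 :: "nat \<Rightarrow> int4 \<Rightarrow> int" where
  "coord4 j v = (case v of (x, y, z, w) \<Rightarrow> if j = 0 then x else if j = 1 then y else if j = 2 then z else w)"

lemma coord_add: "coord3 j (v + w) = coord3 j v + coord3 j w" "coord4 j (v' + w') = coord4 j v' + coord4 j w'"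
  by (auto simp: coord3_def coord4_def plus_prod_def split: prod.splits)

lemma coord_eqI:
  "(\<And>j. j < 3 \<Longrightarrow> coord3 j v = coord3 j w) \<Longrightarrow> v = w"
  "(\<And>j. j < 4 \<Longrightarrow> coord4 j v' = coord4 j w') \<Longrightarrow> v' = w'"
proof -
  assume *: "\<And>j. j < 3 \<Longrightarrow> coord3 j v = coord3 j w"
  show "v = w" using *[of 0] *[of 1] *[of 2] by (auto simp: coord3_def split: prod.splits)
next
  assume *: "\<And>j. j < 4 \<Longrightarrow> coord4 j v' = coord4 j w'"
  show "v' = w'" using *[of 0] *[of 1] *[of 2] *[of 3] by (auto simp: coord4_def split: prod.splits)
qed

text \<open>The coordinate functions f are additive, so they read off the coefficients of an integer
  combination; together they separate points, which gives both independence and generation.\<close>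

lemma nat_ring_basis:
  fixes mul :: "'v::{countable, ab_group_add} \<Rightarrow> 'v \<Rightarrow> 'v" and f :: "nat \<Rightarrow> 'v \<Rightarrow> int"
  assumes ring: "cring (nat_ring mul e)"
    and add: "\<And>j v w. f j (v + w) = f j v + f j w"
    and eqI: "\<And>v w. (\<And>j. j < n \<Longrightarrow> f j v = f j w) \<Longrightarrow> v = w"
    and dual: "\<And>i j. i < n \<Longrightarrow> j < n \<Longrightarrow> f i (d j) = (if i = j then 1 else 0)"
  shows "int_basis (nat_ring mul e) n (\<lambda>j. to_nat (d j))"
proof -
  interpret cring "nat_ring mul e" by (rule ring)
  have cl: "(\<lambda>j. to_nat (d j)) \<in> {..<n} \<rightarrow> carrier (nat_ring mul e)" by (auto simp: nat_ring_def)
  have comb: "f i (from_nat (int_comb (nat_ring mul e) n (\<lambda>j. to_nat (d j)) m)) = m i" if "i < n" for i m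
  proof -
    have "f i (from_nat (int_comb (nat_ring mul e) n (\<lambda>j. to_nat (d j)) m)) =
        (\<Sum>j<n. m j * f i (from_nat (to_nat (d j))))"
      by (rule additive_int_comb[OF _ cl]) (auto simp: nat_ring_def add)
    also have "\<dots> = (\<Sum>j<n. if j = i then m i else 0)"
      using that by (intro sum.cong) (auto simp: dual)
    finally show ?thesis using that by simp
  qed
  have f0: "f j 0 = 0" for j using add[of j 0 0] by simp
  show ?thesis
    unfolding int_basis_def int_indep_def
  proof (intro conjI allI impI ballI cl)
    fix m j assume "int_comb (nat_ring mul e) n (\<lambda>j. to_nat (d j)) m = \<zero>\<^bsub>nat_ring mul e\<^esub>" "j < n"
    then show "m j = 0" using comb[of j m] by (simp add: nat_ring_def f0)
  next
    fix x assume "x \<in> carrier (nat_ring mul e)"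
    then obtain v :: 'v where v: "x = to_nat v" by (auto simp: nat_ring_def)
    let ?y = "int_comb (nat_ring mul e) n (\<lambda>j. to_nat (d j)) (\<lambda>j. f j v)"
    obtain w :: 'v where w: "?y = to_nat w"
      using int_comb_closed[OF cl, of "\<lambda>j. f j v"] by (auto simp: nat_ring_def)
    have "v = w" using comb[of _ "\<lambda>j. f j v"] by (intro eqI) (simp add: w)
    then show "\<exists>m. x = int_comb (nat_ring mul e) n (\<lambda>j. to_nat (d j)) m" using v w by metis
  qed
qed

section \<open>A family of orders and their cubic resolvents\<close>

lemma det_fun_expand:
  fixes f :: "nat \<Rightarrow> nat \<Rightarrow> 'a::idom"
  assumes "\<And>j. 0 < j \<Longrightarrow> j < Suc m \<Longrightarrow> f j 0 = 0"
  shows "Determinant.det (Matrix.mat (Suc m) (Suc m) (\<lambda>(i, j). f i j)) =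
    f 0 0 * Determinant.det (Matrix.mat m m (\<lambda>(i, j). f (Suc i) (Suc j)))"
proof -
  let ?A1 = "Matrix.mat 1 1 (\<lambda>(i, j). f i j)" and ?A2 = "Matrix.mat 1 m (\<lambda>(i, j). f i (Suc j))"
  let ?A4 = "Matrix.mat m m (\<lambda>(i, j). f (Suc i) (Suc j))"
  have "Matrix.mat (Suc m) (Suc m) (\<lambda>(i, j). f i j) = four_block_mat ?A1 ?A2 (0\<^sub>m m 1) ?A4"
    using assms by (intro eq_matI) auto
  then have "Determinant.det (Matrix.mat (Suc m) (Suc m) (\<lambda>(i, j). f i j)) =
      Determinant.det ?A1 * Determinant.det ?A4"
    using det_four_block_mat_lower_left_zero[of ?A1 1 ?A2 m "0\<^sub>m m 1" ?A4] by simp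
  then show ?thesis by (simp add: det_single)
qed

lemma det_fun_2:
  fixes f :: "nat \<Rightarrow> nat \<Rightarrow> 'a::comm_ring_1"
  shows "Determinant.det (Matrix.mat 2 2 (\<lambda>(i, j). f i j)) = f 0 0 * f 1 1 - f 0 1 * f 1 0"
proof -
  let ?A = "Matrix.mat 2 2 (\<lambda>(i, j). f i j)"
  have "Determinant.det ?A = (\<Sum>i<2. ?A $$ (i, 0) * cofactor ?A i 0)"
    by (rule laplace_expansion_column) auto
  also have "\<dots> = f 0 0 * cofactor ?A 0 0 + f 1 0 * cofactor ?A 1 0"
    by (simp add: eval_nat_numeral)
  finally have "Determinant.det ?A = f 0 0 * cofactor ?A 0 0 + f 1 0 * cofactor ?A 1 0" .
  moreover have "cofactor ?A 0 0 = f 1 1" "cofactor ?A 1 0 = - f 0 1"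
    by (simp_all add: cofactor_def mat_delete_def det_single)
  ultimately show ?thesis by (simp add: mult.commute)
qed

lemma (in split_ring) ring_disc_gram:
  "of_int (ring_disc n R) = Determinant.det (Matrix.mat n n (\<lambda>(i, j). \<Sum>k<n. s k (b i) * s k (b j)))"
  by (subst det_fun_mult[of n "\<lambda>i k. s k (b i)" "\<lambda>k j. s k (b j)"],
      subst det_fun_transpose[of n "\<lambda>k j. s k (b j)"])
    (simp add: emb_det_def ring_disc_eq power2_eq_square)

text \<open>\<open>R\<close> and \<open>C\<close> below correspond under Bhargava's parametrisation to the pair of ternary quadratic
  forms \<open>a x1\<^sup>2 - n x2 x3\<close> and \<open>b x2\<^sup>2 - c x3\<^sup>2\<close>. The sizes of \<open>a\<close>, \<open>b\<close>, \<open>c\<close> and \<open>n\<close> can be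
  prescribed independently, \<open>R\<close> has a basis that is orthogonal under all embeddings, and \<open>b * c\<close>
  being twice a square makes \<open>R \<otimes> \<rat>\<close> a pure quartic field.\<close>

locale dihedral_family =
  fixes a b c n k :: int
  assumes pos: "0 < a" "0 < b" "0 < c" "0 < n" "0 < k" and bc: "b * c = 2 * k\<^sup>2"
begin

definition mulR :: "int4 \<Rightarrow> int4 \<Rightarrow> int4" where
  "mulR v w = (case v of (x0, x1, x2, x3) \<Rightarrow> case w of (y0, y1, y2, y3) \<Rightarrow>
    (x0 * y0 + a\<^sup>2 * b * c * (x1 * y1) + n * a * b * c * (x2 * y3 + x3 * y2),
     x0 * y1 + x1 * y0 + n * b * (x2 * y2) + n * c * (x3 * y3),
     x0 * y2 + x2 * y0 + a * c * (x1 * y3 + x3 * y1),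
     x0 * y3 + x3 * y0 + a * b * (x1 * y2 + x2 * y1)))"

text \<open>Coordinates are along \<omega>, 1, \<theta> with \<omega> \<theta> = 0, \<theta>^2 = - 4
  a b c \<theta> and \<omega>^2 = - 4 a^2 n^2 b c - a n^2 \<theta>. Over the rationals this is the
  product of the rationals, where \<theta> = - 4 a b c, and the field generated by a square root of
  -2, where \<theta> = 0.\<close>

definition mulC :: "int3 \<Rightarrow> int3 \<Rightarrow> int3" where
  "mulC v w = (case v of (z, x, y) \<Rightarrow> case w of (z', x', y') \<Rightarrow>
    (x * z' + z * x',
     x * x' - 4 * a\<^sup>2 * n\<^sup>2 * b * c * (z * z'),
     x * y' + y * x' - 4 * a * b * c * (y * y') - a * n\<^sup>2 * (z * z')))"

definition R :: "nat ring" where "R = nat_ring mulR (1, 0, 0, 0)"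
definition C :: "nat ring" where "C = nat_ring mulC (0, 1, 0)"

lemma cring_R: "cring R"
  unfolding R_def
  by (rule cring_nat_ring)
    (auto simp: mulR_def plus_prod_def power2_eq_square algebra_simps split: prod.splits)

lemma cring_C: "cring C"
  unfolding C_def
  by (rule cring_nat_ring)
    (auto simp: mulC_def plus_prod_def power2_eq_square algebra_simps split: prod.splits)

text \<open>The basis of \<open>C\<close> is ordered \<open>\<omega>, 1, \<theta>\<close>, which makes the Gram matrix block triangular.\<close>

definition bR :: "nat \<Rightarrow> nat" where
  "bR j = to_nat ((if j = 0 then 1 else 0, if j = 1 then 1 else 0,
     if j = 2 then 1 else 0, if j = 3 then 1 else 0) :: int4)"

definition bC :: "nat \<Rightarrow> nat" where
  "bC j = to_nat ((if j = 0 then 1 else 0, if j = 1 then 1 else 0, if j = 2 then 1 else 0) :: int3)"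

lemma basis_R: "int_basis R 4 bR"
  unfolding R_def bR_def
proof (rule nat_ring_basis[where f = coord4])
  show "cring (nat_ring mulR (1, 0, 0, 0))" using cring_R by (simp only: R_def)
  fix i j :: nat assume "i < 4" "j < 4"
  then show "coord4 i (if j = 0 then 1 else 0, if j = 1 then 1 else 0, if j = 2 then 1 else 0,
      if j = 3 then 1 else 0) = (if i = j then 1 else 0)"
    unfolding less_4 by (elim disjE) (simp_all add: coord4_def)
qed (rule coord_add coord_eqI, assumption?)+

lemma basis_C: "int_basis C 3 bC"
  unfolding C_def bC_def
proof (rule nat_ring_basis[where f = coord3])
  show "cring (nat_ring mulC (0, 1, 0))" using cring_C by (simp only: C_def)
  fix i j :: nat assume "i < 3" "j < 3"
  then show "coord3 i (if j = 0 then 1 else 0, if j = 1 then 1 else 0, if j = 2 then 1 else 0) =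
      (if i = j then 1 else 0)"
    unfolding less_3 by (elim disjE) (simp_all add: coord3_def)
qed (rule coord_add coord_eqI, assumption?)+

text \<open>The positive root of b c, irrational because b c is twice a square. The numbers a s, u
  and v are the images of \<alpha>1, \<alpha>2 and \<alpha>3 under the embedding
  \<open>sR 0\<close>.\<close>

definition s :: real where "s = k * sqrt 2"
definition u :: real where "u = sqrt (n * a * b * s)"
definition v :: real where "v = sqrt (n * a * c * s)"

lemma s_pos: "0 < s" using pos by (simp add: s_def)
lemma u_pos: "0 < u" using pos s_pos by (simp add: u_def)
lemma v_pos: "0 < v" using pos s_pos by (simp add: v_def)

lemma s_sq: "s * s = b * c"
proof -
  have "real_of_int (b * c) = 2 * (real_of_int k)\<^sup>2" by (simp add: bc)
  then show ?thesis by (simp add: s_def power2_eq_square algebra_simps)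
qed

lemma u_sq: "u * u = n * a * b * s" and v_sq: "v * v = n * a * c * s"
  using pos s_pos by (simp_all add: u_def v_def)

lemma uv: "u * v = n * a * b * c"
proof -
  have "u * v = sqrt ((n * a * s)\<^sup>2 * (b * c))"
    by (simp add: u_def v_def real_sqrt_mult[symmetric] power2_eq_square algebra_simps)
  also have "\<dots> = n * a * s * sqrt (s * s)" using pos s_pos by (simp add: real_sqrt_mult s_sq)
  also have "\<dots> = n * a * (s * s)" using s_pos by simp
  finally show ?thesis by (simp add: s_sq)
qed

lemma su: "s * u = b * v" and sv: "s * v = c * u"
proof -
  have "v * (s * u) = v * (b * v)"
    using uv v_sq s_sq by (simp add: algebra_simps)
  then show "s * u = b * v" using v_pos by simp
  have "u * (s * v) = u * (c * u)"
    using uv u_sq s_sq by (simp add: algebra_simps)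
  then show "s * v = c * u" using u_pos by simp
qed

text \<open>Embedding i multiplies u by the i-th power of \<i>. The square of u then forces the sign
  of a s, and the rationality of u v forces the inverse power on v. The formula has period four in
  i.\<close>

definition sR :: "nat \<Rightarrow> nat \<Rightarrow> complex" where
  "sR i = (\<lambda>x\<in>carrier R. case from_nat x :: int4 of (x0, x1, x2, x3) \<Rightarrow>
     of_int x0 + of_int x1 * ((-1) ^ i * (a * s)) + of_int x2 * (\<i> ^ i * u) + of_int x3 * ((- \<i>) ^ i * v))"

definition sC :: "nat \<Rightarrow> nat \<Rightarrow> complex" where
  "sC p = (\<lambda>x\<in>carrier C. case from_nat x :: int3 of (z, x, y) \<Rightarrow>
     of_int x + of_int y * (if p = 0 then - 4 * a * b * c else 0) +
     of_int z * (if p = 0 then 0 else if p = 1 then 2 * \<i> * n * a * s else - 2 * \<i> * n * a * s))"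

lemma carrier_R: "carrier R = range (to_nat :: int4 \<Rightarrow> nat)"
  by (simp add: R_def nat_ring_def)

lemma carrier_C: "carrier C = range (to_nat :: int3 \<Rightarrow> nat)"
  by (simp add: C_def nat_ring_def)

lemma sR_apply: "sR i (to_nat ((x0, x1, x2, x3) :: int4)) =
    of_int x0 + of_int x1 * ((-1) ^ i * (a * s)) + of_int x2 * (\<i> ^ i * u) + of_int x3 * ((- \<i>) ^ i * v)"
  by (simp add: sR_def carrier_R)

lemma sC_apply: "sC p (to_nat ((z, x, y) :: int3)) =
    of_int x + of_int y * (if p = 0 then - 4 * a * b * c else 0) +
     of_int z * (if p = 0 then 0 else if p = 1 then 2 * \<i> * n * a * s else - 2 * \<i> * n * a * s)"
  by (simp add: sC_def carrier_C)

lemma sR_bR: "sR i (bR 0) = 1" "sR i (bR 1) = (-1) ^ i * (a * s)" "sR i (bR 2) = \<i> ^ i * u"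
    "sR i (bR 3) = (- \<i>) ^ i * v"
  by (simp_all add: bR_def sR_apply)

lemma sR_hom: "sR i \<in> complex_homs R"
proof -
  define A1 A2 A3 where A: "A1 = (-1) ^ i * complex_of_real (a * s)"
    "A2 = \<i> ^ i * complex_of_real u" "A3 = (- \<i>) ^ i * complex_of_real v"
  have i1: "(-1) ^ i * (-1) ^ i = (1::complex)" by (simp flip: power_mult_distrib)
  have i2: "\<i> ^ i * \<i> ^ i = (-1) ^ i" "(- \<i>) ^ i * (- \<i>) ^ i = (-1) ^ i" by (simp_all flip: power_mult_distrib)
  have i3: "\<i> ^ i * (- \<i>) ^ i = 1" by (simp flip: power_mult_distrib)
  have i4: "(-1) ^ i * \<i> ^ i = (- \<i>) ^ i" "(-1) ^ i * (- \<i>) ^ i = \<i> ^ i" by (simp_all flip: power_mult_distrib)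
  have rel: "A1 * A1 = a\<^sup>2 * b * c" "A1 * A2 = a * b * A3" "A1 * A3 = a * c * A2"
    "A2 * A2 = n * b * A1" "A3 * A3 = n * c * A1" "A2 * A3 = n * a * b * c"
  proof -
    have "A1 * A1 = ((-1) ^ i * (-1) ^ i) * complex_of_real (a\<^sup>2 * (s * s))"
      by (simp add: A power2_eq_square)
    then show "A1 * A1 = a\<^sup>2 * b * c" unfolding i1 s_sq by simp
    have "A1 * A2 = ((-1) ^ i * \<i> ^ i) * complex_of_real (a * (s * u))" by (simp add: A mult_ac)
    then show "A1 * A2 = a * b * A3" unfolding i4 su by (simp add: A mult_ac)
    have "A1 * A3 = ((-1) ^ i * (- \<i>) ^ i) * complex_of_real (a * (s * v))" by (simp add: A mult_ac)
    then show "A1 * A3 = a * c * A2" unfolding i4 sv by (simp add: A mult_ac)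
    have "A2 * A2 = (\<i> ^ i * \<i> ^ i) * complex_of_real (u * u)" by (simp add: A mult_ac)
    then show "A2 * A2 = n * b * A1" unfolding i2 u_sq by (simp add: A mult_ac)
    have "A3 * A3 = ((- \<i>) ^ i * (- \<i>) ^ i) * complex_of_real (v * v)" by (simp add: A mult_ac)
    then show "A3 * A3 = n * c * A1" unfolding i2 v_sq by (simp add: A mult_ac)
    have "A2 * A3 = (\<i> ^ i * (- \<i>) ^ i) * complex_of_real (u * v)" by (simp add: A mult_ac)
    then show "A2 * A3 = n * a * b * c" unfolding i3 uv by simp
  qed
  have ap: "sR i (to_nat ((x0, x1, x2, x3) :: int4)) = of_int x0 + of_int x1 * A1 + of_int x2 * A2 + of_int x3 * A3"
    for x0 x1 x2 x3 by (simp add: sR_apply A)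
  have expand: "(x0 + x1 * A1 + x2 * A2 + x3 * A3) * (y0 + y1 * A1 + y2 * A2 + y3 * A3) =
      x0 * y0 + (x0 * y1 + x1 * y0) * A1 + (x0 * y2 + x2 * y0) * A2 + (x0 * y3 + x3 * y0) * A3
      + x1 * y1 * (A1 * A1) + (x1 * y2 + x2 * y1) * (A1 * A2) + (x1 * y3 + x3 * y1) * (A1 * A3)
      + x2 * y2 * (A2 * A2) + x3 * y3 * (A3 * A3) + (x2 * y3 + x3 * y2) * (A2 * A3)"
    for x0 x1 x2 x3 y0 y1 y2 y3 :: complex by (simp add: algebra_simps)
  have "sR i \<in> Ring.ring_hom R complex_ring"
  proof (rule ring_hom_memI)
    fix x y assume "x \<in> carrier R" "y \<in> carrier R"
    then obtain x0 x1 x2 x3 y0 y1 y2 y3 where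
      xy: "x = to_nat ((x0, x1, x2, x3) :: int4)" "y = to_nat ((y0, y1, y2, y3) :: int4)"
      unfolding carrier_R by (metis imageE prod_cases4)
    show "sR i (x \<otimes>\<^bsub>R\<^esub> y) = sR i x \<otimes>\<^bsub>complex_ring\<^esub> sR i y"
      by (simp add: xy R_def nat_ring_def mulR_def, simp add: R_def[symmetric] nat_ring_def[symmetric] ap expand rel)
        (simp add: algebra_simps)
    show "sR i (x \<oplus>\<^bsub>R\<^esub> y) = sR i x \<oplus>\<^bsub>complex_ring\<^esub> sR i y"
      by (simp add: xy R_def nat_ring_def plus_prod_def, simp add: R_def[symmetric] nat_ring_def[symmetric] ap)
        (simp add: algebra_simps)
  next
    have "\<one>\<^bsub>R\<^esub> = to_nat ((1, 0, 0, 0) :: int4)" by (simp add: R_def nat_ring_def)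
    then show "sR i \<one>\<^bsub>R\<^esub> = \<one>\<^bsub>complex_ring\<^esub>" by (simp add: ap)
  qed simp
  then show ?thesis by (simp add: complex_homs_def sR_def)
qed

lemma sC_hom: "sC p \<in> complex_homs C"
proof -
  define T W where "T = (if p = 0 then - 4 * a * b * c else 0 :: complex)"
    and "W = (if p = 0 then 0 else if p = 1 then 2 * \<i> * n * a * s else - 2 * \<i> * n * a * s)"
  have ss: "complex_of_real s * complex_of_real s = of_int b * of_int c"
  proof -
    have "complex_of_real s * complex_of_real s = complex_of_real (s * s)" by simp
    also have "\<dots> = of_int b * of_int c" unfolding s_sq by simp
    finally show ?thesis .
  qed
  have ss': "complex_of_real s * (complex_of_real s * z) = of_int b * of_int c * z" for z
    using ss by (metis mult.assoc)
  have TW: "T * W = 0" "T * T = - 4 * a * b * c * T"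
    by (simp_all add: T_def W_def)
  have WW: "W * W = - 4 * a\<^sup>2 * n\<^sup>2 * b * c - a * n\<^sup>2 * T"
    by (simp add: T_def W_def power2_eq_square algebra_simps ss')
  have ap: "sC p (to_nat ((z, x, y) :: int3)) = of_int x + of_int y * T + of_int z * W" for x y z
    by (simp add: sC_apply T_def W_def)
  have expand: "(x + y * T + z * W) * (x' + y' * T + z' * W) =
      x * x' + (x * y' + y * x') * T + (x * z' + z * x') * W + y * y' * (T * T)
      + (y * z' + z * y') * (T * W) + z * z' * (W * W)" for x y z x' y' z' :: complex
    by (simp add: algebra_simps)
  have "sC p \<in> Ring.ring_hom C complex_ring"
  proof (rule ring_hom_memI)
    fix x y assume "x \<in> carrier C" "y \<in> carrier C"
    then obtain x0 x1 x2 y0 y1 y2 where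
      xy: "x = to_nat ((x0, x1, x2) :: int3)" "y = to_nat ((y0, y1, y2) :: int3)"
      unfolding carrier_C by (metis imageE prod_cases3)
    show "sC p (x \<otimes>\<^bsub>C\<^esub> y) = sC p x \<otimes>\<^bsub>complex_ring\<^esub> sC p y"
      by (simp add: xy C_def nat_ring_def mulC_def, simp add: C_def[symmetric] nat_ring_def[symmetric] ap expand TW WW)
        (simp add: algebra_simps)
    show "sC p (x \<oplus>\<^bsub>C\<^esub> y) = sC p x \<oplus>\<^bsub>complex_ring\<^esub> sC p y"
      by (simp add: xy C_def nat_ring_def plus_prod_def, simp add: C_def[symmetric] nat_ring_def[symmetric] ap)
        (simp add: algebra_simps)
  next
    have "\<one>\<^bsub>C\<^esub> = to_nat ((0, 1, 0) :: int3)" by (simp add: C_def nat_ring_def)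
    then show "sC p \<one>\<^bsub>C\<^esub> = \<one>\<^bsub>complex_ring\<^esub>" by (simp add: ap)
  qed simp
  then show ?thesis by (simp add: complex_homs_def sC_def)
qed

lemma i_powers: "\<i> ^ 2 = -1" "\<i> ^ 3 = - \<i>" "(- \<i>) ^ 2 = -1" "(- \<i>) ^ 3 = \<i>"
  by (simp_all add: eval_nat_numeral)

lemma small_split_R: "small_split R 4 sR bR"
proof (intro small_split.intro split_ring.intro split_ring_axioms.intro small_split_axioms.intro
    cring_R basis_R sR_hom)
  show "inj_on sR {..<4}"
  proof (rule inj_onI)
    fix i j assume ij: "i \<in> {..<4}" "j \<in> {..<4}" "sR i = sR j"
    then have "\<i> ^ i * complex_of_real u = \<i> ^ j * complex_of_real u" using sR_bR(3) by metis
    moreover have "complex_of_real u \<noteq> 0" using u_pos by simp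
    ultimately have "\<i> ^ i = \<i> ^ j" by (rule mult_right_cancel[THEN iffD1, rotated])
    then show "i = j" using ij(1,2) unfolding lessThan_iff less_4
      by (elim disjE) (simp_all add: i_powers complex_eq_iff)
  qed
qed simp_all

lemma small_split_C: "small_split C 3 sC bC"
proof (intro small_split.intro split_ring.intro split_ring_axioms.intro small_split_axioms.intro
    cring_C basis_C sC_hom)
  show "inj_on sC {..<3}"
  proof (rule inj_onI)
    fix i j assume ij: "i \<in> {..<3}" "j \<in> {..<3}" "sC i = sC j"
    then have "sC i (bC 0) = sC j (bC 0)" by simp
    then have "(if i = 0 then 0 else if i = 1 then 2 * \<i> * n * a * s else - 2 * \<i> * n * a * s) =
        (if j = 0 then 0 else if j = 1 then 2 * \<i> * n * a * s else - 2 * \<i> * n * a * s)"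
      unfolding bC_def sC_apply by simp
    moreover have "i = 0 \<or> i = 1 \<or> i = 2" "j = 0 \<or> j = 1 \<or> j = 2" using ij by auto
    ultimately show "i = j" using pos s_pos
      by (elim disjE) (simp_all add: complex_eq_iff)
  qed
qed simp_all

interpretation R: small_split R 4 sR bR by (rule small_split_R)
interpretation C: small_split C 3 sC bC by (rule small_split_C)

lemma disc_R: "ring_disc 4 R = - 256 * a ^ 4 * n\<^sup>2 * b ^ 3 * c ^ 3"
proof -
  let ?G = "\<lambda>i j. \<Sum>k<4. sR k (bR i) * sR k (bR j)"
  have S: "(\<Sum>k<4. f k) = f 0 + f 1 + f 2 + f 3" for f :: "nat \<Rightarrow> complex"
    by (simp add: eval_nat_numeral)
  note val = sR_bR sR_bR[unfolded One_nat_def] i_powers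
  \<comment> \<open>The trace form is diagonal except that it pairs \<alpha>2 with \<alpha>3 and
    neither with itself; this antidiagonal block gives the negative sign.\<close>
  have col0: "?G 1 0 = 0" "?G 2 0 = 0" "?G 3 0 = 0" and col1: "?G 2 1 = 0" "?G 3 1 = 0"
    and block: "?G 2 2 = 0" "?G 3 3 = 0" "?G 2 3 = 4 * (u * v)" "?G 3 2 = 4 * (u * v)"
    and diag: "?G 0 0 = 4" "?G 1 1 = 4 * (a * s) * (a * s)"
    unfolding S by (simp_all add: val)
  have "complex_of_int (ring_disc 4 R) = Determinant.det (Matrix.mat (Suc (Suc 2)) (Suc (Suc 2)) (\<lambda>(i, j). ?G i j))"
    unfolding R.ring_disc_gram by (simp add: eval_nat_numeral)
  also have "\<dots> = ?G 0 0 * (?G 1 1 * (?G 2 2 * ?G 3 3 - ?G 2 3 * ?G 3 2))"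
  proof -
    have G0: "?G j 0 = 0" if "0 < j" "j < Suc (Suc 2)" for j
    proof -
      have "j = 1 \<or> j = 2 \<or> j = 3" using that by auto
      then show ?thesis using col0 by (elim disjE) simp_all
    qed
    have G1: "?G (Suc j) (Suc 0) = 0" if "0 < j" "j < Suc 2" for j
    proof -
      have "Suc j = 2 \<or> Suc j = 3" using that by auto
      then show ?thesis using col1[unfolded One_nat_def] by (elim disjE) (simp_all only:)
    qed
    note det1 = det_fun_expand[of "Suc 2" ?G, OF G0]
    note det2 = det_fun_expand[of 2 "\<lambda>i j. ?G (Suc i) (Suc j)", OF G1]
    note det3 = det_fun_2[of "\<lambda>i j. ?G (Suc (Suc i)) (Suc (Suc j))"]
    have suc: "Suc 0 = 1" "Suc 1 = 2" "Suc 2 = 3" by simp_all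
    show ?thesis using det1 det2 det3 by (simp only: suc)
  qed
  also have "\<dots> = of_real (- 256 * (a * s) * (a * s) * (u * v) * (u * v))"
    unfolding diag block by simp
  also have "\<dots> = of_real (of_int (- 256 * a ^ 4 * n\<^sup>2 * b ^ 3 * c ^ 3))"
  proof (rule arg_cong[of _ _ complex_of_real])
    have "- 256 * (a * s) * (a * s) * (u * v) * (u * v) = - 256 * a\<^sup>2 * (s * s) * (u * v)\<^sup>2"
      by (simp add: power2_eq_square)
    also have "\<dots> = of_int (- 256 * a ^ 4 * n\<^sup>2 * b ^ 3 * c ^ 3)"
      unfolding s_sq uv by (simp add: power2_eq_square power3_eq_cube power4_eq_xxxx)
    finally show "- 256 * (a * s) * (a * s) * (u * v) * (u * v) = of_int (- 256 * a ^ 4 * n\<^sup>2 * b ^ 3 * c ^ 3)" .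
  qed
  finally show ?thesis by (simp only: of_real_of_int_eq of_int_eq_iff)
qed

lemma disc_C: "ring_disc 3 C = - 256 * a ^ 4 * n\<^sup>2 * b ^ 3 * c ^ 3"
proof -
  let ?G = "\<lambda>i j. \<Sum>k<3. sC k (bC i) * sC k (bC j)"
  have S: "(\<Sum>k<3. f k) = f 0 + f 1 + f 2" for f :: "nat \<Rightarrow> complex"
    by (simp add: eval_nat_numeral)
  have sCb: "sC p (bC 0) = (if p = 0 then 0 else if p = 1 then 2 * \<i> * n * a * s else - 2 * \<i> * n * a * s)"
    "sC p (bC 1) = 1" "sC p (bC 2) = (if p = 0 then - 4 * a * b * c else 0)" for p
    unfolding bC_def sC_apply by simp_all
  note sCb' = sCb[unfolded One_nat_def]
  have "complex_of_int (ring_disc 3 C) = Determinant.det (Matrix.mat (Suc 2) (Suc 2) (\<lambda>(i, j). ?G i j))"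
    unfolding C.ring_disc_gram by (simp add: eval_nat_numeral)
  also have "\<dots> = ?G 0 0 * (?G 1 1 * ?G 2 2 - ?G 1 2 * ?G 2 1)"
  proof -
    have G0: "?G j 0 = 0" if "0 < j" "j < Suc 2" for j
    proof -
      have "j = 1 \<or> j = 2" using that by auto
      then show ?thesis unfolding S by (elim disjE) (simp_all add: sCb sCb')
    qed
    note det1 = det_fun_expand[of 2 ?G, OF G0]
    note det2 = det_fun_2[of "\<lambda>i j. ?G (Suc i) (Suc j)"]
    have suc: "Suc 0 = 1" "Suc 1 = 2" by simp_all
    show ?thesis using det1 det2 by (simp only: suc)
  qed
  also have "\<dots> = of_real (- 8 * a\<^sup>2 * n\<^sup>2 * (s * s) * (2 * (4 * a * b * c)\<^sup>2))"
    unfolding S by (simp add: sCb sCb' power2_eq_square algebra_simps)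
  also have "\<dots> = of_real (of_int (- 256 * a ^ 4 * n\<^sup>2 * b ^ 3 * c ^ 3))"
    unfolding s_sq by (rule arg_cong[of _ _ complex_of_real])
      (simp add: power2_eq_square power3_eq_cube power4_eq_xxxx)
  finally show ?thesis by (simp only: of_real_of_int_eq of_int_eq_iff)
qed

end


section \<open>The Galois group of the family\<close>

lemma sqrt_2_irrational: "sqrt 2 \<notin> \<rat>"
proof
  assume "sqrt 2 \<in> \<rat>"
  then obtain m n :: nat where mn: "n \<noteq> 0" "\<bar>sqrt 2\<bar> = m / n" "coprime m n"
    by (rule Rats_abs_nat_div_natE)
  then have "real m = sqrt 2 * n" by simp
  then have "(real m)\<^sup>2 = 2 * (real n)\<^sup>2" by (simp add: power_mult_distrib)
  then have eq: "m\<^sup>2 = 2 * n\<^sup>2" by (metis of_nat_eq_iff of_nat_mult of_nat_numeral of_nat_power)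
  then have "even m" by (metis dvd_triv_left even_power)
  then obtain l where "m = 2 * l" by blast
  then have "n\<^sup>2 = 2 * l\<^sup>2" using eq by (simp add: power2_eq_square)
  then have "even n" by (metis dvd_triv_left even_power)
  with \<open>even m\<close> mn(3) show False by (metis coprime_common_divisor_nat even_numeral odd_one dvd_refl)
qed

text \<open>The map only has to be understood on a convenient field F around the generators. Finite
  order supplies the inverse as an iterate, so bijectivity on the generated field needs no separate
  argument.\<close>

lemma generated_field_automorphism:
  fixes U F :: "complex set"
  assumes UF: "U \<subseteq> F" and F1: "1 \<in> F" and Fu: "\<And>z. z \<in> F \<Longrightarrow> - z \<in> F"
    and Fi: "\<And>z. z \<in> F \<Longrightarrow> z \<noteq> 0 \<Longrightarrow> inverse z \<in> F"
    and Fa: "\<And>z w. z \<in> F \<Longrightarrow> w \<in> F \<Longrightarrow> z + w \<in> F"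
    and Fm: "\<And>z w. z \<in> F \<Longrightarrow> w \<in> F \<Longrightarrow> z * w \<in> F"
    and a1: "\<alpha> 1 = 1" and aa: "\<And>z w. z \<in> F \<Longrightarrow> w \<in> F \<Longrightarrow> \<alpha> (z + w) = \<alpha> z + \<alpha> w"
    and am: "\<And>z w. z \<in> F \<Longrightarrow> w \<in> F \<Longrightarrow> \<alpha> (z * w) = \<alpha> z * \<alpha> w"
    and aU: "\<And>z. z \<in> U \<Longrightarrow> \<alpha> z \<in> U"
    and period: "\<And>z. z \<in> F \<Longrightarrow> (\<alpha> ^^ Suc m) z = z"
  shows "\<alpha> \<in> ring_iso (complex_ring\<lparr>carrier := generate_field complex_ring U\<rparr>)
    (complex_ring\<lparr>carrier := generate_field complex_ring U\<rparr>)"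
proof -
  let ?K = "generate_field complex_ring U"
  have KF: "z \<in> F" if "z \<in> ?K" for z
    using that
  proof (induction rule: generate_field.induct)
    case (m_inv h)
    then show ?case using Fi by (simp add: class_ring_simps)
  qed (use UF F1 Fu Fa Fm in \<open>auto simp: class_ring_simps\<close>)
  have a0: "\<alpha> 0 = 0"
    using aa[of 0 0] Fa[OF F1 Fu[OF F1]] by simp
  have au: "\<alpha> (- z) = - \<alpha> z" if "z \<in> F" for z
    using aa[OF that Fu[OF that]] a0 by (simp add: add_eq_0_iff)
  have ai: "\<alpha> (inverse z) = inverse (\<alpha> z)" if "z \<in> F" "z \<noteq> 0" for z
    using am[OF that(1) Fi[OF that]] that a1 by (simp add: inverse_unique)
  have inj: "z = w" if "z \<in> F" "w \<in> F" "\<alpha> z = \<alpha> w" for z w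
    using period[OF that(1)] period[OF that(2)] that(3) by (metis comp_apply funpow_Suc_right)
  have aK: "\<alpha> z \<in> ?K" if "z \<in> ?K" for z
    using that
  proof (induction rule: generate_field.induct)
    case one
    then show ?case using a1 generate_field.one[of complex_ring U] by simp
  next
    case (incl h)
    then show ?case by (intro generate_field.incl aU)
  next
    case (a_inv h)
    then show ?case using au[OF KF] generate_field.a_inv[of "\<alpha> h" complex_ring U]
      by (simp add: class_ring_simps)
  next
    case (m_inv h)
    then have h: "h \<noteq> 0" by simp
    then have "\<alpha> h \<noteq> 0" using inj[OF KF[OF m_inv(1)], of 0] a0 Fa[OF F1 Fu[OF F1]] by auto
    then show ?case using m_inv h ai[OF KF] generate_field.m_inv[of "\<alpha> h" complex_ring U]
      by (simp add: class_ring_simps)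
  next
    case (eng_add h1 h2)
    then show ?case using aa[OF KF KF] generate_field.eng_add[of "\<alpha> h1" complex_ring U "\<alpha> h2"] by simp
  next
    case (eng_mult h1 h2)
    then show ?case using am[OF KF KF] generate_field.eng_mult[of "\<alpha> h1" complex_ring U "\<alpha> h2"] by simp
  qed
  have pK: "(\<alpha> ^^ j) z \<in> ?K" if "z \<in> ?K" for j z
    using that aK by (induction j) auto
  have "bij_betw \<alpha> ?K ?K"
  proof (rule bij_betwI[where g = "\<alpha> ^^ m"])
    fix z assume "z \<in> ?K"
    then show "(\<alpha> ^^ m) (\<alpha> z) = z" using period[OF KF] by (metis comp_apply funpow_Suc_right)
  next
    fix z assume "z \<in> ?K"
    then show "\<alpha> ((\<alpha> ^^ m) z) = z" using period[OF KF] by simp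
  qed (use aK pK in auto)
  then show ?thesis
    unfolding ring_iso_def using aK aa[OF KF KF] am[OF KF KF] a1
    by (auto intro!: ring_hom_memI)
qed

lemma galois_perms_comp:
  assumes "\<pi> \<in> galois_perms m R e" "\<pi>' \<in> galois_perms m R e"
  shows "\<pi> \<circ> \<pi>' \<in> galois_perms m R e"
proof -
  let ?K = "splitting_field R"
  obtain \<alpha> where \<pi>: "\<pi> permutes {1..m}" and \<alpha>: "\<alpha> \<in> ring_iso ?K ?K"
      "\<forall>i\<in>{1..m}. \<forall>x\<in>carrier R. e (\<pi> i) x = \<alpha> (e i x)"
    using assms(1) by (auto simp: galois_perms_def)
  obtain \<alpha>' where \<pi>': "\<pi>' permutes {1..m}" and \<alpha>': "\<alpha>' \<in> ring_iso ?K ?K"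
      "\<forall>i\<in>{1..m}. \<forall>x\<in>carrier R. e (\<pi>' i) x = \<alpha>' (e i x)"
    using assms(2) by (auto simp: galois_perms_def)
  have "\<forall>i\<in>{1..m}. \<forall>x\<in>carrier R. e ((\<pi> \<circ> \<pi>') i) x = (\<alpha> \<circ> \<alpha>') (e i x)"
    using \<alpha>(2) \<alpha>'(2) permutes_in_image[OF \<pi>'] by simp
  moreover have "\<alpha> \<circ> \<alpha>' \<in> ring_iso ?K ?K" using \<alpha>'(1) \<alpha>(1) by (rule ring_iso_set_trans)
  moreover have "\<pi> \<circ> \<pi>' permutes {1..m}" using \<pi>' \<pi> by (rule permutes_compose)
  ultimately show ?thesis unfolding galois_perms_def by blast
qed

lemma galois_perms_inv:
  assumes "\<pi> \<in> galois_perms m R e" "e \<in> numberings m R"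
  shows "inv' \<pi> \<in> galois_perms m R e"
proof -
  define U where "U = (\<Union>\<sigma>\<in>complex_homs R. \<sigma> ` carrier R)"
  define K where "K = generate_field complex_ring U"
  have KK: "splitting_field R = complex_ring\<lparr>carrier := K\<rparr>"
    by (simp add: splitting_field_def K_def U_def)
  obtain \<alpha> where \<pi>: "\<pi> permutes {1..m}" and \<alpha>: "\<alpha> \<in> ring_iso (splitting_field R) (splitting_field R)"
      "\<forall>i\<in>{1..m}. \<forall>x\<in>carrier R. e (\<pi> i) x = \<alpha> (e i x)"
    using assms(1) by (auto simp: galois_perms_def)
  have "field complex_ring" by (rule class_field.field_axioms)
  then have "field (complex_ring\<lparr>carrier := K\<rparr>)"
    unfolding K_def by (rule field.generate_field_is_field) simp
  then have "ring (complex_ring\<lparr>carrier := K\<rparr>)"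
    by (intro cring.axioms(1) domain.axioms(1) field.axioms(1))
  then have \<beta>: "inv_into K \<alpha> \<in> ring_iso (splitting_field R) (splitting_field R)"
    using ring_iso_set_sym[OF _ \<alpha>(1)] by (simp add: KK)
  have eK: "e i x \<in> K" if "i \<in> {1..m}" "x \<in> carrier R" for i x
  proof -
    have "e i \<in> complex_homs R" using that(1) assms(2) by (auto simp: numberings_def bij_betw_def)
    then show ?thesis unfolding K_def using that(2) by (intro generate_field.incl) (auto simp: U_def)
  qed
  have inj: "inj_on \<alpha> K" using \<alpha>(1) by (auto simp: KK ring_iso_def bij_betw_def)
  have \<pi>i: "inv' \<pi> permutes {1..m}" using \<pi> by (rule permutes_inv)
  have "e (inv' \<pi> i) x = inv_into K \<alpha> (e i x)" if "i \<in> {1..m}" "x \<in> carrier R" for i x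
  proof -
    have j: "inv' \<pi> i \<in> {1..m}" using permutes_in_image[OF \<pi>i] that(1) by simp
    have "e i x = \<alpha> (e (inv' \<pi> i) x)"
      using \<alpha>(2) j that(2) permutes_inverses(1)[OF \<pi>] by metis
    then show ?thesis using inj eK[OF j that(2)] by simp
  qed
  then show ?thesis using \<beta> \<pi>i by (auto simp: galois_perms_def)
qed

section \<open>The field generated by \<i> and u, and its rotation\<close>

context dihedral_family begin

interpretation R: small_split R 4 sR bR by (rule small_split_R)

definition gauss :: "complex set" where
  "gauss = {z. Re z \<in> \<rat> \<and> Im z \<in> \<rat>}"

lemma gauss_closed [intro, simp]:
  "0 \<in> gauss" "1 \<in> gauss" "\<i> \<in> gauss" "of_int m \<in> gauss"
  "z \<in> gauss \<Longrightarrow> - z \<in> gauss" "z \<in> gauss \<Longrightarrow> w \<in> gauss \<Longrightarrow> z + w \<in> gauss"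
  "z \<in> gauss \<Longrightarrow> w \<in> gauss \<Longrightarrow> z * w \<in> gauss"
  by (auto simp: gauss_def)

lemma gauss_power [intro, simp]: "z \<in> gauss \<Longrightarrow> z ^ j \<in> gauss"
  by (induction j) auto

lemma gauss_sum [intro, simp]: "(\<And>i. i \<in> I \<Longrightarrow> f i \<in> gauss) \<Longrightarrow> sum f I \<in> gauss"
  by (induction I rule: infinite_finite_induct) auto

lemma gauss_divide_int [intro, simp]: "z \<in> gauss \<Longrightarrow> z / of_int m \<in> gauss"
proof -
  assume z: "z \<in> gauss"
  have "z / of_int m = z * of_real (1 / of_int m)" by simp
  moreover have "of_real (1 / of_int m) \<in> gauss" by (simp add: gauss_def)
  ultimately show ?thesis using z by (simp only:) (rule gauss_closed)
qed

lemma s_independent: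
  assumes "x \<in> \<rat>" "y \<in> \<rat>" "x + y * s = 0"
  shows "x = 0" "y = 0"
proof -
  show "y = 0"
  proof (rule ccontr)
    assume "y \<noteq> 0"
    then have "sqrt 2 = - x / (y * k)" using assms(3) pos by (simp add: s_def field_simps)
    moreover have "- x / (y * k) \<in> \<rat>" using assms(1,2) by simp
    ultimately show False using sqrt_2_irrational by simp
  qed
  then show "x = 0" using assms(3) by simp
qed

text \<open>The conjugate of \<open>x\<^sup>2 = u\<^sup>2 y\<^sup>2\<close> under \<open>s \<mapsto> -s\<close> equates a square with minus a square,
  because \<open>u\<^sup>2\<close> is a positive rational multiple of \<open>s\<close>.\<close>

lemma u_independent_real:
  assumes q: "q0 \<in> \<rat>" "q1 \<in> \<rat>" "q2 \<in> \<rat>" "q3 \<in> \<rat>"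
    and eq: "q0 + q1 * u + q2 * u\<^sup>2 + q3 * u ^ 3 = 0"
  shows "q0 = 0 \<and> q1 = 0 \<and> q2 = 0 \<and> q3 = 0"
proof -
  define t where "t = real_of_int (n * a * b)"
  define m where "m = real_of_int (b * c)"
  have t: "0 < t" "t \<in> \<rat>" using pos by (simp_all add: t_def)
  have m: "m \<in> \<rat>" "s * s = m" by (simp_all add: m_def s_sq)
  have u2: "u\<^sup>2 = t * s" using u_sq by (simp add: t_def power2_eq_square)
  define x y where "x = q0 + q2 * t * s" and "y = q1 + q3 * t * s"
  have "x = - (u * y)"
    using eq u2 by (simp add: x_def y_def power3_eq_cube power2_eq_square algebra_simps)
  then have "x * x = u\<^sup>2 * (y * y)" by (simp add: power2_eq_square)
  then have xy: "x * x = t * s * (y * y)" by (simp add: u2)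
  have ex: "x * x = (q0 * q0 + q2 * q2 * t * t * (s * s)) + (2 * q0 * q2 * t) * s"
    by (simp add: x_def algebra_simps)
  have ey: "t * s * (y * y) = 2 * q1 * q3 * t * t * (s * s) + (t * (q1 * q1 + q3 * q3 * t * t * (s * s))) * s"
    by (simp add: y_def algebra_simps)
  let ?A = "q0 * q0 + q2 * q2 * t * t * m - 2 * q1 * q3 * t * t * m"
  let ?B = "2 * q0 * q2 * t - t * (q1 * q1 + q3 * q3 * t * t * m)"
  have "?A + ?B * s = 0" using xy unfolding ex ey m(2) by (simp add: algebra_simps)
  then have AB: "?A = 0" "?B = 0" using s_independent[of ?A ?B] q t(2) m(1) by auto
  define x' y' where "x' = q0 - q2 * t * s" and "y' = q1 - q3 * t * s"
  have "x' * x' + t * s * (y' * y') = (q0 * q0 + q2 * q2 * t * t * (s * s) - 2 * q1 * q3 * t * t * (s * s))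
      - (2 * q0 * q2 * t - t * (q1 * q1 + q3 * q3 * t * t * (s * s))) * s"
    by (simp add: x'_def y'_def algebra_simps)
  also have "\<dots> = 0" unfolding m(2) AB by simp
  finally have z: "x' * x' + t * s * (y' * y') = 0" .
  have "0 \<le> t * s * (y' * y')" using t s_pos by simp
  then have "x' * x' = 0" "t * s * (y' * y') = 0" using z zero_le_square[of x'] by linarith+
  then have "x' = 0" "y' = 0" using t s_pos by auto
  then have "q0 + (- (q2 * t)) * s = 0" "q1 + (- (q3 * t)) * s = 0" by (simp_all add: x'_def y'_def)
  then have "q0 = 0" "- (q2 * t) = 0" "q1 = 0" "- (q3 * t) = 0"
    using s_independent[of q0 "- (q2 * t)"] s_independent[of q1 "- (q3 * t)"] q t(2) by auto
  then show ?thesis using t by simp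
qed

text \<open>Since u is real, real and imaginary parts separate and the rational case applies to
  each. So u has degree four over the Gaussian rationals, and u can be sent to \<i> u while \<i> is
  fixed.\<close>

lemma u_independent:
  assumes g: "g0 \<in> gauss" "g1 \<in> gauss" "g2 \<in> gauss" "g3 \<in> gauss"
    and eq: "g0 + g1 * u + g2 * u\<^sup>2 + g3 * u ^ 3 = 0"
  shows "g0 = 0 \<and> g1 = 0 \<and> g2 = 0 \<and> g3 = 0"
proof -
  have re: "Re (g * complex_of_real u ^ j) = Re g * u ^ j" "Im (g * complex_of_real u ^ j) = Im g * u ^ j" for g j
    by (simp_all flip: of_real_power)
  have "Re (g0 + g1 * u + g2 * u\<^sup>2 + g3 * u ^ 3) = 0" "Im (g0 + g1 * u + g2 * u\<^sup>2 + g3 * u ^ 3) = 0"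
    unfolding eq by simp_all
  then have "Re g0 + Re g1 * u + Re g2 * u\<^sup>2 + Re g3 * u ^ 3 = 0"
    "Im g0 + Im g1 * u + Im g2 * u\<^sup>2 + Im g3 * u ^ 3 = 0"
    by (simp_all add: re)
  then have "Re g0 = 0 \<and> Re g1 = 0 \<and> Re g2 = 0 \<and> Re g3 = 0" "Im g0 = 0 \<and> Im g1 = 0 \<and> Im g2 = 0 \<and> Im g3 = 0"
    using g by (intro u_independent_real; simp add: gauss_def)+
  then show ?thesis by (simp add: complex_eq_iff)
qed

lemma u_pow_4: "complex_of_real u ^ 4 = of_int (n\<^sup>2 * a\<^sup>2 * b ^ 3 * c)"
proof -
  have "u ^ 4 = (u * u) * (u * u)" by (simp add: power4_eq_xxxx)
  also have "\<dots> = (n * a * b)\<^sup>2 * (s * s)" unfolding u_sq by (simp add: power2_eq_square)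
  also have "\<dots> = of_int (n\<^sup>2 * a\<^sup>2 * b ^ 3 * c)"
    unfolding s_sq by (simp add: power2_eq_square power3_eq_cube)
  finally show ?thesis by (metis of_real_of_int_eq of_real_power)
qed

definition gauss_poly :: "complex poly \<Rightarrow> bool" where
  "gauss_poly P \<longleftrightarrow> (\<forall>i. Polynomial.coeff P i \<in> gauss)"

lemma gauss_poly_ops:
  "gauss_poly P \<Longrightarrow> gauss_poly Q \<Longrightarrow> gauss_poly (P + Q)"
  "gauss_poly P \<Longrightarrow> gauss_poly Q \<Longrightarrow> gauss_poly (P * Q)"
  "gauss_poly P \<Longrightarrow> gauss_poly (- P)"
  "gauss_poly 1" "gauss_poly 0"
  "gauss_poly P \<Longrightarrow> gauss_poly (pcompose P [:0, \<i>:])"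
  "x \<in> gauss \<Longrightarrow> gauss_poly P \<Longrightarrow> gauss_poly (pCons x P)"
  by (auto simp: gauss_poly_def Polynomial.coeff_mult coeff_pcompose_linear coeff_pCons coeff_1 split: nat.splits)

text \<open>Reduction modulo X^4 - d with d an integer, a polynomial of which both u and \<i> u are
  roots. Passing from u to \<i> u only multiplies the coefficients of the residue by powers of
  \<i>.\<close>

lemma poly_residues:
  "gauss_poly P \<Longrightarrow> \<exists>g0 g1 g2 g3. g0 \<in> gauss \<and> g1 \<in> gauss \<and> g2 \<in> gauss \<and> g3 \<in> gauss \<and>
    poly P u = g0 + g1 * u + g2 * u\<^sup>2 + g3 * u ^ 3 \<and>
    poly P (\<i> * u) = g0 + (\<i> * g1) * u + (- g2) * u\<^sup>2 + (- \<i> * g3) * u ^ 3"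
proof (induction P)
  case 0
  then show ?case by (intro exI[of _ 0]) simp
next
  case (pCons x P)
  have x: "x \<in> gauss" "gauss_poly P"
    using pCons.prems unfolding gauss_poly_def
    by (metis coeff_pCons_0, metis coeff_pCons_Suc)
  obtain g0 g1 g2 g3 where g: "g0 \<in> gauss" "g1 \<in> gauss" "g2 \<in> gauss" "g3 \<in> gauss"
    "poly P u = g0 + g1 * u + g2 * u\<^sup>2 + g3 * u ^ 3"
    "poly P (\<i> * u) = g0 + (\<i> * g1) * u + (- g2) * u\<^sup>2 + (- \<i> * g3) * u ^ 3"
    using pCons.IH[OF x(2)] by blast
  let ?d = "of_int (n\<^sup>2 * a\<^sup>2 * b ^ 3 * c) :: complex"
  have "u * (g0 + g1 * u + g2 * u\<^sup>2 + g3 * u ^ 3) = g0 * u + g1 * u\<^sup>2 + g2 * u ^ 3 + g3 * complex_of_real u ^ 4"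
    by (simp add: power2_eq_square power3_eq_cube power4_eq_xxxx algebra_simps)
  then have 1: "poly (pCons x P) u = (x + ?d * g3) + g0 * u + g1 * u\<^sup>2 + g2 * u ^ 3"
    unfolding poly_pCons g(5) u_pow_4 by simp
  have "\<i> * u * (g0 + (\<i> * g1) * u + (- g2) * u\<^sup>2 + (- \<i> * g3) * u ^ 3) =
      (\<i> * g0) * u + (- g1) * u\<^sup>2 + (- \<i> * g2) * u ^ 3 + g3 * complex_of_real u ^ 4"
    by (simp add: power2_eq_square power3_eq_cube power4_eq_xxxx algebra_simps)
  then have 2: "poly (pCons x P) (\<i> * u) =
      (x + ?d * g3) + (\<i> * g0) * u + (- g1) * u\<^sup>2 + (- \<i> * g2) * u ^ 3"
    unfolding poly_pCons g(6) u_pow_4 by simp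
  show ?case
    by (rule exI[of _ "x + ?d * g3"], rule exI[of _ g0], rule exI[of _ g1], rule exI[of _ g2])
      (use 1 2 x g in auto)
qed

lemma poly_root_iff:
  assumes "gauss_poly P"
  shows "poly P u = 0 \<longleftrightarrow> poly P (\<i> * u) = 0"
proof -
  obtain g0 g1 g2 g3 where g: "g0 \<in> gauss" "g1 \<in> gauss" "g2 \<in> gauss" "g3 \<in> gauss"
    "poly P u = g0 + g1 * u + g2 * u\<^sup>2 + g3 * u ^ 3"
    "poly P (\<i> * u) = g0 + (\<i> * g1) * u + (- g2) * u\<^sup>2 + (- \<i> * g3) * u ^ 3"
    using poly_residues[OF assms] by blast
  have "poly P u = 0 \<longleftrightarrow> g0 = 0 \<and> g1 = 0 \<and> g2 = 0 \<and> g3 = 0"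
    unfolding g(5) using u_independent[OF g(1-4)] by auto
  moreover have "poly P (\<i> * u) = 0 \<longleftrightarrow> g0 = 0 \<and> g1 = 0 \<and> g2 = 0 \<and> g3 = 0"
    unfolding g(6) using u_independent[of g0 "\<i> * g1" "- g2" "- \<i> * g3"] g(1-4) by auto
  ultimately show ?thesis by simp
qed

definition big_field :: "complex set" where
  "big_field = {poly P u / poly Q u | P Q. gauss_poly P \<and> gauss_poly Q \<and> poly Q u \<noteq> 0}"

text \<open>The automorphism that sends u to \<i> u and fixes \<i>. The value does not depend on the
  chosen fraction, because a Gaussian polynomial vanishes at u exactly when it vanishes at \<i>
  u.\<close>

definition rot :: "complex \<Rightarrow> complex" where
  "rot z = (SOME w. \<exists>P Q. gauss_poly P \<and> gauss_poly Q \<and> poly Q u \<noteq> 0 \<and>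
     z = poly P u / poly Q u \<and> w = poly P (\<i> * u) / poly Q (\<i> * u))"

lemma rot_eq:
  assumes "gauss_poly P" "gauss_poly Q" "poly Q u \<noteq> 0"
  shows "rot (poly P u / poly Q u) = poly P (\<i> * u) / poly Q (\<i> * u)"
  unfolding rot_def
proof (rule some_equality)
  show "\<exists>P' Q'. gauss_poly P' \<and> gauss_poly Q' \<and> poly Q' u \<noteq> 0 \<and>
     poly P u / poly Q u = poly P' u / poly Q' u \<and>
     poly P (\<i> * u) / poly Q (\<i> * u) = poly P' (\<i> * u) / poly Q' (\<i> * u)"
    using assms by blast
  fix w assume "\<exists>P' Q'. gauss_poly P' \<and> gauss_poly Q' \<and> poly Q' u \<noteq> 0 \<and>
     poly P u / poly Q u = poly P' u / poly Q' u \<and> w = poly P' (\<i> * u) / poly Q' (\<i> * u)"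
  then obtain P' Q' where w: "gauss_poly P'" "gauss_poly Q'" "poly Q' u \<noteq> 0"
    "poly P u / poly Q u = poly P' u / poly Q' u" "w = poly P' (\<i> * u) / poly Q' (\<i> * u)"
    by blast
  have "poly (P * Q' + - (P' * Q)) u = 0" using w(3,4) assms(3) by (simp add: field_simps)
  moreover have "gauss_poly (P * Q' + - (P' * Q))"
    by (intro gauss_poly_ops assms w)
  ultimately have "poly (P * Q' + - (P' * Q)) (\<i> * u) = 0" using poly_root_iff by blast
  moreover have "poly Q (\<i> * u) \<noteq> 0" "poly Q' (\<i> * u) \<noteq> 0"
    using poly_root_iff assms w by auto
  ultimately show "w = poly P (\<i> * u) / poly Q (\<i> * u)"
    unfolding w(5) by (subst frac_eq_eq) auto
qed

lemma big_fieldE: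
  assumes "z \<in> big_field"
  obtains P Q where "gauss_poly P" "gauss_poly Q" "poly Q u \<noteq> 0" "poly Q (\<i> * u) \<noteq> 0"
    "z = poly P u / poly Q u" "rot z = poly P (\<i> * u) / poly Q (\<i> * u)"
proof -
  obtain P Q where PQ: "gauss_poly P" "gauss_poly Q" "poly Q u \<noteq> 0" "z = poly P u / poly Q u"
    using assms by (auto simp: big_field_def)
  then show ?thesis using that rot_eq poly_root_iff by metis
qed

lemma big_fieldI:
  assumes "gauss_poly P" "gauss_poly Q" "poly Q u \<noteq> 0" "z = poly P u / poly Q u"
  shows "z \<in> big_field"
  using assms by (auto simp: big_field_def)

lemma rot_in: 
  assumes "gauss_poly P" "gauss_poly Q" "poly Q u \<noteq> 0"
  shows "poly P (\<i> * u) / poly Q (\<i> * u) \<in> big_field"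
    "rot (poly P (\<i> * u) / poly Q (\<i> * u)) = poly P (- u) / poly Q (- u)"
proof -
  let ?P = "pcompose P [:0, \<i>:]" and ?Q = "pcompose Q [:0, \<i>:]"
  have g: "gauss_poly ?P" "gauss_poly ?Q" using assms by (simp_all add: gauss_poly_ops)
  have e: "poly ?P u = poly P (\<i> * u)" "poly ?Q u = poly Q (\<i> * u)"
    "poly ?P (\<i> * u) = poly P (- u)" "poly ?Q (\<i> * u) = poly Q (- u)"
    by (simp_all add: poly_pcompose mult.commute[of _ \<i>])
  have nz: "poly ?Q u \<noteq> 0" using assms poly_root_iff[OF assms(2)] by (simp add: e)
  show "poly P (\<i> * u) / poly Q (\<i> * u) \<in> big_field"
    using big_fieldI[OF g nz refl] by (simp only: e)
  show "rot (poly P (\<i> * u) / poly Q (\<i> * u)) = poly P (- u) / poly Q (- u)"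
    using rot_eq[OF g nz] by (simp only: e)
qed

lemma rot_rot:
  assumes "gauss_poly P" "gauss_poly Q" "poly Q u \<noteq> 0"
  shows "(rot ^^ 2) (poly P u / poly Q u) = poly P (- u) / poly Q (- u)"
  using rot_eq[OF assms] rot_in[OF assms] by (simp add: numeral_2_eq_2)

lemma rot_period: "z \<in> big_field \<Longrightarrow> (rot ^^ Suc 3) z = z"
proof -
  assume "z \<in> big_field"
  then obtain P Q where PQ: "gauss_poly P" "gauss_poly Q" "poly Q u \<noteq> 0" "z = poly P u / poly Q u"
    by (auto simp: big_field_def)
  let ?f = "\<lambda>P. pcompose (pcompose P [:0, \<i>:]) [:0, \<i>:]"
  have e: "poly (?f P) x = poly P (- x)" for P x
  proof -
    have "\<i> * x * \<i> = - x" "x * \<i> * \<i> = - x" by (simp_all add: complex_eq_iff)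
    then show ?thesis by (simp add: poly_pcompose)
  qed
  have nz: "poly (?f Q) u \<noteq> 0"
    using poly_root_iff[OF PQ(2)] poly_root_iff[OF gauss_poly_ops(6)[OF PQ(2)]] PQ(3)
    by (simp add: poly_pcompose mult.commute[of _ \<i>])
  have "(rot ^^ 2) ((rot ^^ 2) z) = (rot ^^ 2) (poly (?f P) u / poly (?f Q) u)"
    using rot_rot[OF PQ(1-3)] by (simp add: PQ(4) e)
  also have "\<dots> = z"
    using rot_rot[of "?f P" "?f Q"] nz PQ by (simp add: gauss_poly_ops e)
  finally show ?thesis by (simp add: eval_nat_numeral)
qed

lemma sR_poly:
  obtains P where "gauss_poly P" "poly P u = sR i (to_nat ((x0, x1, x2, x3) :: int4))"
    "poly P (\<i> * u) = sR (Suc i) (to_nat ((x0, x1, x2, x3) :: int4))"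
proof -
  \<comment> \<open>The coefficients come from a s = u^2 / (n b) and v = u^3 / (n a b^2), which
    express all conjugates through u.\<close>
  let ?P = "[:of_int x0, of_int x2 * \<i> ^ i, of_int x1 * (-1) ^ i / of_int (n * b),
    of_int x3 * (- \<i>) ^ i / of_int (n * a * b\<^sup>2):] :: complex poly"
  have P: "poly ?P z = of_int x0 + of_int x1 * ((-1) ^ i * (z\<^sup>2 / of_int (n * b))) + of_int x2 * (\<i> ^ i * z)
      + of_int x3 * ((- \<i>) ^ i * (z ^ 3 / of_int (n * a * b\<^sup>2)))" for z
    by (simp add: power2_eq_square power3_eq_cube algebra_simps)
  have as: "complex_of_real u ^ 2 / of_int (n * b) = a * s"
  proof -
    have "u\<^sup>2 / real_of_int (n * b) = real_of_int a * s" using u_sq pos by (simp add: power2_eq_square field_simps)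
    then have "complex_of_real (u\<^sup>2 / real_of_int (n * b)) = complex_of_real (real_of_int a * s)" by (simp only:)
    then show ?thesis by (simp only: of_real_divide of_real_mult of_real_power of_real_of_int_eq)
  qed
  have v: "complex_of_real u ^ 3 / of_int (n * a * b\<^sup>2) = v"
  proof -
    have "u ^ 3 = (s * u) * (n * a * b)" using u_sq by (simp add: power3_eq_cube)
    also have "\<dots> = (b * v) * (n * a * b)" by (simp only: su)
    finally have "u ^ 3 / of_int (n * a * b\<^sup>2) = v" using pos by (simp add: power2_eq_square)
    then have "complex_of_real (u ^ 3 / of_int (n * a * b\<^sup>2)) = complex_of_real v" by (simp only:)
    then show ?thesis by (simp only: of_real_divide of_real_power of_real_of_int_eq)
  qed
  have as': "(\<i> * complex_of_real u) ^ 2 / of_int (n * b) = - (a * s)"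
    using as by (simp add: power_mult_distrib)
  have v': "(\<i> * complex_of_real u) ^ 3 / of_int (n * a * b\<^sup>2) = - \<i> * v"
  proof -
    have "(\<i> * complex_of_real u) ^ 3 / of_int (n * a * b\<^sup>2) =
        - \<i> * (complex_of_real u ^ 3 / of_int (n * a * b\<^sup>2))"
      by (simp add: power_mult_distrib i_powers)
    then show ?thesis by (simp only: v)
  qed
  have "gauss_poly ?P" by (intro gauss_poly_ops gauss_closed gauss_divide_int gauss_power)
  moreover have "poly ?P u = sR i (to_nat ((x0, x1, x2, x3) :: int4))"
    unfolding sR_apply P as v by simp
  moreover have "poly ?P (\<i> * u) = sR (Suc i) (to_nat ((x0, x1, x2, x3) :: int4))"
    unfolding sR_apply P as' v' by simp
  ultimately show ?thesis by (rule that)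
qed

lemma sR_4: "sR 4 = sR 0"
  unfolding sR_def by simp

lemma sR_rot: "x \<in> carrier R \<Longrightarrow> sR i x \<in> big_field \<and> rot (sR i x) = sR (Suc i) x"
proof -
  assume "x \<in> carrier R"
  then obtain x0 x1 x2 x3 where x: "x = to_nat ((x0, x1, x2, x3) :: int4)"
    unfolding carrier_R by (metis imageE prod_cases4)
  obtain P where P: "gauss_poly P" "poly P u = sR i x" "poly P (\<i> * u) = sR (Suc i) x"
    unfolding x by (rule sR_poly)
  show ?thesis
    using big_fieldI[of P 1 "sR i x"] rot_eq[of P 1] P by (simp add: gauss_poly_ops)
qed

section \<open>The Galois action on the numbered embeddings\<close>

definition eR :: "nat \<Rightarrow> nat \<Rightarrow> complex" where
  "eR = (\<lambda>i\<in>{1..4}. sR (i - 1))"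

lemma eR_simps: "eR 1 = sR 0" "eR 2 = sR 1" "eR 3 = sR 2" "eR 4 = sR 3"
  by (simp_all add: eR_def)

lemma eR_numbering: "eR \<in> numberings 4 R"
proof -
  have "bij_betw (\<lambda>i. i - 1) {1..4} {..<4::nat}"
    by (rule bij_betwI[where g = Suc]) auto
  then have "bij_betw (sR \<circ> (\<lambda>i. i - 1)) {1..4} (complex_homs R)" using R.homs_bij by (rule bij_betw_trans)
  then have "bij_betw eR {1..4} (complex_homs R)"
    by (rule bij_betw_cong[THEN iffD1, rotated]) (simp add: eR_def)
  then show ?thesis by (simp add: numberings_def eR_def)
qed

lemma range_14: "i \<in> {1..4::nat} \<longleftrightarrow> i = 1 \<or> i = 2 \<or> i = 3 \<or> i = 4"
  by auto

definition images :: "complex set" where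
  "images = (\<Union>\<sigma>\<in>complex_homs R. \<sigma> ` carrier R)"

lemma splitting_field_images:
  "splitting_field R = complex_ring\<lparr>carrier := generate_field complex_ring images\<rparr>"
  by (simp add: splitting_field_def images_def)

lemma images_iff: "z \<in> images \<longleftrightarrow> (\<exists>i<4. \<exists>x\<in>carrier R. z = sR i x)"
  by (auto simp: images_def R.complex_homs_eq)

lemma rot_automorphism: "rot \<in> ring_iso (splitting_field R) (splitting_field R)"
  unfolding splitting_field_images
proof (rule generated_field_automorphism[where F = big_field and m = 3])
  show "images \<subseteq> big_field" using sR_rot by (auto simp: images_iff)
  show "1 \<in> big_field" by (rule big_fieldI[of 1 1]) (simp_all add: gauss_poly_ops)
  show "rot 1 = 1" using rot_eq[of 1 1] by (simp add: gauss_poly_ops)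
  show "- z \<in> big_field" if "z \<in> big_field" for z
    using that by (rule big_fieldE) (rule big_fieldI[of "- _"], auto simp: gauss_poly_ops)
  show "inverse z \<in> big_field" if "z \<in> big_field" "z \<noteq> 0" for z
  proof (rule big_fieldE[OF that(1)])
    fix P Q assume "gauss_poly P" "gauss_poly Q" "z = poly P u / poly Q u"
    then show ?thesis using that(2) by (intro big_fieldI[of Q P]) auto
  qed
  fix z w assume z: "z \<in> big_field" and w: "w \<in> big_field"
  obtain P Q where PQ: "gauss_poly P" "gauss_poly Q" "poly Q u \<noteq> 0" "poly Q (\<i> * u) \<noteq> 0"
    "z = poly P u / poly Q u" "rot z = poly P (\<i> * u) / poly Q (\<i> * u)" by (rule big_fieldE[OF z])
  obtain P' Q' where PQ': "gauss_poly P'" "gauss_poly Q'" "poly Q' u \<noteq> 0" "poly Q' (\<i> * u) \<noteq> 0"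
    "w = poly P' u / poly Q' u" "rot w = poly P' (\<i> * u) / poly Q' (\<i> * u)" by (rule big_fieldE[OF w])
  have g: "gauss_poly (P * Q' + P' * Q)" "gauss_poly (P * P')" "gauss_poly (Q * Q')"
    using PQ PQ' by (simp_all add: gauss_poly_ops)
  have nz: "poly (Q * Q') u \<noteq> 0" using PQ PQ' by simp
  have sum: "z + w = poly (P * Q' + P' * Q) u / poly (Q * Q') u" and
    prod: "z * w = poly (P * P') u / poly (Q * Q') u"
    using PQ(3) PQ'(3) by (simp_all add: PQ(5) PQ'(5) add_frac_eq)
  show "z + w \<in> big_field" using big_fieldI[OF g(1,3) nz sum] .
  show "z * w \<in> big_field" using big_fieldI[OF g(2,3) nz prod] .
  show "rot (z + w) = rot z + rot w"
    unfolding sum rot_eq[OF g(1,3) nz] PQ(6) PQ'(6) using PQ(4) PQ'(4) by (simp add: add_frac_eq)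
  show "rot (z * w) = rot z * rot w"
    unfolding prod rot_eq[OF g(2,3) nz] PQ(6) PQ'(6) by simp
next
  fix z assume "z \<in> images"
  then obtain i x where ix: "i < 4" "x \<in> carrier R" "z = sR i x" by (auto simp: images_iff)
  have "sR (Suc i) x = sR (if i = 3 then 0 else Suc i) x"
  proof (cases "i = 3")
    case True
    then have "sR (Suc i) = sR 0" using sR_4 by simp
    then show ?thesis using True by simp
  qed simp
  then have "rot z = sR (if i = 3 then 0 else Suc i) x"
    using sR_rot[OF ix(2), of i] ix(3) by metis
  then show "rot z \<in> images" using ix unfolding images_iff
    by (intro exI[of _ "if i = 3 then 0 else Suc i"]) auto
qed (rule rot_period)

lemma cnj_sR: "cnj (sR 0 x) = sR 0 x" "cnj (sR 1 x) = sR 3 x" "cnj (sR 2 x) = sR 2 x" "cnj (sR 3 x) = sR 1 x"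
  if cx: "x \<in> carrier R"
proof -
  obtain w :: int4 where w: "x = to_nat w" using cx unfolding carrier_R by blast
  obtain x0 x1 x2 x3 where "w = (x0, x1, x2, x3)" by (cases w)
  with w have x: "x = to_nat ((x0, x1, x2, x3) :: int4)" by simp
  have 0: "sR 0 x = of_int x0 + of_int x1 * (a * s) + of_int x2 * u + of_int x3 * v"
    unfolding x sR_apply by simp
  have 1: "sR 1 x = of_int x0 - of_int x1 * (a * s) + of_int x2 * (\<i> * u) - of_int x3 * (\<i> * v)"
    unfolding x sR_apply by simp
  have 2: "sR 2 x = of_int x0 + of_int x1 * (a * s) - of_int x2 * u - of_int x3 * v"
    unfolding x sR_apply i_powers by simp
  have 3: "sR 3 x = of_int x0 - of_int x1 * (a * s) - of_int x2 * (\<i> * u) + of_int x3 * (\<i> * v)"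
    unfolding x sR_apply i_powers by simp
  show "cnj (sR 0 x) = sR 0 x" unfolding 0 by simp
  show "cnj (sR 1 x) = sR 3 x" unfolding 1 3 by simp
  show "cnj (sR 2 x) = sR 2 x" unfolding 2 by simp
  show "cnj (sR 3 x) = sR 1 x" unfolding 1 3 by simp
qed

lemma cnj_automorphism: "cnj \<in> ring_iso (splitting_field R) (splitting_field R)"
  unfolding splitting_field_images
proof (rule generated_field_automorphism[where F = UNIV and m = 1])
  fix z assume "z \<in> images"
  then obtain i x where ix: "i < 4" "x \<in> carrier R" "z = sR i x" by (auto simp: images_iff)
  have "\<exists>j\<in>{0, 1, 2, 3}. cnj (sR i x) = sR j x"
    using ix(1) unfolding less_4[of i] by (elim disjE) (use cnj_sR[OF ix(2)] in blast)+
  then obtain j where "j \<in> {0, 1, 2, 3 :: nat}" "cnj (sR i x) = sR j x" by (rule bexE)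
  moreover from this(1) have "j < 4" by auto
  ultimately have "\<exists>j<4. cnj (sR i x) = sR j x" by blast
  then show "cnj z \<in> images" using ix unfolding images_iff by blast
qed auto

lemma rotation_galois: "cycle_of_list [1, 2, 3, 4] \<in> galois_perms 4 R eR"
  unfolding galois_perms_def
proof (intro CollectI conjI bexI[of _ rot] rot_automorphism ballI)
  show "cycle_of_list [1, 2, 3, 4::nat] permutes {1..4}"
    using cycle_permutes[of "[1, 2, 3, 4::nat]"] permutes_subset[of _ "set [1, 2, 3, 4::nat]" "{1..4}"] by auto
  fix i :: nat and x assume i: "i \<in> {1..4}" and x: "x \<in> carrier R"
  have c: "cycle_of_list [1, 2, 3, 4::nat] 1 = 2" "cycle_of_list [1, 2, 3, 4::nat] 2 = 3"
    "cycle_of_list [1, 2, 3, 4::nat] 3 = 4" "cycle_of_list [1, 2, 3, 4::nat] 4 = 1"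
    by (simp_all add: Transposition.transpose_def)
  have r: "rot (sR 0 x) = sR 1 x" "rot (sR 1 x) = sR 2 x" "rot (sR 2 x) = sR 3 x" "rot (sR 3 x) = sR 0 x"
    using sR_rot[OF x, of 0] sR_rot[OF x, of 1] sR_rot[OF x, of 2] sR_rot[OF x, of 3] sR_4
    by (simp_all add: eval_nat_numeral)
  show "eR (cycle_of_list [1, 2, 3, 4] i) x = rot (eR i x)"
    using i unfolding range_14 by (elim disjE; simp only: c eR_simps r)
qed

lemma conjugation_galois: "Transposition.transpose 2 4 \<in> galois_perms 4 R eR"
  unfolding galois_perms_def
proof (intro CollectI conjI bexI[of _ cnj] cnj_automorphism ballI)
  show "Transposition.transpose 2 (4::nat) permutes {1..4}" by (rule permutes_swap_id) auto
  fix i :: nat and x assume i: "i \<in> {1..4}" and x: "x \<in> carrier R"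
  have c: "Transposition.transpose 2 4 (1::nat) = 1" "Transposition.transpose 2 4 (2::nat) = 4"
    "Transposition.transpose 2 4 (3::nat) = 3" "Transposition.transpose 2 4 (4::nat) = 2"
    by (simp_all add: Transposition.transpose_def)
  show "eR (Transposition.transpose 2 4 i) x = cnj (eR i x)"
    using i unfolding range_14 by (elim disjE; simp only: c eR_simps cnj_sR[OF x])
qed

lemma permutes_14_eqI:
  assumes "\<pi> permutes {1..4::nat}" "\<rho> permutes {1..4}" "\<pi> 1 = \<rho> 1" "\<pi> 2 = \<rho> 2" "\<pi> 3 = \<rho> 3" "\<pi> 4 = \<rho> 4"
  shows "\<pi> = \<rho>"
proof
  fix i
  show "\<pi> i = \<rho> i"
  proof (cases "i \<in> {1..4}")
    case True
    then show ?thesis unfolding range_14 using assms by auto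
  next
    case False
    then show ?thesis using assms(1,2) by (simp add: permutes_def)
  qed
qed

abbreviation "r4 \<equiv> cycle_of_list [1, 2, 3, 4::nat]"
abbreviation "t13 \<equiv> Transposition.transpose 1 (3::nat)"

lemma r4_permutes: "r4 permutes {1..4}"
  using rotation_galois by (simp add: galois_perms_def)

lemma t13_permutes: "t13 permutes {1..4}"
  by (rule permutes_swap_id) auto

text \<open>Complex conjugation exchanges the embeddings 2 and 4; followed by the half turn it
  becomes the reflection that generates \<open>D4\<close> together with the four-cycle.\<close>

lemma t13_galois: "t13 \<in> galois_perms 4 R eR"
proof -
  have "r4 \<circ> (r4 \<circ> Transposition.transpose 2 4) = t13"
    by (rule permutes_14_eqI)
      (auto intro!: permutes_compose r4_permutes t13_permutes permutes_swap_id simp: Transposition.transpose_def)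
  then show ?thesis using galois_perms_comp rotation_galois conjugation_galois by metis
qed

lemma id_galois: "id \<in> galois_perms 4 R eR"
proof -
  have "id \<in> ring_iso (splitting_field R) (splitting_field R)"
    by (auto simp: ring_iso_def ring_hom_def)
  then show ?thesis unfolding galois_perms_def
    by (intro CollectI conjI bexI[of _ id] permutes_id) auto
qed

lemma D4_le_galois: "D4 \<subseteq> galois_perms 4 R eR"
proof
  fix \<pi> assume "\<pi> \<in> D4"
  then show "\<pi> \<in> galois_perms 4 R eR"
    unfolding D4_def
  proof (induction rule: generate.induct)
    case one
    show ?case by (simp only: sym_group_one id_galois)
  next
    case (incl h)
    then show ?case using rotation_galois t13_galois by auto
  next
    case (inv h)
    then have h: "h \<in> galois_perms 4 R eR" using rotation_galois t13_galois by auto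
    then have "h \<in> carrier (sym_group 4)" by (simp add: galois_perms_def sym_group_carrier)
    then show ?case using galois_perms_inv[OF h eR_numbering] by (simp add: sym_group_inv_equality)
  next
    case (eng h1 h2)
    show ?case unfolding sym_group_mult using eng(3,4) by (rule galois_perms_comp)
  qed
qed

lemma D4_comp: "\<pi> \<in> D4 \<Longrightarrow> \<rho> \<in> D4 \<Longrightarrow> \<pi> \<circ> \<rho> \<in> D4"
  unfolding D4_def using generate.eng[of \<pi> "sym_group 4" _ \<rho>] by (simp add: sym_group_mult)

lemma D4_gens: "r4 \<in> D4" "t13 \<in> D4" "id \<in> D4"
  unfolding D4_def using generate.one[of "sym_group 4"] by (auto intro: generate.incl simp: sym_group_one)

text \<open>An element of the Galois group respects the blocks \<open>{1, 3}\<close> and \<open>{2, 4}\<close>, on which \<open>bR 2\<close>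
  takes opposite values.\<close>

lemma galois_le_D4: "galois_perms 4 R eR \<subseteq> D4"
proof
  fix \<pi> assume "\<pi> \<in> galois_perms 4 R eR"
  then obtain \<alpha> where \<pi>: "\<pi> permutes {1..4}" and \<alpha>: "\<alpha> \<in> ring_iso (splitting_field R) (splitting_field R)"
      "\<forall>i\<in>{1..4}. \<forall>x\<in>carrier R. eR (\<pi> i) x = \<alpha> (eR i x)"
    by (auto simp: galois_perms_def)
  have hom: "\<alpha> \<in> Ring.ring_hom (splitting_field R) (splitting_field R)"
    using \<alpha>(1) by (simp add: ring_iso_def)
  have b2: "bR 2 \<in> carrier R" by simp
  have val: "eR 1 (bR 2) = u" "eR 2 (bR 2) = \<i> * u" "eR 3 (bR 2) = - u" "eR 4 (bR 2) = - \<i> * u"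
    unfolding eR_simps sR_bR by (simp_all add: i_powers)
  have K: "eR i (bR 2) \<in> generate_field complex_ring images" if "i \<in> {1..4}" for i
  proof (rule generate_field.incl)
    have "eR i \<in> complex_homs R" using eR_numbering that by (auto simp: numberings_def bij_betw_def)
    then show "eR i (bR 2) \<in> images" unfolding images_def using b2 by blast
  qed
  have add: "\<alpha> (z + w) = \<alpha> z + \<alpha> w"
    if "z \<in> generate_field complex_ring images" "w \<in> generate_field complex_ring images" for z w
    using ring_hom_add[OF hom, of z w] that by (simp add: splitting_field_images)
  have zK: "0 \<in> generate_field complex_ring images"
    using generate_field.eng_add[OF K[of 1] K[of 3]] by (simp add: val[unfolded One_nat_def] val)
  have a0: "\<alpha> 0 = 0" using add[OF zK zK] by simp
  have opp: "eR (\<pi> i) (bR 2) + eR (\<pi> j) (bR 2) = 0"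
    if "i \<in> {1..4}" "j \<in> {1..4}" "eR i (bR 2) + eR j (bR 2) = 0" for i j
    using \<alpha>(2) b2 that add[OF K K, of i j] a0 by simp
  have p13: "eR (\<pi> 1) (bR 2) + eR (\<pi> 3) (bR 2) = 0" by (rule opp) (simp_all add: val[unfolded One_nat_def] val)
  have p24: "eR (\<pi> 2) (bR 2) + eR (\<pi> 4) (bR 2) = 0" by (rule opp) (simp_all add: val)
  have mem: "\<pi> i \<in> {1..4}" if "i \<in> {1..4}" for i using permutes_in_image[OF \<pi>] that by simp
  have mem': "\<pi> i = 1 \<or> \<pi> i = 2 \<or> \<pi> i = 3 \<or> \<pi> i = 4" if "i \<in> {1..4}" for i
    using mem[OF that] unfolding range_14 .
  have inj: "\<pi> i \<noteq> \<pi> j" if "i \<noteq> j" for i j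
    using permutes_inj[OF \<pi>] that by (auto simp: inj_def)
  have u: "complex_of_real u \<noteq> 0" using u_pos by simp
  have opposite: "(i = 1 \<and> j = 3) \<or> (i = 3 \<and> j = 1) \<or> (i = 2 \<and> j = 4) \<or> (i = 4 \<and> j = 2)"
    if "i \<in> {1..4}" "j \<in> {1..4}" "eR i (bR 2) + eR j (bR 2) = 0" for i j :: nat
    using that u unfolding range_14 by (elim disjE) (simp_all add: val val[unfolded One_nat_def] complex_eq_iff)
  have o13: "(\<pi> 1 = 1 \<and> \<pi> 3 = 3) \<or> (\<pi> 1 = 3 \<and> \<pi> 3 = 1) \<or> (\<pi> 1 = 2 \<and> \<pi> 3 = 4) \<or> (\<pi> 1 = 4 \<and> \<pi> 3 = 2)"
    by (rule opposite[OF mem mem p13]) simp_all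
  have o24: "(\<pi> 2 = 1 \<and> \<pi> 4 = 3) \<or> (\<pi> 2 = 3 \<and> \<pi> 4 = 1) \<or> (\<pi> 2 = 2 \<and> \<pi> 4 = 4) \<or> (\<pi> 2 = 4 \<and> \<pi> 4 = 2)"
    by (rule opposite[OF mem mem p24]) simp_all
  have n12: "\<pi> 1 \<noteq> \<pi> 2" and n14: "\<pi> 1 \<noteq> \<pi> 4" using inj by auto
  define r t where "r = r4" and "t = t13"
  have rt: "r permutes {1..4}" "t permutes {1..4}" "r \<in> D4" "t \<in> D4"
    using r4_permutes t13_permutes D4_gens by (simp_all only: r_def t_def)
  have val_rt: "r (Suc 0) = 2" "r 2 = 3" "r 3 = 4" "r 4 = Suc 0"
    "t (Suc 0) = 3" "t 2 = 2" "t 3 = Suc 0" "t 4 = 4"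
    by (simp_all add: r_def t_def Transposition.transpose_def)
  have fin: "\<pi> \<in> D4" if "\<rho> \<in> D4" "\<rho> permutes {1..4}" "\<pi> 1 = \<rho> 1" "\<pi> 2 = \<rho> 2" "\<pi> 3 = \<rho> 3" "\<pi> 4 = \<rho> 4" for \<rho>
    using permutes_14_eqI[OF \<pi> that(2-6)] that(1) by simp
  note D = D4_gens(3) D4_comp permutes_compose rt rt[unfolded One_nat_def] permutes_id
  \<comment> \<open>Exactly eight permutations carry opposite pairs to opposite pairs, and each is a
    word in the rotation r and the reflection t.\<close>
  from o13 o24 n12 n14 consider
      "\<pi> 1 = 1" "\<pi> 2 = 2" "\<pi> 3 = 3" "\<pi> 4 = 4" | "\<pi> 1 = 1" "\<pi> 2 = 4" "\<pi> 3 = 3" "\<pi> 4 = 2"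
    | "\<pi> 1 = 3" "\<pi> 2 = 2" "\<pi> 3 = 1" "\<pi> 4 = 4" | "\<pi> 1 = 3" "\<pi> 2 = 4" "\<pi> 3 = 1" "\<pi> 4 = 2"
    | "\<pi> 1 = 2" "\<pi> 2 = 1" "\<pi> 3 = 4" "\<pi> 4 = 3" | "\<pi> 1 = 2" "\<pi> 2 = 3" "\<pi> 3 = 4" "\<pi> 4 = 1"
    | "\<pi> 1 = 4" "\<pi> 2 = 1" "\<pi> 3 = 2" "\<pi> 4 = 3" | "\<pi> 1 = 4" "\<pi> 2 = 3" "\<pi> 3 = 2" "\<pi> 4 = 1"
    by (elim disjE conjE) simp_all
  then show "\<pi> \<in> D4"
  proof cases
    case 1 then show ?thesis by (intro fin[of id]) (auto intro: D)
  next
    case 2 then show ?thesis by (intro fin[of "r \<circ> (r \<circ> t)"]) (auto intro: D simp: val_rt)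
  next
    case 3 then show ?thesis by (intro fin[of t]) (auto intro: D simp: val_rt)
  next
    case 4 then show ?thesis by (intro fin[of "r \<circ> r"]) (auto intro: D simp: val_rt)
  next
    case 5 then show ?thesis by (intro fin[of "r \<circ> (r \<circ> (r \<circ> t))"]) (auto intro: D simp: val_rt)
  next
    case 6 then show ?thesis by (intro fin[of r]) (auto intro: D simp: val_rt)
  next
    case 7 then show ?thesis by (intro fin[of "r \<circ> (r \<circ> r)"]) (auto intro: D simp: val_rt)
  next
    case 8 then show ?thesis by (intro fin[of "r \<circ> t"]) (auto intro: D simp: val_rt)
  qed
qed

lemma G_ring_R: "G_ring 4 D4 R"
  unfolding G_ring_def using eR_numbering D4_le_galois galois_le_D4 by blast

end


section \<open>The cubic resolvents of the family\<close>

lemma pairings_of_four: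
  fixes k1 k2 k3 k4 :: nat
  assumes "k1 < 4" "k2 < 4" "k3 < 4" "k4 < 4"
    "k1 \<noteq> k2" "k1 \<noteq> k3" "k1 \<noteq> k4" "k2 \<noteq> k3" "k2 \<noteq> k4" "k3 \<noteq> k4"
  shows "({k1, k2}, {k3, k4}) \<in> {({0, 2}, {1, 3}), ({1, 3}, {0, 2}), ({0, 1}, {2, 3}), ({2, 3}, {0, 1}),
    ({0, 3}, {1, 2}), ({1, 2}, {0, 3})}"
  using assms unfolding less_4
  by (elim disjE) (simp_all add: doubleton_eq_iff)

context dihedral_family begin

interpretation R: small_split R 4 sR bR by (rule small_split_R)
interpretation C: small_split C 3 sC bC by (rule small_split_C)

text \<open>The order follows the homomorphisms \<open>sC\<close>: index 0 pairs opposite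
  embeddings, a splitting fixed by the four-cycle, and so belongs to the rational factor of C. In
  \<open>pairing\<close> this splitting has index 1.\<close>

definition pair_sum :: "nat \<Rightarrow> nat \<Rightarrow> complex" where
  "pair_sum p x = (if p = 0 then sR 0 x * sR 2 x + sR 1 x * sR 3 x
     else if p = 1 then sR 0 x * sR 1 x + sR 2 x * sR 3 x
     else sR 0 x * sR 3 x + sR 1 x * sR 2 x)"

text \<open>Bhargava's quadratic map in coordinates: the coefficient of \<omega> is the second of
  the two ternary forms, that of \<theta> is minus the first, and the coefficient of 1 adjusts the
  lift from the quotient by the integers.\<close>

definition resolvent_map :: "int4 \<Rightarrow> int3" where
  "resolvent_map w = (case w of (x0, x1, x2, x3) \<Rightarrow>
     (b * x2\<^sup>2 - c * x3\<^sup>2, 2 * x0\<^sup>2 - 2 * a\<^sup>2 * b * c * x1\<^sup>2, - (a * x1\<^sup>2 - n * x2 * x3)))"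

lemma pair_sum_resolvent:
  assumes "p < 3"
  shows "pair_sum p (to_nat w) = sC p (to_nat (resolvent_map w))"
proof -
  obtain x0 x1 x2 x3 where w: "w = (x0, x1, x2, x3)" by (cases w)
  define X0 X1 X2 X3 where "X0 = complex_of_int x0" and "X1 = complex_of_int x1"
    and "X2 = complex_of_int x2" and "X3 = complex_of_int x3"
  define A B N K where "A = complex_of_int a" and "B = complex_of_int b"
    and "N = complex_of_int n" and "K = complex_of_int c"
  define S U V where "S = complex_of_real s" and "U = complex_of_real u" and "V = complex_of_real v"
  note defs = X0_def X1_def X2_def X3_def A_def S_def U_def V_def
  have 0: "sR 0 (to_nat w) = X0 + X1 * (A * S) + (X2 * U + X3 * V)"
    by (simp add: w sR_apply defs)
  have 1: "sR 1 (to_nat w) = X0 - X1 * (A * S) + \<i> * (X2 * U - X3 * V)"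
    unfolding w sR_apply by (simp add: defs algebra_simps)
  have 2: "sR 2 (to_nat w) = X0 + X1 * (A * S) - (X2 * U + X3 * V)"
    unfolding w sR_apply i_powers by (simp add: defs)
  have 3: "sR 3 (to_nat w) = X0 - X1 * (A * S) - \<i> * (X2 * U - X3 * V)"
    unfolding w sR_apply i_powers by (simp add: defs algebra_simps)
  have SS: "S * S = B * K"
  proof -
    have "S * S = complex_of_real (s * s)" by (simp add: S_def)
    then show ?thesis unfolding s_sq by (simp add: B_def K_def)
  qed
  have UU: "U * U = N * A * B * S"
  proof -
    have "U * U = complex_of_real (u * u)" by (simp add: U_def)
    then show ?thesis unfolding u_sq by (simp add: A_def B_def N_def S_def)
  qed
  have VV: "V * V = N * A * K * S"
  proof -
    have "V * V = complex_of_real (v * v)" by (simp add: V_def)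
    then show ?thesis unfolding v_sq by (simp add: A_def K_def N_def S_def)
  qed
  have UV: "U * V = N * A * B * K"
  proof -
    have "U * V = complex_of_real (u * v)" by (simp add: U_def V_def)
    then show ?thesis unfolding uv by (simp add: A_def B_def K_def N_def)
  qed
  \<comment> \<open>The four embeddings have the shape Z + p, Z' + \<i> q, Z - p, Z' - \<i> q, where
    p and q collect the terms in u and v. In these variables the three pairings are short
    identities.\<close>
  have q0: "(Z + p) * (Z - p) + (Z' + \<i> * q) * (Z' - \<i> * q) = Z * Z - p * p + Z' * Z' + q * q" for Z p Z' q
    by (simp add: algebra_simps)
  have q1: "(Z + p) * (Z' + \<i> * q) + (Z - p) * (Z' - \<i> * q) = 2 * Z * Z' + 2 * \<i> * (p * q)" for Z p Z' q
    by (simp add: algebra_simps)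
  have q2: "(Z + p) * (Z' - \<i> * q) + (Z' + \<i> * q) * (Z - p) = 2 * Z * Z' - 2 * \<i> * (p * q)" for Z p Z' q
    by (simp add: algebra_simps)
  have ZZ: "(X0 + X1 * (A * S)) * (X0 - X1 * (A * S)) = X0 * X0 - X1 * X1 * A * A * (S * S)"
    by (simp add: algebra_simps)
  have pq: "(X2 * U + X3 * V) * (X2 * U - X3 * V) = X2 * X2 * (U * U) - X3 * X3 * (V * V)"
    by (simp add: algebra_simps)
  have sum0: "(X0 + X1 * (A * S)) * (X0 + X1 * (A * S)) - (X2 * U + X3 * V) * (X2 * U + X3 * V)
      + (X0 - X1 * (A * S)) * (X0 - X1 * (A * S)) + (X2 * U - X3 * V) * (X2 * U - X3 * V) =
      2 * X0 * X0 + 2 * X1 * X1 * A * A * (S * S) - 4 * X2 * X3 * (U * V)"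
    by (simp add: algebra_simps)
  have rm: "sC p (to_nat (resolvent_map w)) =
      (2 * X0 * X0 - 2 * A * A * B * K * X1 * X1) + (- (A * X1 * X1 - N * X2 * X3)) * (if p = 0 then - 4 * A * B * K else 0)
      + (B * X2 * X2 - K * X3 * X3) * (if p = 0 then 0 else if p = 1 then 2 * \<i> * N * A * S else - 2 * \<i> * N * A * S)" for p
    unfolding w resolvent_map_def prod.case sC_apply
    by (simp add: X0_def X1_def X2_def X3_def A_def B_def N_def K_def S_def power2_eq_square algebra_simps)
  have "p = 0 \<or> p = 1 \<or> p = 2" using assms by auto
  then show ?thesis
  proof (elim disjE)
    assume p: "p = 0"
    have "pair_sum p (to_nat w) = 2 * X0 * X0 + 2 * X1 * X1 * A * A * (S * S) - 4 * X2 * X3 * (U * V)"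
      unfolding p pair_sum_def 0 1 2 3 using q0 sum0 by simp
    then show ?thesis unfolding rm SS UV p by (simp add: algebra_simps)
  next
    assume p: "p = 1"
    have "pair_sum p (to_nat w) = 2 * (X0 * X0 - X1 * X1 * A * A * (S * S)) + 2 * \<i> * (X2 * X2 * (U * U) - X3 * X3 * (V * V))"
      unfolding p pair_sum_def 0 1 2 3 using q1[of "X0 + X1 * (A * S)" "X2 * U + X3 * V" "X0 - X1 * (A * S)" "X2 * U - X3 * V"]
      by (simp only: ZZ[symmetric] pq[symmetric]) simp
    then show ?thesis unfolding rm SS UU VV p by (simp add: algebra_simps)
  next
    assume p: "p = 2"
    have "pair_sum p (to_nat w) = 2 * (X0 * X0 - X1 * X1 * A * A * (S * S)) - 2 * \<i> * (X2 * X2 * (U * U) - X3 * X3 * (V * V))"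
      unfolding p pair_sum_def 0 1 2 3 using q2[of "X0 + X1 * (A * S)" "X2 * U + X3 * V" "X0 - X1 * (A * S)" "X2 * U - X3 * V"]
      by (simp only: ZZ[symmetric] pq[symmetric]) simp
    then show ?thesis unfolding rm SS UU VV p by (simp add: algebra_simps)
  qed
qed

lemma numbering_pair_sum:
  assumes e: "e \<in> numberings 4 R"
  shows "\<exists>p<3. \<forall>x. phi43 R x e = pair_sum p x"
proof -
  have bij: "bij_betw e {1..4} (sR ` {..<4})" using e by (simp add: numberings_def R.complex_homs_eq)
  have "\<exists>k<4. e i = sR k" if "i \<in> {1..4}" for i
    using bij_betwE[OF bij] that by blast
  then obtain k where k: "\<And>i. i \<in> {1..4} \<Longrightarrow> k i < 4" "\<And>i. i \<in> {1..4} \<Longrightarrow> e i = sR (k i)" by metis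
  have ne: "k i \<noteq> k j" if "i \<in> {1..4}" "j \<in> {1..4}" "i \<noteq> j" for i j
    using bij k(2) that unfolding bij_betw_def inj_on_def by metis
  have "({k 1, k 2}, {k 3, k 4}) \<in> {({0, 2}, {1, 3}), ({1, 3}, {0, 2}), ({0, 1}, {2, 3}), ({2, 3}, {0, 1}),
    ({0, 3}, {1, 2}), ({1, 2}, {0, 3})}"
    by (rule pairings_of_four) (rule k(1) ne; simp)+
  then consider (a) "{k 1, k 2} = {0, 2}" "{k 3, k 4} = {1, 3}" | (b) "{k 1, k 2} = {1, 3}" "{k 3, k 4} = {0, 2}"
    | (c) "{k 1, k 2} = {0, 1}" "{k 3, k 4} = {2, 3}" | (d) "{k 1, k 2} = {2, 3}" "{k 3, k 4} = {0, 1}"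
    | (e) "{k 1, k 2} = {0, 3}" "{k 3, k 4} = {1, 2}" | (f) "{k 1, k 2} = {1, 2}" "{k 3, k 4} = {0, 3}"
    unfolding insert_iff prod.inject empty_iff by (elim disjE conjE FalseE)
  moreover have prod: "sR i x * sR j x = sR i' x * sR j' x" if "{i, j} = {i', j'}" for i j i' j' x
    using that by (auto simp: doubleton_eq_iff mult.commute)
  have phi: "phi43 R x e = sR (k 1) x * sR (k 2) x + sR (k 3) x * sR (k 4) x" for x
    unfolding phi43_eval[OF e] using k(2)[of 1] k(2)[of 2] k(2)[of 3] k(2)[of 4] by simp
  have sum: "phi43 R x e = sR i x * sR j x + sR i' x * sR j' x"
    if "{k 1, k 2} = {i, j}" "{k 3, k 4} = {i', j'}" for i j i' j' x
    unfolding phi using prod[OF that(1)] prod[OF that(2)] by simp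
  ultimately show ?thesis
  proof cases
    case a then show ?thesis by (intro exI[of _ 0]) (simp add: sum[OF a] pair_sum_def)
  next
    case b then show ?thesis by (intro exI[of _ 0]) (simp add: sum[OF b] pair_sum_def)
  next
    case c then show ?thesis by (intro exI[of _ 1]) (simp add: sum[OF c] pair_sum_def)
  next
    case d then show ?thesis by (intro exI[of _ 1]) (simp add: sum[OF d] pair_sum_def)
  next
    case e then show ?thesis by (intro exI[of _ 2]) (simp add: sum[OF e] pair_sum_def)
  next
    case f then show ?thesis by (intro exI[of _ 2]) (simp add: sum[OF f] pair_sum_def)
  qed
qed

definition pairing_index :: "(nat \<Rightarrow> nat \<Rightarrow> complex) \<Rightarrow> nat" where
  "pairing_index e = (SOME p. p < 3 \<and> (\<forall>x. phi43 R x e = pair_sum p x))"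

lemma pairing_index:
  assumes "e \<in> numberings 4 R"
  shows "pairing_index e < 3" "phi43 R x e = pair_sum (pairing_index e) x"
proof -
  have "pairing_index e < 3 \<and> (\<forall>x. phi43 R x e = pair_sum (pairing_index e) x)"
    unfolding pairing_index_def by (rule someI_ex) (use numbering_pair_sum[OF assms] in blast)
  then show "pairing_index e < 3" "phi43 R x e = pair_sum (pairing_index e) x" by auto
qed

text \<open>The value of the resolvent map at \<alpha>2 is b \<omega>, on which the three
  homomorphisms of C take different values. Hence \<open>pairing_index\<close> is determined by the
  values of \<open>phi43\<close>.\<close>

lemma pair_sum_distinct:
  assumes "p < 3" "q < 3" "pair_sum p (bR 2) = pair_sum q (bR 2)"
  shows "p = q"
proof -
  have b2: "bR 2 = to_nat ((0, 0, 1, 0) :: int4)" by (simp add: bR_def)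
  have v: "pair_sum p (bR 2) = of_int b * (if p = 0 then 0 else if p = 1 then 2 * \<i> * n * a * s else - 2 * \<i> * n * a * s)"
    if "p < 3" for p
    unfolding b2 pair_sum_resolvent[OF that] by (simp add: resolvent_map_def sC_apply)
  have "p = 0 \<or> p = 1 \<or> p = 2" "q = 0 \<or> q = 1 \<or> q = 2" using assms by auto
  then show ?thesis using assms(3) pos s_pos unfolding v[OF assms(1)] v[OF assms(2)]
    by (elim disjE) (simp_all add: complex_eq_iff)
qed

text \<open>The renumberings already realise all three splittings, with indices 0 and 1 interchanged
  between \<open>pairing\<close> and \<open>pair_sum\<close>. This is what makes
  \<open>to_closure\<close> injective.\<close>

lemma pairing_index_surj:
  assumes "p < 3"
  shows "\<exists>e\<in>numberings 4 R. pairing_index e = p"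
proof -
  have gal: "galois_perms 4 R eR = D4" using D4_le_galois galois_le_D4 by blast
  interpret d: D4_quartic R eR bR
    by (intro D4_quartic.intro D4_quartic_axioms.intro cring_R basis_R eR_numbering gal)
  have ex: "\<exists>q. \<forall>x. phi43 R x (d.renum q) = pair_sum p x"
  proof -
    have "p = 0 \<or> p = 1 \<or> p = 2" using assms by auto
    then show ?thesis
    proof (elim disjE)
      assume "p = 0" then show ?thesis
        by (intro exI[of _ 1]) (simp add: d.phi43_renum d.pairing_def pair_sum_def eR_simps eR_simps[unfolded One_nat_def])
    next
      assume "p = 1" then show ?thesis
        by (intro exI[of _ 0]) (simp add: d.phi43_renum d.pairing_def pair_sum_def eR_simps eR_simps[unfolded One_nat_def])
    next
      assume "p = 2" then show ?thesis
        by (intro exI[of _ 2]) (simp add: d.phi43_renum d.pairing_def pair_sum_def eR_simps eR_simps[unfolded One_nat_def])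
    qed
  qed
  then obtain q where q: "\<And>x. phi43 R x (d.renum q) = pair_sum p x" by blast
  have "pairing_index (d.renum q) = p"
    using pair_sum_distinct[OF pairing_index(1)[OF d.renum_numbering] assms] pairing_index(2)[OF d.renum_numbering] q
    by metis
  then show ?thesis using d.renum_numbering by blast
qed

text \<open>Realises C inside the closure ring, as functions depending only on the splitting that a
  numbering induces. The embedding asked of a resolvent is its inverse on the invariant
  ring.\<close>

definition to_closure :: "nat \<Rightarrow> (nat \<Rightarrow> nat \<Rightarrow> complex) \<Rightarrow> complex" where
  "to_closure x = (\<lambda>e\<in>numberings 4 R. sC (pairing_index e) x)"

lemma to_closure_hom: "to_closure \<in> Ring.ring_hom C (closure_ring 4 R)"
proof (rule ring_hom_memI)
  have h: "sC (pairing_index e) \<in> Ring.ring_hom C complex_ring" if "e \<in> numberings 4 R" for e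
    by (rule C.hom[OF pairing_index(1)[OF that]])
  fix x y assume xy: "x \<in> carrier C" "y \<in> carrier C"
  show "to_closure (x \<otimes>\<^bsub>C\<^esub> y) = to_closure x \<otimes>\<^bsub>closure_ring 4 R\<^esub> to_closure y"
    by (auto simp: to_closure_def closure_ring_def fun_eq_iff C.chom_mult[OF h xy])
  show "to_closure (x \<oplus>\<^bsub>C\<^esub> y) = to_closure x \<oplus>\<^bsub>closure_ring 4 R\<^esub> to_closure y"
    by (auto simp: to_closure_def closure_ring_def fun_eq_iff C.chom_add[OF h xy])
  show "to_closure x \<in> carrier (closure_ring 4 R)" by (simp add: to_closure_def closure_ring_def)
next
  have h: "sC (pairing_index e) \<in> Ring.ring_hom C complex_ring" if "e \<in> numberings 4 R" for e
    by (rule C.hom[OF pairing_index(1)[OF that]])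
  show "to_closure \<one>\<^bsub>C\<^esub> = \<one>\<^bsub>closure_ring 4 R\<^esub>"
    by (auto simp: to_closure_def closure_ring_def fun_eq_iff C.chom_one[OF h])
qed

lemma to_closure_inj: "inj_on to_closure (carrier C)"
proof (rule inj_onI)
  fix x y assume xy: "x \<in> carrier C" "y \<in> carrier C" "to_closure x = to_closure y"
  show "x = y"
  proof (rule C.eq_if_homs_eq[OF xy(1,2)])
    fix p :: nat assume "p < 3"
    then obtain e where e: "e \<in> numberings 4 R" "pairing_index e = p" using pairing_index_surj by blast
    show "sC p x = sC p y" using fun_cong[OF xy(3), of e] e by (simp add: to_closure_def)
  qed
qed

text \<open>Each generator \<open>phi43 R x\<close> is the image of a value of the resolvent map,
  and the image of C is closed under the ring operations.\<close>

lemma invariant_ring_le: "carrier (cubic_invariant_ring R) \<subseteq> to_closure ` carrier C"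
proof
  interpret j: ring_hom_cring C "closure_ring 4 R" to_closure
    using to_closure_hom cring_C closure_ring_cring by (simp add: ring_hom_cring_def ring_hom_cring_axioms_def)
  fix f assume "f \<in> carrier (cubic_invariant_ring R)"
  then have "f \<in> generate_ring (closure_ring 4 R) (phi43 R ` carrier R)"
    by (simp add: cubic_invariant_ring_def)
  then show "f \<in> to_closure ` carrier C"
  proof (induction rule: generate_ring.induct)
    case one
    then show ?case using j.hom_one C.one_closed by (metis imageI)
  next
    case (incl f)
    then obtain w :: int4 where w: "f = phi43 R (to_nat w)" unfolding carrier_R by blast
    have "f = to_closure (to_nat (resolvent_map w))"
    proof
      fix e
      show "f e = to_closure (to_nat (resolvent_map w)) e"
      proof (cases "e \<in> numberings 4 R")
        case True
        then show ?thesis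
          using pairing_index[OF True] by (simp add: w to_closure_def pair_sum_resolvent)
      next
        case False
        then show ?thesis by (simp add: w to_closure_def phi43_def closure_ring_def)
      qed
    qed
    then show ?case by (simp add: carrier_C)
  next
    case (a_inv f)
    then obtain x where x: "x \<in> carrier C" "f = to_closure x" by blast
    then have "\<ominus>\<^bsub>closure_ring 4 R\<^esub> f = to_closure (\<ominus>\<^bsub>C\<^esub> x)" by simp
    then show ?case using C.a_inv_closed[OF x(1)] by (rule image_eqI)
  next
    case (eng_add f g)
    then obtain x y where x: "x \<in> carrier C" "f = to_closure x" and y: "y \<in> carrier C" "g = to_closure y" by blast
    then have "f \<oplus>\<^bsub>closure_ring 4 R\<^esub> g = to_closure (x \<oplus>\<^bsub>C\<^esub> y)" by simp
    then show ?case using C.a_closed[OF x(1) y(1)] by (rule image_eqI)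
  next
    case (eng_mult f g)
    then obtain x y where x: "x \<in> carrier C" "f = to_closure x" and y: "y \<in> carrier C" "g = to_closure y" by blast
    then have "f \<otimes>\<^bsub>closure_ring 4 R\<^esub> g = to_closure (x \<otimes>\<^bsub>C\<^esub> y)" by simp
    then show ?case using C.m_closed[OF x(1) y(1)] by (rule image_eqI)
  qed
qed

lemma cubic_resolvent_C: "cubic_resolvent R C"
proof -
  let ?A = "cubic_invariant_ring R"
  let ?\<iota> = "inv_into (carrier C) to_closure"
  note le = invariant_ring_le
  interpret C: cring C by (rule cring_C)
  have in_C: "?\<iota> f \<in> carrier C" "to_closure (?\<iota> f) = f" if "f \<in> carrier ?A" for f
    using le that by (auto intro: inv_into_into f_inv_into_f)
  have "?\<iota> \<in> Ring.ring_hom ?A C"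
  proof (rule ring_hom_memI)
    fix f g assume fg: "f \<in> carrier ?A" "g \<in> carrier ?A"
    have "to_closure (?\<iota> f \<otimes>\<^bsub>C\<^esub> ?\<iota> g) = f \<otimes>\<^bsub>?A\<^esub> g"
      using ring_hom_mult[OF to_closure_hom in_C(1)[OF fg(1)] in_C(1)[OF fg(2)]] in_C(2) fg
      by (simp add: cubic_invariant_ring_def)
    then show "?\<iota> (f \<otimes>\<^bsub>?A\<^esub> g) = ?\<iota> f \<otimes>\<^bsub>C\<^esub> ?\<iota> g"
      using in_C(1) fg by (metis C.m_closed inv_into_f_f to_closure_inj)
    have "to_closure (?\<iota> f \<oplus>\<^bsub>C\<^esub> ?\<iota> g) = f \<oplus>\<^bsub>?A\<^esub> g"
      using ring_hom_add[OF to_closure_hom in_C(1)[OF fg(1)] in_C(1)[OF fg(2)]] in_C(2) fg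
      by (simp add: cubic_invariant_ring_def)
    then show "?\<iota> (f \<oplus>\<^bsub>?A\<^esub> g) = ?\<iota> f \<oplus>\<^bsub>C\<^esub> ?\<iota> g"
      using in_C(1) fg by (metis C.a_closed inv_into_f_f to_closure_inj)
  next
    have "to_closure \<one>\<^bsub>C\<^esub> = \<one>\<^bsub>?A\<^esub>"
      using ring_hom_one[OF to_closure_hom] by (simp add: cubic_invariant_ring_def)
    then show "?\<iota> \<one>\<^bsub>?A\<^esub> = \<one>\<^bsub>C\<^esub>" by (metis C.one_closed inv_into_f_f to_closure_inj)
  qed (use in_C in auto)
  moreover have "inj_on ?\<iota> (carrier ?A)" using le by (rule inj_on_inv_into)
  moreover have "rank_ring 3 C" using cring_C basis_C by (auto simp: rank_ring_def)
  ultimately show ?thesis by (auto simp: cubic_resolvent_def disc_R disc_C)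
qed

end


section \<open>Successive minima of the family\<close>

context dihedral_family begin

interpretation R: small_split R 4 sR bR by (rule small_split_R)
interpretation C: small_split C 3 sC bC by (rule small_split_C)

text \<open>All four conjugates of a basis element have the same modulus, so its length is that
  modulus.\<close>

lemma len_bR: "R.len (bR 0) = 1" "R.len (bR 1) = a * s" "R.len (bR 2) = u" "R.len (bR 3) = v"
proof -
  have sq: "R.len x = r" if "\<And>i. i < 4 \<Longrightarrow> cmod (sR i x) = r" "0 \<le> r" for x r
    unfolding R.ring_length_eq using that by simp
  show "R.len (bR 0) = 1" by (rule sq) (simp_all add: sR_bR)
  show "R.len (bR 1) = a * s"
    unfolding One_nat_def
    using pos s_pos by (intro sq) (simp_all add: sR_bR[unfolded One_nat_def] norm_mult norm_power)
  show "R.len (bR 2) = u" using u_pos by (intro sq) (simp_all add: sR_bR norm_mult norm_power)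
  show "R.len (bR 3) = v" using v_pos by (intro sq) (simp_all add: sR_bR norm_mult norm_power)
qed

lemma len_bC: "C.len (bC 1) = 1" "C.len (bC 2) \<le> 4 * a * b * c" "C.len (bC 0) \<le> 2 * a * n * s"
proof -
  have sq: "C.len x \<le> r" if "\<And>i. i < 3 \<Longrightarrow> cmod (sC i x) \<le> r" "0 \<le> r" for x r
  proof (rule power2_le_imp_le)
    have "3 * (C.len x)\<^sup>2 \<le> (\<Sum>i<(3::nat). r\<^sup>2)"
      unfolding C.len_sq[simplified] using that by (intro sum_mono power_mono) auto
    then show "(C.len x)\<^sup>2 \<le> r\<^sup>2" by simp
  qed (rule that)
  have "bC 1 = \<one>\<^bsub>C\<^esub>" by (simp add: bC_def C_def nat_ring_def)
  then show "C.len (bC 1) = 1" by (simp only: C.len_one)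
  show "C.len (bC 2) \<le> 4 * a * b * c"
    using pos by (intro sq) (auto simp: bC_def sC_apply norm_mult)
  show "C.len (bC 0) \<le> 2 * a * n * s"
    using pos s_pos by (intro sq) (auto simp: bC_def sC_apply norm_mult)
qed

lemma abs_disc_R: "real_of_int \<bar>ring_disc 4 R\<bar> = (16 * a\<^sup>2 * n * b * c * s)\<^sup>2"
proof -
  have "\<bar>ring_disc 4 R\<bar> = 256 * a ^ 4 * n\<^sup>2 * b ^ 3 * c ^ 3"
    unfolding disc_R using pos by (simp add: abs_mult)
  then have "real_of_int \<bar>ring_disc 4 R\<bar> = 256 * a ^ 4 * n\<^sup>2 * b\<^sup>2 * c\<^sup>2 * (b * c)"
    by (simp add: power2_eq_square power3_eq_cube)
  also have "\<dots> = 256 * a ^ 4 * n\<^sup>2 * b\<^sup>2 * c\<^sup>2 * (s * s)" by (simp only: s_sq of_int_mult)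
  also have "\<dots> = (16 * a\<^sup>2 * n * b * c * s)\<^sup>2"
    by (simp add: power2_eq_square power4_eq_xxxx)
  finally show ?thesis .
qed

text \<open>The product of the basis lengths is 1/16 of the root of the discriminant, hence at most
  4 = 64/16 times the product of the minima. As no minimum exceeds its basis length, the factor 4
  bounds each one separately.\<close>

lemma succ_min_R:
  assumes order: "1 \<le> a * s" "a * s \<le> u" "u \<le> v"
  shows "succ_min 4 R 1 \<le> a * s" "succ_min 4 R 2 \<le> u" "succ_min 4 R 3 \<le> v"
    "a * s \<le> 4 * succ_min 4 R 1" "u \<le> 4 * succ_min 4 R 2" "v \<le> 4 * succ_min 4 R 3"
proof -
  let ?l = "succ_min 4 R"
  have ind: "int_indep R (Suc i) bR" if "i < 4" for i
    by (rule R.int_indep_initial[OF R.basis_indep]) (use that in simp)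
  note len = len_bR len_bR[unfolded One_nat_def]
  show 1: "?l 1 \<le> a * s"
  proof (rule R.succ_min_le[OF ind])
    fix j :: nat assume "j \<le> 1"
    then have "j = 0 \<or> j = 1" by auto
    then show "R.len (bR j) \<le> a * s" using order by (elim disjE) (simp_all add: len)
  qed simp_all
  show 2: "?l 2 \<le> u"
  proof (rule R.succ_min_le[OF ind])
    fix j :: nat assume "j \<le> 2"
    then have "j = 0 \<or> j = 1 \<or> j = 2" by auto
    then show "R.len (bR j) \<le> u" using order by (elim disjE) (simp_all add: len)
  qed simp_all
  show 3: "?l 3 \<le> v"
  proof (rule R.succ_min_le[OF ind])
    fix j :: nat assume "j \<le> 3"
    then have "j = 0 \<or> j = 1 \<or> j = 2 \<or> j = 3" by auto
    then show "R.len (bR j) \<le> v" using order by (elim disjE) (simp_all add: len)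
  qed simp_all
  note q = quartic_minima_bounds[OF small_split_R]
  have pos': "0 < ?l 1" "0 < ?l 2" "0 < ?l 3" using q(2,3,4) by linarith+
  have "sqrt (real_of_int \<bar>ring_disc 4 R\<bar>) = 16 * a\<^sup>2 * n * b * c * s"
    unfolding abs_disc_R using pos s_pos by (simp add: real_sqrt_abs)
  also have "\<dots> = 16 * ((a * s) * (u * v))" by (simp add: uv power2_eq_square)
  finally have P: "(a * s) * (u * v) \<le> 4 * (?l 1 * ?l 2 * ?l 3)" using q(6) by simp
  have as: "0 < a * s" using order by linarith
  have "(a * s) * (u * v) \<le> 4 * ?l 1 * (u * v)"
  proof -
    have "?l 2 * ?l 3 \<le> u * v" using 2 3 pos' u_pos by (intro mult_mono) auto
    then have "?l 1 * (?l 2 * ?l 3) \<le> ?l 1 * (u * v)" using pos' by (intro mult_left_mono) auto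
    then show ?thesis using P by (simp add: mult.assoc)
  qed
  then show "a * s \<le> 4 * ?l 1" using u_pos v_pos by (simp add: mult_le_cancel_right)
  have "u * ((a * s) * v) \<le> 4 * ?l 2 * ((a * s) * v)"
  proof -
    have "?l 1 * ?l 3 \<le> (a * s) * v" using 1 3 pos' as by (intro mult_mono) auto
    then have "?l 2 * (?l 1 * ?l 3) \<le> ?l 2 * ((a * s) * v)" using pos' by (intro mult_left_mono) auto
    then show ?thesis using P by (simp add: mult_ac)
  qed
  then show "u \<le> 4 * ?l 2" using mult_pos_pos[OF as v_pos] by (subst (asm) mult_le_cancel_right_pos) auto
  have "v * ((a * s) * u) \<le> 4 * ?l 3 * ((a * s) * u)"
  proof -
    have "?l 1 * ?l 2 \<le> (a * s) * u" using 1 2 pos' as by (intro mult_mono) auto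
    then have "?l 3 * (?l 1 * ?l 2) \<le> ?l 3 * ((a * s) * u)" using pos' by (intro mult_left_mono) auto
    then show ?thesis using P by (simp add: mult_ac)
  qed
  then show "v \<le> 4 * ?l 3" using mult_pos_pos[OF as u_pos] by (subst (asm) mult_le_cancel_right_pos) auto
qed

text \<open>Comparison of products as for R: the root of the discriminant is twice the product of 4
  a b c and 2 a n s, which leaves 32 = 64/2. The function f reorders the basis as 1, \<theta>,
  \<omega>.\<close>

lemma succ_min_C:
  assumes order: "4 * a * b * c \<le> 2 * a * n * s"
  shows "succ_min 3 C 1 \<le> 4 * a * b * c" "succ_min 3 C 2 \<le> 2 * a * n * s"
    "4 * a * b * c \<le> 32 * succ_min 3 C 1" "2 * a * n * s \<le> 32 * succ_min 3 C 2"
proof -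
  let ?m = "succ_min 3 C" and ?M = "real_of_int (4 * a * b * c)" and ?W = "2 * a * n * s"
  define f where "f j = (if j = 0 then bC 1 else if j = 1 then bC 2 else bC 0)" for j :: nat
  have S: "(\<Sum>j<3. g j) = g 0 + g 1 + g 2" for g :: "nat \<Rightarrow> complex"
    by (simp add: eval_nat_numeral)
  have ind: "int_indep C 3 f"
    unfolding C.int_indep_iff
  proof (intro conjI allI impI)
    show "f \<in> {..<3} \<rightarrow> carrier C" by (auto simp: f_def)
    fix m j assume m: "\<forall>i<3. (\<Sum>j<3. of_int (m j) * sC i (f j)) = 0" and j: "j < (3::nat)"
    let ?m' = "\<lambda>j. if j = 0 then m 2 else if j = 1 then m 0 else m 1 :: int"
    have z0: "(\<Sum>j<3. of_int (?m' j) * sC i (bC j)) = 0" if "i < 3" for i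
      using m[rule_format, OF that] unfolding S by (simp add: f_def add_ac)
    have z: "?m' l = 0" if "l < 3" for l :: nat
      by (rule C.int_indepD[OF C.basis_indep z0 that])
    from z[of 0] z[of 1] z[of 2] have "m 0 = 0" "m 1 = 0" "m 2 = 0" by simp_all
    then show "m j = 0" using j unfolding less_3 by auto
  qed
  have indi: "int_indep C (Suc i) f" if "i < 3" for i
    by (rule C.int_indep_initial[OF ind]) (use that in simp)
  have "0 < 4 * a * b * c" using pos by simp
  then have M1: "1 \<le> ?M" by linarith
  note len = len_bC len_bC[unfolded One_nat_def]
  have order': "?M \<le> ?W" using order by simp
  show 1: "?m 1 \<le> 4 * a * b * c"
  proof (rule C.succ_min_le[OF indi])
    fix j :: nat assume "j \<le> 1"
    then have "j = 0 \<or> j = 1" by auto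
    then show "C.len (f j) \<le> 4 * a * b * c" using M1 len by (elim disjE) (simp_all add: f_def)
  qed simp_all
  show 2: "?m 2 \<le> 2 * a * n * s"
  proof (rule C.succ_min_le[OF indi])
    fix j :: nat assume "j \<le> 2"
    then have "j = 0 \<or> j = 1 \<or> j = 2" by auto
    then show "C.len (f j) \<le> 2 * a * n * s"
      using M1 len order' by (elim disjE) (simp_all add: f_def)
  qed simp_all
  note q = cubic_minima_bounds[OF small_split_C]
  have pos': "0 < ?m 1" "0 < ?m 2" using q(1,2) by linarith+
  have "sqrt (real_of_int \<bar>ring_disc 3 C\<bar>) = 16 * a\<^sup>2 * n * b * c * s"
    unfolding disc_C disc_R[symmetric] abs_disc_R using pos s_pos by (simp add: real_sqrt_abs)
  also have "\<dots> = 2 * (?M * ?W)" by (simp add: power2_eq_square)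
  finally have P: "?M * ?W \<le> 32 * (?m 1 * ?m 2)" using q(4) by simp
  have MW: "0 < ?M" "0 < ?W" using M1 order' by linarith+
  have "?m 1 * ?m 2 \<le> ?m 1 * ?W" using 2 pos' by (intro mult_left_mono) auto
  then have "?M * ?W \<le> 32 * (?m 1 * ?W)" using P by linarith
  then have "?M * ?W \<le> (32 * ?m 1) * ?W" by (simp only: mult.assoc)
  then have "?M \<le> 32 * ?m 1" using MW(2) by (subst (asm) mult_le_cancel_right_pos)
  then show "4 * a * b * c \<le> 32 * ?m 1" by simp
  have "?m 1 * ?m 2 \<le> ?M * ?m 2" using 1 pos' by (intro mult_right_mono) auto
  then have "?M * ?W \<le> 32 * (?M * ?m 2)" using P by linarith
  then have "?W * ?M \<le> (32 * ?m 2) * ?M" by (simp only: mult_ac)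
  then show "2 * a * n * s \<le> 32 * ?m 2" using MW(1) by (subst (asm) mult_le_cancel_right_pos)
qed

end

section \<open>Approximating points of the region by the family\<close>

lemma log_2_close:
  fixes x y :: real
  assumes "0 < x" "x \<le> y" "y \<le> 32 * x"
  shows "\<bar>log 2 x - log 2 y\<bar> \<le> 5"
proof -
  have "log 2 x \<le> log 2 y" using assms by simp
  moreover have "log 2 y \<le> log 2 (32 * x)" using assms by simp
  moreover have "log 2 (32 * x) = 5 + log 2 x"
  proof -
    have "log 2 (2 ^ 5) = (5::real)" by (subst log_pow_cancel) auto
    then show ?thesis using assms by (simp add: log_mult)
  qed
  ultimately show ?thesis by linarith
qed

text \<open>The strict orderings leave gaps that rounded exponents cannot close, and the last two
  strict inequalities make the exponents of a and b positive before rounding.\<close>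

definition strict_region :: "(real \<times> real \<times> real \<times> real \<times> real) set" where
  "strict_region = {(p1, p2, p3, q1, q2). 0 \<le> p1 \<and> p1 < p2 \<and> p2 < p3 \<and> p1 + p2 + p3 = 1/2 \<and>
     0 \<le> q1 \<and> q1 < q2 \<and> q1 + q2 = 1/2 \<and> q1 < 2 * p1 \<and> q2 < 2 * p2}"

definition D4_points :: "(real \<times> real \<times> real \<times> real \<times> real) set" where
  "D4_points = {minima_point R C | (R :: nat ring) (C :: nat ring).
     nondegenerate 4 R \<and> G_ring 4 D4 R \<and> cubic_resolvent R C}"

text \<open>Oddness of B + E makes b c twice a square. The common denominator is the binary
  logarithm of the discriminant, and the five numbers approximated are those of a s, u, v, 4 a b c
  and 2 a n s.\<close>

lemma power_of_two_family:
  fixes A B E N :: nat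
  assumes odd: "odd (B + E)"
    and o1: "real A + (B + E) / 2 \<le> (real N + A + B + (B + E) / 2) / 2" and o2: "B \<le> E"
    and o3: "2 + real A + B + E \<le> 1 + real A + N + (B + E) / 2"
  obtains x1 x2 x3 y1 y2 where
    "(x1 / (8 + 4 * real A + 2 * N + 3 * (B + E)), x2 / (8 + 4 * real A + 2 * N + 3 * (B + E)),
      x3 / (8 + 4 * real A + 2 * N + 3 * (B + E)), y1 / (8 + 4 * real A + 2 * N + 3 * (B + E)),
      y2 / (8 + 4 * real A + 2 * N + 3 * (B + E))) \<in> D4_points"
    "\<bar>x1 - (real A + (B + E) / 2)\<bar> \<le> 5" "\<bar>x2 - (real N + A + B + (B + E) / 2) / 2\<bar> \<le> 5"
    "\<bar>x3 - (real N + A + E + (B + E) / 2) / 2\<bar> \<le> 5" "\<bar>y1 - (2 + real A + B + E)\<bar> \<le> 5"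
    "\<bar>y2 - (1 + real A + N + (B + E) / 2)\<bar> \<le> 5"
proof -
  obtain j where j: "B + E = Suc (2 * j)" using odd by (metis oddE Suc_eq_plus1)
  have bc: "(2::int) ^ B * 2 ^ E = 2 * (2 ^ j)\<^sup>2"
    unfolding power_add[symmetric] j by (simp add: power_mult mult.commute flip: power_mult)
  interpret F: dihedral_family "2 ^ A" "2 ^ B" "2 ^ E" "2 ^ N" "2 ^ j"
    by unfold_locales (use bc in simp_all)
  define h where "h = (B + E) / (2::real)"
  have h: "h = j + 1/2" by (simp add: h_def j)
  have s: "F.s = 2 powr h"
    unfolding F.s_def h powr_add by (simp add: powr_realpow powr_half_sqrt)
  have pw: "real_of_int (2 ^ m) = 2 powr m" for m :: nat by (simp add: powr_realpow)
  have u: "F.u = 2 powr ((real N + A + B + h) / 2)"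
    unfolding F.u_def s of_int_mult pw powr_add[symmetric] by (simp add: powr_half_sqrt[symmetric] powr_powr)
  have v: "F.v = 2 powr ((real N + A + E + h) / 2)"
    unfolding F.v_def s of_int_mult pw powr_add[symmetric] by (simp add: powr_half_sqrt[symmetric] powr_powr)
  have as: "real_of_int (2 ^ A) * F.s = 2 powr (A + h)"
    unfolding s pw powr_add[symmetric] ..
  have p4: "(4::real) = 2 powr 2" by simp
  have M: "real_of_int (4 * 2 ^ A * 2 ^ B * 2 ^ E) = 2 powr (2 + real A + B + E)"
  proof -
    have "real_of_int (4 * 2 ^ A * 2 ^ B * 2 ^ E) = 4 * real_of_int (2 ^ A) * real_of_int (2 ^ B) * real_of_int (2 ^ E)"
      by simp
    then show ?thesis unfolding pw p4 powr_add[symmetric] .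
  qed
  have W: "real_of_int (2 * 2 ^ A * 2 ^ N) * F.s = 2 powr (1 + real A + N + h)"
  proof -
    have "real_of_int (2 * 2 ^ A * 2 ^ N) * F.s = 2 powr 1 * real_of_int (2 ^ A) * real_of_int (2 ^ N) * F.s"
      by simp
    then show ?thesis unfolding pw s powr_add[symmetric] .
  qed
  have D: "real_of_int \<bar>ring_disc 4 F.R\<bar> = 2 powr (8 + 4 * real A + 2 * N + 3 * (B + E))"
  proof -
    have "16 * (2 powr real A)\<^sup>2 * 2 powr real N * 2 powr real B * 2 powr real E * 2 powr h =
        2 powr (4 + 2 * real A + N + B + E + h)"
    proof -
      have p16: "(16::real) = 2 powr 4" by simp
      have pA: "((2::real) powr real A)\<^sup>2 = 2 powr (2 * real A)"
        by (simp add: power2_eq_square flip: powr_add)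
      show ?thesis unfolding p16 pA powr_add[symmetric] by simp
    qed
    then have "real_of_int \<bar>ring_disc 4 F.R\<bar> = (2 powr (4 + 2 * real A + N + B + E + h))\<^sup>2"
      unfolding F.abs_disc_R s by (simp add: powr_realpow)
    also have "\<dots> = 2 powr (2 * (4 + 2 * real A + N + B + E + h))"
      by (simp only: power2_eq_square powr_add[symmetric] mult_2)
    also have "2 * (4 + 2 * real A + N + B + E + h) = 8 + 4 * real A + 2 * N + 3 * (B + E)"
      by (simp add: h_def)
    finally show ?thesis .
  qed
  have mono: "x \<le> y \<Longrightarrow> (2::real) powr x \<le> 2 powr y" for x y by simp
  have h0: "0 \<le> A + h" by (simp add: h)
  have o1': "2 powr (A + h) \<le> 2 powr ((real N + A + B + h) / 2)" using o1 by (intro mono) (simp add: h_def)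
  have o2': "2 powr ((real N + A + B + h) / 2) \<le> 2 powr ((real N + A + E + h) / 2)" using o2 by (intro mono) simp
  have o3': "2 powr (2 + real A + B + E) \<le> 2 powr (1 + real A + N + h)" using o3 by (intro mono) (simp add: h_def)
  have h1: "1 \<le> 2 powr (A + h)" using h0 by (simp add: ge_one_powr_ge_zero)
  note l = F.succ_min_R[unfolded as u v, OF h1 o1' o2']
  have o3'': "real_of_int (4 * 2 ^ A * 2 ^ B * 2 ^ E) \<le> real_of_int (2 * 2 ^ A * 2 ^ N) * F.s"
    unfolding M W by (rule o3')
  note m = F.succ_min_C[OF o3'', unfolded M W]
  let ?l = "succ_min 4 F.R" and ?m = "succ_min 3 F.C" and ?d = "8 + 4 * real A + 2 * N + 3 * (B + E)"
  have close: "\<bar>log 2 x - y\<bar> \<le> 5" if "0 < x" "x \<le> 2 powr y" "2 powr y \<le> 32 * x" for x y :: real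
    using log_2_close[OF that] by simp
  note q4 = quartic_minima_bounds[OF F.small_split_R] and q3 = cubic_minima_bounds[OF F.small_split_C]
  have p: "0 < ?l 1" "0 < ?l 2" "0 < ?l 3" "0 < ?m 1" "0 < ?m 2" using q4(2,3,4) q3(1,2) by linarith+
  have lg: "log (real_of_int \<bar>ring_disc 4 F.R\<bar>) x = log 2 x / ?d" for x
    unfolding D by (simp add: log_def)
  have "minima_point F.R F.C \<in> D4_points"
    unfolding D4_points_def
    using split_ring.nondegenerate[OF small_split.axioms(1)[OF F.small_split_R]] F.G_ring_R F.cubic_resolvent_C
    by blast
  then have "(log 2 (?l 1) / ?d, log 2 (?l 2) / ?d, log 2 (?l 3) / ?d, log 2 (?m 1) / ?d, log 2 (?m 2) / ?d) \<in> D4_points"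
    by (simp only: minima_point_def Let_def lg)
  moreover have "\<bar>log 2 (?l 1) - (real A + (B + E) / 2)\<bar> \<le> 5"
    using close[OF p(1) l(1)] l(4) p(1) by (simp add: h_def)
  moreover have "\<bar>log 2 (?l 2) - (real N + A + B + (B + E) / 2) / 2\<bar> \<le> 5"
    using close[OF p(2) l(2)] l(5) p(2) by (simp add: h_def)
  moreover have "\<bar>log 2 (?l 3) - (real N + A + E + (B + E) / 2) / 2\<bar> \<le> 5"
    using close[OF p(3) l(3)] l(6) p(3) by (simp add: h_def)
  moreover have "\<bar>log 2 (?m 1) - (2 + real A + B + E)\<bar> \<le> 5"
    using close[OF p(4) m(1) m(3)] by simp
  moreover have "\<bar>log 2 (?m 2) - (1 + real A + N + (B + E) / 2)\<bar> \<le> 5"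
    using close[OF p(5) m(2) m(4)] by (simp add: h_def)
  ultimately show ?thesis by (rule that)
qed

lemma ratio_tendsto:
  fixes x d :: "nat \<Rightarrow> real" and p K :: real
  assumes x: "\<And>T. T \<ge> T0 \<Longrightarrow> \<bar>x T - real T * p\<bar> \<le> K" and d: "\<And>T. T \<ge> T0 \<Longrightarrow> \<bar>d T - T\<bar> \<le> K"
  shows "(\<lambda>T. x T / d T) \<longlonglongrightarrow> p"
proof -
  have K: "(\<lambda>T. K / real T) \<longlonglongrightarrow> 0"
    using tendsto_mult_right_zero[OF lim_inverse_n, of K] by (simp add: divide_inverse mult.commute)
  have gen: "(\<lambda>T. y T / real T) \<longlonglongrightarrow> q" if y: "\<And>T. T \<ge> T0 \<Longrightarrow> \<bar>y T - real T * q\<bar> \<le> K" for y :: "nat \<Rightarrow> real" and q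
  proof -
    have "(\<lambda>T. y T / real T - q) \<longlonglongrightarrow> 0"
    proof (rule Lim_null_comparison[OF _ K])
      show "\<forall>\<^sub>F T in sequentially. norm (y T / real T - q) \<le> K / real T"
        using eventually_ge_at_top[of T0] eventually_gt_at_top[of 0]
      proof eventually_elim
        case (elim T)
        have "y T / real T - q = (y T - real T * q) / real T" using elim by (simp add: field_simps)
        then show ?case using y[of T] elim by (simp add: divide_right_mono)
      qed
    qed
    then show ?thesis by (rule LIM_zero_cancel)
  qed
  have "(\<lambda>T. (x T / real T) / (d T / real T)) \<longlonglongrightarrow> p / 1"
    using gen[OF x] gen[of d 1] d by (intro tendsto_divide) auto
  moreover have "\<forall>\<^sub>F T in sequentially. (x T / real T) / (d T / real T) = x T / d T"
    using eventually_gt_at_top[of 0] by eventually_elim auto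
  ultimately show ?thesis using Lim_transform_eventually[of _ "p / 1"] by fastforce
qed

lemma strict_approximation:
  assumes t: "(p1, p2, p3, q1, q2) \<in> strict_region" and e: "0 < \<epsilon>"
  shows "\<exists>z\<in>D4_points. dist z (p1, p2, p3, q1, q2) < \<epsilon>"
proof -
  have st: "0 \<le> p1" "p1 < p2" "p2 < p3" "p1 + p2 + p3 = 1/2" "0 \<le> q1" "q1 < q2" "q1 + q2 = 1/2"
    "q1 < 2 * p1" "q2 < 2 * p2" using t by (auto simp: strict_region_def)
  \<comment> \<open>The exponents solve the linear system in which, up to constants, a s, u, v, a b
    c and a n s are 2 to the powers T p1, T p2, T p3, T q1 and T q2. Then 4 A + 2 N + 3 (B + E) is
    about T.\<close>
  define A where "A T = nat \<lfloor>real T * (2 * p1 - q1)\<rfloor>" for T :: nat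
  define N where "N T = nat \<lfloor>real T * (p2 + p3 - q1)\<rfloor>" for T :: nat
  define B where "B T = nat \<lfloor>real T * (2 * p2 - q2)\<rfloor>" for T :: nat
  define E0 where "E0 T = nat \<lfloor>real T * (2 * p3 - q2)\<rfloor>" for T :: nat
  \<comment> \<open>Raising this exponent by at most 1 fixes the parity of B + E.\<close>
  define E where "E T = (if even (B T + E0 T) then Suc (E0 T) else E0 T)" for T :: nat
  have fl: "\<bar>real (nat \<lfloor>x\<rfloor>) - x\<bar> \<le> 1" if "0 \<le> x" for x :: real using that by linarith
  have eA: "\<bar>A T - real T * (2 * p1 - q1)\<bar> \<le> 1" for T unfolding A_def using st by (intro fl) simp
  have eN: "\<bar>N T - real T * (p2 + p3 - q1)\<bar> \<le> 1" for T unfolding N_def using st by (intro fl) simp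
  have eB: "\<bar>B T - real T * (2 * p2 - q2)\<bar> \<le> 1" for T unfolding B_def using st by (intro fl) simp
  have eE0: "\<bar>E0 T - real T * (2 * p3 - q2)\<bar> \<le> 1" for T unfolding E0_def using st by (intro fl) simp
  have eE: "\<bar>E T - real T * (2 * p3 - q2)\<bar> \<le> 2" for T
  proof -
    have "real (E T) = real (E0 T) \<or> real (E T) = real (E0 T) + 1" by (simp add: E_def)
    then show ?thesis using eE0[of T] by linarith
  qed
  have odd: "odd (B T + E T)" for T by (simp add: E_def)
  have q2: "q2 = 1/2 - q1" and p3: "p3 = 1/2 - p1 - p2" using st by auto
  have lin: "\<bar>A T + (B T + E T) / 2 - real T * p1\<bar> \<le> 10"
    "\<bar>(real (N T) + A T + B T + (B T + E T) / 2) / 2 - real T * p2\<bar> \<le> 10"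
    "\<bar>(real (N T) + A T + E T + (B T + E T) / 2) / 2 - real T * p3\<bar> \<le> 10"
    "\<bar>(2 + real (A T) + B T + E T) - real T * q1\<bar> \<le> 10"
    "\<bar>(1 + real (A T) + N T + (B T + E T) / 2) - real T * q2\<bar> \<le> 10"
    "\<bar>(8 + 4 * real (A T) + 2 * N T + 3 * (B T + E T)) - real T\<bar> \<le> 30" for T
  proof -
    \<comment> \<open>With p3 and q2 eliminated and these products named, all estimates become
      linear.\<close>
    define X Y Z where "X = real T * p1" and "Y = real T * p2" and "Z = real T * q1"
    have h: "real T * (2 * p1 - q1) = 2 * X - Z" "real T * (p2 + p3 - q1) = T / 2 - X - Z"
      "real T * (2 * p2 - q2) = 2 * Y - T / 2 + Z" "real T * (2 * p3 - q2) = T / 2 - 2 * X - 2 * Y + Z"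
      "real T * p3 = T / 2 - X - Y" "real T * q2 = T / 2 - Z"
      unfolding p3 q2 X_def Y_def Z_def by (simp_all add: algebra_simps)
    have e: "\<bar>A T - (2 * X - Z)\<bar> \<le> 1" "\<bar>N T - (T / 2 - X - Z)\<bar> \<le> 1"
      "\<bar>B T - (2 * Y - T / 2 + Z)\<bar> \<le> 1" "\<bar>E T - (T / 2 - 2 * X - 2 * Y + Z)\<bar> \<le> 2"
      using eA[of T] eN[of T] eB[of T] eE[of T] unfolding h by auto
    note es = e[THEN abs_le_D1] e[THEN abs_le_D2]
    note X = X_def[symmetric] Y_def[symmetric] Z_def[symmetric]
    show "\<bar>A T + (B T + E T) / 2 - real T * p1\<bar> \<le> 10"
      unfolding X of_nat_add by (rule abs_leI) (use es in \<open>simp_all add: field_simps\<close>)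
    show "\<bar>(real (N T) + A T + B T + (B T + E T) / 2) / 2 - real T * p2\<bar> \<le> 10"
      unfolding X of_nat_add by (rule abs_leI) (use es in \<open>simp_all add: field_simps\<close>)
    show "\<bar>(real (N T) + A T + E T + (B T + E T) / 2) / 2 - real T * p3\<bar> \<le> 10"
      unfolding h of_nat_add by (rule abs_leI) (use es in \<open>simp_all add: field_simps\<close>)
    show "\<bar>(2 + real (A T) + B T + E T) - real T * q1\<bar> \<le> 10"
      unfolding X by (rule abs_leI) (use es in \<open>simp_all add: field_simps\<close>)
    show "\<bar>(1 + real (A T) + N T + (B T + E T) / 2) - real T * q2\<bar> \<le> 10"
      unfolding h of_nat_add by (rule abs_leI) (use es in \<open>simp_all add: field_simps\<close>)
    show "\<bar>(8 + 4 * real (A T) + 2 * N T + 3 * (B T + E T)) - real T\<bar> \<le> 30"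
      by (rule abs_leI) (use es in \<open>simp_all add: field_simps\<close>)
  qed
  \<comment> \<open>The smallest of the three gaps that the ordering hypotheses depend on. Once T g
    reaches 30 it outweighs two rounding errors of at most 10 each.\<close>
  define g where "g = min (p2 - p1) (min (p3 - p2) (q2 - q1))"
  have g: "0 < g" using st by (simp add: g_def)
  obtain T0 where T0: "30 / g < real T0" using reals_Archimedean2 by blast
  have big: "30 \<le> real T * (p2 - p1)" "30 \<le> real T * (p3 - p2)" "30 \<le> real T * (q2 - q1)" if "T \<ge> T0" for T
  proof -
    have "30 < real T0 * g" using T0 g by (simp add: field_simps)
    also have "\<dots> \<le> real T * g" using that g by (intro mult_right_mono) auto
    finally have "30 \<le> real T * g" by simp
    moreover have "real T * g \<le> real T * (p2 - p1)" "real T * g \<le> real T * (p3 - p2)" "real T * g \<le> real T * (q2 - q1)"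
      by (rule mult_left_mono; simp add: g_def)+
    ultimately show "30 \<le> real T * (p2 - p1)" "30 \<le> real T * (p3 - p2)" "30 \<le> real T * (q2 - q1)" by linarith+
  qed
  let ?d = "\<lambda>T. 8 + 4 * real (A T) + 2 * N T + 3 * (B T + E T)"
  have "\<exists>x1 x2 x3 y1 y2. (x1 / ?d T, x2 / ?d T, x3 / ?d T, y1 / ?d T, y2 / ?d T) \<in> D4_points \<and>
      \<bar>x1 - real T * p1\<bar> \<le> 30 \<and> \<bar>x2 - real T * p2\<bar> \<le> 30 \<and> \<bar>x3 - real T * p3\<bar> \<le> 30 \<and>
      \<bar>y1 - real T * q1\<bar> \<le> 30 \<and> \<bar>y2 - real T * q2\<bar> \<le> 30" if T: "T \<ge> T0" for T
  proof -
    have o1: "real (A T) + (B T + E T) / 2 \<le> (real (N T) + A T + B T + (B T + E T) / 2) / 2"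
      using lin(1,2)[of T] big(1)[OF T] unfolding abs_le_iff right_diff_distrib by linarith
    have "real (B T) \<le> real (E T)"
      using lin(2,3)[of T] big(2)[OF T] unfolding abs_le_iff right_diff_distrib by (simp add: field_simps)
    then have o2: "B T \<le> E T" by simp
    have o3: "2 + real (A T) + B T + E T \<le> 1 + real (A T) + N T + (B T + E T) / 2"
      using lin(4,5)[of T] big(3)[OF T] unfolding abs_le_iff right_diff_distrib by linarith
    show ?thesis
    proof (rule power_of_two_family[OF odd o1 o2 o3])
      fix x1 x2 x3 y1 y2
      assume z: "(x1 / ?d T, x2 / ?d T, x3 / ?d T, y1 / ?d T, y2 / ?d T) \<in> D4_points"
        "\<bar>x1 - (real (A T) + (B T + E T) / 2)\<bar> \<le> 5" "\<bar>x2 - (real (N T) + A T + B T + (B T + E T) / 2) / 2\<bar> \<le> 5"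
        "\<bar>x3 - (real (N T) + A T + E T + (B T + E T) / 2) / 2\<bar> \<le> 5" "\<bar>y1 - (2 + real (A T) + B T + E T)\<bar> \<le> 5"
        "\<bar>y2 - (1 + real (A T) + N T + (B T + E T) / 2)\<bar> \<le> 5"
      have "\<bar>x1 - real T * p1\<bar> \<le> 30" using z(2) lin(1)[of T] unfolding abs_le_iff by linarith
      moreover have "\<bar>x2 - real T * p2\<bar> \<le> 30" using z(3) lin(2)[of T] unfolding abs_le_iff by linarith
      moreover have "\<bar>x3 - real T * p3\<bar> \<le> 30" using z(4) lin(3)[of T] unfolding abs_le_iff by linarith
      moreover have "\<bar>y1 - real T * q1\<bar> \<le> 30" using z(5) lin(4)[of T] unfolding abs_le_iff by linarith
      moreover have "\<bar>y2 - real T * q2\<bar> \<le> 30" using z(6) lin(5)[of T] unfolding abs_le_iff by linarith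
      ultimately show ?thesis using z(1) by blast
    qed
  qed
  then have "\<exists>w. (fst w / ?d T, fst (snd w) / ?d T, fst (snd (snd w)) / ?d T,
        fst (snd (snd (snd w))) / ?d T, snd (snd (snd (snd w))) / ?d T) \<in> D4_points \<and>
      \<bar>fst w - real T * p1\<bar> \<le> 30 \<and> \<bar>fst (snd w) - real T * p2\<bar> \<le> 30 \<and>
      \<bar>fst (snd (snd w)) - real T * p3\<bar> \<le> 30 \<and> \<bar>fst (snd (snd (snd w))) - real T * q1\<bar> \<le> 30 \<and>
      \<bar>snd (snd (snd (snd w))) - real T * q2\<bar> \<le> 30" if "T \<ge> T0" for T
    using that by (metis fst_conv snd_conv)
  then obtain W where W: "\<And>T. T \<ge> T0 \<Longrightarrow> (fst (W T) / ?d T, fst (snd (W T)) / ?d T, fst (snd (snd (W T))) / ?d T,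
        fst (snd (snd (snd (W T)))) / ?d T, snd (snd (snd (snd (W T)))) / ?d T) \<in> D4_points \<and>
      \<bar>fst (W T) - real T * p1\<bar> \<le> 30 \<and> \<bar>fst (snd (W T)) - real T * p2\<bar> \<le> 30 \<and>
      \<bar>fst (snd (snd (W T))) - real T * p3\<bar> \<le> 30 \<and> \<bar>fst (snd (snd (snd (W T)))) - real T * q1\<bar> \<le> 30 \<and>
      \<bar>snd (snd (snd (snd (W T)))) - real T * q2\<bar> \<le> 30" by metis
  define x1 where "x1 T = fst (W T)" for T
  define x2 where "x2 T = fst (snd (W T))" for T
  define x3 where "x3 T = fst (snd (snd (W T)))" for T
  define y1 where "y1 T = fst (snd (snd (snd (W T))))" for T
  define y2 where "y2 T = snd (snd (snd (snd (W T))))" for T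
  have z: "\<And>T. T \<ge> T0 \<Longrightarrow>
      (x1 T / ?d T, x2 T / ?d T, x3 T / ?d T, y1 T / ?d T, y2 T / ?d T) \<in> D4_points"
    "\<And>T. T \<ge> T0 \<Longrightarrow> \<bar>x1 T - real T * p1\<bar> \<le> 30" "\<And>T. T \<ge> T0 \<Longrightarrow> \<bar>x2 T - real T * p2\<bar> \<le> 30"
    "\<And>T. T \<ge> T0 \<Longrightarrow> \<bar>x3 T - real T * p3\<bar> \<le> 30" "\<And>T. T \<ge> T0 \<Longrightarrow> \<bar>y1 T - real T * q1\<bar> \<le> 30"
    "\<And>T. T \<ge> T0 \<Longrightarrow> \<bar>y2 T - real T * q2\<bar> \<le> 30"
    using W by (simp_all only: x1_def x2_def x3_def y1_def y2_def)
  have lim: "(\<lambda>T. f T / ?d T) \<longlonglongrightarrow> q" if f: "\<And>T. T \<ge> T0 \<Longrightarrow> \<bar>f T - real T * q\<bar> \<le> 30" for f q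
  proof (rule ratio_tendsto)
    show "\<bar>f T - real T * q\<bar> \<le> 30" if "T \<ge> T0" for T using that by (rule f)
    show "\<bar>?d T - real T\<bar> \<le> 30" for T by (rule lin(6))
  qed
  have "(\<lambda>T. (x1 T / ?d T, x2 T / ?d T, x3 T / ?d T, y1 T / ?d T, y2 T / ?d T)) \<longlonglongrightarrow> (p1, p2, p3, q1, q2)"
    by (intro tendsto_Pair) (rule lim, rule z(2-6), assumption)+
  then have "\<forall>\<^sub>F T in sequentially. dist (x1 T / ?d T, x2 T / ?d T, x3 T / ?d T, y1 T / ?d T, y2 T / ?d T) (p1, p2, p3, q1, q2) < \<epsilon>"
    using e by (rule tendstoD)
  then have "\<forall>\<^sub>F T in sequentially. T \<ge> T0 \<and> dist (x1 T / ?d T, x2 T / ?d T, x3 T / ?d T, y1 T / ?d T, y2 T / ?d T) (p1, p2, p3, q1, q2) < \<epsilon>"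
    by (intro eventually_conj eventually_ge_at_top)
  then obtain T where "T \<ge> T0" "dist (x1 T / ?d T, x2 T / ?d T, x3 T / ?d T, y1 T / ?d T, y2 T / ?d T) (p1, p2, p3, q1, q2) < \<epsilon>"
    unfolding eventually_sequentially by blast
  then show ?thesis using z(1) by blast
qed

text \<open>Convexity: any positive step from a point of the closed region towards a strict point
  makes the weak inequalities strict where this is required.\<close>

lemma strict_region_segment:
  assumes p: "p \<in> exponent_region 0" and z: "z \<in> strict_region" and l: "0 < l" "l \<le> 1"
  shows "p + l *\<^sub>R (z - p) \<in> strict_region"
proof -
  obtain p1 p2 p3 q1 q2 where pe: "p = (p1, p2, p3, q1, q2)" by (cases p)
  obtain z1 z2 z3 w1 w2 where ze: "z = (z1, z2, z3, w1, w2)" by (cases z)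
  have weak: "0 \<le> x + l * (y - x)" if "0 \<le> x" "0 \<le> y" for x y :: real
  proof -
    have "x + l * (y - x) = (1 - l) * x + l * y" by (simp add: algebra_simps)
    then show ?thesis using that l by simp
  qed
  have strict: "x + l * (y - x) < x' + l * (y' - x')" if "x \<le> x'" "y < y'" for x y x' y' :: real
  proof -
    have "(1 - l) * x \<le> (1 - l) * x'" using that l by (intro mult_left_mono) auto
    moreover have "l * y < l * y'" using that l by simp
    ultimately show ?thesis by (simp add: algebra_simps)
  qed
  have P: "0 \<le> p1" "p1 \<le> p2" "p2 \<le> p3" "p1 + p2 + p3 = 1/2" "0 \<le> q1" "q1 \<le> q2" "q1 + q2 = 1/2"
    "q1 \<le> 2 * p1" "q2 \<le> 2 * p2" using p by (auto simp: pe exponent_region_def)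
  have Z: "0 \<le> z1" "z1 < z2" "z2 < z3" "z1 + z2 + z3 = 1/2" "0 \<le> w1" "w1 < w2" "w1 + w2 = 1/2"
    "w1 < 2 * z1" "w2 < 2 * z2" using z by (auto simp: ze strict_region_def)
  have s3: "(p1 + l * (z1 - p1)) + (p2 + l * (z2 - p2)) + (p3 + l * (z3 - p3)) = 1/2"
  proof -
    have "(p1 + l * (z1 - p1)) + (p2 + l * (z2 - p2)) + (p3 + l * (z3 - p3)) =
        (p1 + p2 + p3) + l * ((z1 + z2 + z3) - (p1 + p2 + p3))" by (simp add: algebra_simps)
    then show ?thesis using P Z by simp
  qed
  have s2: "(q1 + l * (w1 - q1)) + (q2 + l * (w2 - q2)) = 1/2"
  proof -
    have "(q1 + l * (w1 - q1)) + (q2 + l * (w2 - q2)) =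
        (q1 + q2) + l * ((w1 + w2) - (q1 + q2))" by (simp add: algebra_simps)
    then show ?thesis using P Z by simp
  qed
  have d: "q1 + l * (w1 - q1) < 2 * (p1 + l * (z1 - p1))" "q2 + l * (w2 - q2) < 2 * (p2 + l * (z2 - p2))"
    using strict[OF P(8) Z(8)] strict[OF P(9) Z(9)] by (simp_all add: algebra_simps)
  show ?thesis
    using weak[OF P(1) Z(1)] strict[OF P(2) Z(2)] strict[OF P(3) Z(3)] s3 weak[OF P(5) Z(5)]
      strict[OF P(6) Z(6)] s2 d
    by (simp add: pe ze strict_region_def)
qed

lemma exponent_region_subset: "exponent_region 0 \<subseteq> P4 D4"
proof
  fix p assume p: "p \<in> exponent_region 0"
  have "(7/50, 4/25, 1/5, 1/5, 3/10) \<in> strict_region" "(7/50, 4/25, 1/5, 21/100, 29/100) \<in> strict_region"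
    by (simp_all add: strict_region_def)
  moreover have "(7/50, 4/25, 1/5, 1/5, 3/10 :: real) \<noteq> (7/50, 4/25, 1/5 :: real, 21/100 :: real, 29/100)" by simp
  \<comment> \<open>Two different strict points are at hand so that one of them differs from p, even
    when p is itself strict.\<close>
  ultimately obtain z where z: "z \<in> strict_region" "z \<noteq> p" by metis
  have "p islimpt D4_points"
    unfolding islimpt_approachable
  proof (intro allI impI)
    fix \<epsilon> :: real assume \<epsilon>: "0 < \<epsilon>"
    define l where "l = min 1 (\<epsilon> / (2 * norm (z - p)))"
    have nz: "0 < norm (z - p)" using z(2) by simp
    have l: "0 < l" "l \<le> 1" using nz \<epsilon> by (simp_all add: l_def)
    define t where "t = p + l *\<^sub>R (z - p)"
    have tp: "dist t p = l * norm (z - p)" using l by (simp add: t_def dist_norm)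
    then have tp0: "0 < dist t p" using l nz by simp
    have "l * norm (z - p) \<le> \<epsilon> / (2 * norm (z - p)) * norm (z - p)"
      by (intro mult_right_mono) (simp_all add: l_def)
    then have tp1: "dist t p \<le> \<epsilon> / 2" using nz tp by simp
    obtain t1 t2 t3 t4 t5 where te: "t = (t1, t2, t3, t4, t5)" by (cases t)
    have "t \<in> strict_region" unfolding t_def by (rule strict_region_segment[OF p z(1) l])
    \<comment> \<open>Approximating t to within less than its distance from p keeps x different from
      p, as a limit point demands.\<close>
    then obtain x where x: "x \<in> D4_points" "dist x t < dist t p"
      using strict_approximation[of t1 t2 t3 t4 t5 "dist t p"] tp0 unfolding te by blast
    have "dist x p < \<epsilon>" using dist_triangle[of x p t] x(2) tp1 by linarith
    moreover have "x \<noteq> p" using x(2) by (auto simp: dist_commute)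
    ultimately show "\<exists>x'\<in>D4_points. x' \<noteq> p \<and> dist x' p < \<epsilon>" using x(1) by blast
  qed
  then show "p \<in> P4 D4" by (simp add: P4_def D4_points_def)
qed

theorem theorem5p3:
  shows "P4 D4 = {(p1, p2, p3, q1, q2) | p1 p2 p3 q1 q2 :: real.
    0 \<le> p1 \<and> p1 \<le> p2 \<and> p2 \<le> p3 \<and> p1 + p2 + p3 = 1 / 2 \<and>
    0 \<le> q1 \<and> q1 \<le> q2 \<and> q1 + q2 = 1 / 2 \<and>
    q1 \<le> 2 * p1 \<and> q2 \<le> 2 * p2}"
proof -
  have "P4 D4 = exponent_region 0"
    using P4_D4_subset exponent_region_subset by (rule subset_antisym)
  then show ?thesis by (auto simp: exponent_region_def)
qed

end
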